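(* Let $d>1$ be an integer, $I=[0,1]$, $T>0$, and assume that $\mathbf a$, $\mathbf s$, $x^0$, $m^0$ satisfy the following hypotheses. (A1) $\mathbf a:\mathbb R^d\to\mathbb R^d$ is Lipschitz with $\mathrm{Lip}(\mathbf a)=L$, and $\mathbf a(0)=0$. (A2) $m^0\in L^\infty(I^d)$, $\int_{I^d}m^0(s)\,ds=1$, and $\frac1M\le m^0\le M$ for some $M>1$; $x^0:I^d\to\mathbb R^d$ satisfies $|x^0|\le X$ for some $X>0$ and is bi-Lipschitz, i.e. there is $L_0>0$ such that $\frac1{L_0}|s_1-s_2|\le|x^0(s_1)-x^0(s_2)|\le L_0|s_1-s_2|$ for all $s_1,s_2\in I^d$. (A3) $\mathbf s:\mathbb R^d\to\mathbb R^d$ is measurable and odd, and there is a locally integrable function $\mathbf S\ge0$ on $\mathbb R^d$ such that $|\mathbf s(x_1)-\mathbf s(x_2)|\le\mathbf S(x_2)\,|x_1-x_2|$ for all $x_1,x_2\in\mathbb R^d$. Let $(x,m)\in C^1([0,T];C(I^d))\oplus C^1([0,T];L^\infty(I^d))$ (with $x$ being $\mathbb R^d$-valued and $m$ real-valued) be the solution of the graph limit equation $$\partial_t x(t,s)=\int_{I^d} m(t,s_\ast)\,\mathbf a(x(t,s_\ast)-x(t,s))\,ds_\ast,\quad \partial_t m(t,s)=\Psi(s,x(t,\cdot),m(t,\cdot)),\quad x(0,\cdot)=x^0,\ m(0,\cdot)=m^0.$$ Assume that $\mathbf s$ is such that, for every $N\ge1$, the system of $N^d$ opinions and weights defined in the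 context has a well defined flow, i.e. a unique solution $(\mathbf x_N,\mathbf m_N)\in C^1([0,T];\mathbb R^{dN^d}\times\mathbb R^{N^d})$, and let $\widetilde x_N,\widetilde m_N$ be the associated step functions defined in the context. Then $$\|\widetilde x_N-x\|_{C([0,T];L^1(I^d))}+\|\widetilde m_N-m\|_{C([0,T];L^1(I^d))}\longrightarrow0\quad\text{as }N\to\infty.$$
   Context: For $x:I^d\to\mathbb R^d$, $m:I^d\to\mathbb R$ and $s\in I^d$, the functional $\Psi$ is $$\Psi(s,x(\cdot),m(\cdot)):=m(s)\iint_{I^{2d}}m(s_\ast)m(s_{\ast\ast})\big\langle\mathbf a(x(s_{\ast\ast})-x(s))+\mathbf a(x(s_{\ast\ast})-x(s_\ast)),\ \mathbf s(x(s)-x(s_\ast))\big\rangle\,ds_\ast\,ds_{\ast\ast},$$ where $\langle\cdot,\cdot\rangle$ is the Euclidean inner product. Fix, for each $N$, a bijection $\sigma:\{1,\dots,N\}^d\to\{1,\dots,N^d\}$, and for $\mathbf i=(i_1,\dots,i_d)\in\{1,\dots,N\}^d$ let $\mathcal Q_{\mathbf i}:=\prod_{k=1}^d\big[\frac{i_k-1}N,\frac{i_k}N\big]$. The system is: for $i=1,\dots,N^d$, $$\dot x_i(t)=\frac1{N^d}\sum_{j=1}^{N^d}m_j(t)\,\mathbf a(x_j(t)-x_i(t)),\qquad\dot m_i(t)=\psi_i^N(\mathbf x_N(t),\mathbf m_N(t)),$$ with $x_i(t)\in\mathbb R^d$, $m_i(t)\in\mathbb R$, $\mathbf x_N=(x_1,\dots,x_{N^d})$,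 $\mathbf m_N=(m_1,\dots,m_{N^d})$, and initial data $$x_i(0)=N^d\int_{\mathcal Q_{\sigma^{-1}(i)}}x^0(s)\,ds,\qquad m_i(0)=N^d\int_{\mathcal Q_{\sigma^{-1}(i)}}m^0(s)\,ds.$$ The step functions are $$\widetilde x_N(t,s):=\sum_{\mathbf i}x_{\sigma(\mathbf i)}(t)\mathbf 1_{\mathcal Q_{\mathbf i}}(s),\qquad\widetilde m_N(t,s):=\sum_{\mathbf i}m_{\sigma(\mathbf i)}(t)\mathbf 1_{\mathcal Q_{\mathbf i}}(s)$$ (values on the measure-zero cube boundaries are irrelevant), and $$\psi_i^N(\mathbf x_N,\mathbf m_N):=N^d\int_{\mathcal Q_{\sigma^{-1}(i)}}\Psi(s,\widetilde x_N,\widetilde m_N)\,ds=\frac1{N^{2d}}m_i\sum_{j,k=1}^{N^d}m_jm_k\big\langle\mathbf a(x_k-x_i)+\mathbf a(x_k-x_j),\mathbf s(x_i-x_j)\big\rangle.$$ *)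

theory Defs
  imports "HOL-Analysis.Analysis" "HOL-Probability.Essential_Supremum"
begin

text \<open>
  \<open>\<real>\<^sup>d\<close> is \<^typ>\<open>real ^ 'n\<close> with \<open>d = CARD('n)\<close>. Functions on \<open>I\<^sup>d\<close> are total functions whose values off
  \<open>cube\<close> play no role. Integrals are Lebesgue integrals with respect to the completed measure
  \<^const>\<open>lebesgue\<close>, and norms take values in \<^typ>\<open>ennreal\<close>, so that they are never silently
  \<open>0\<close> for an unbounded or non-integrable function.
\<close>

definition cube :: "(real ^ 'n) set" where
  "cube = cbox 0 1"

subsection \<open>Norms and C1 curves in function spaces\<close>

definition sup_norm :: "(real ^ 'n \<Rightarrow> 'b::real_normed_vector) \<Rightarrow> ennreal" where
  "sup_norm f = (SUP s\<in>cube. ennreal (norm (f s)))"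

definition Linf_norm :: "(real ^ 'n \<Rightarrow> 'b::real_normed_vector) \<Rightarrow> ennreal" where
  "Linf_norm f = esssup (lebesgue_on cube) (\<lambda>s. ennreal (norm (f s)))"

definition L1_norm :: "(real ^ 'n \<Rightarrow> 'b::real_normed_vector) \<Rightarrow> ennreal" where
  "L1_norm f = (\<integral>\<^sup>+ s. ennreal (norm (f s)) \<partial>lebesgue_on cube)"

definition C_L1_norm :: "real \<Rightarrow> (real \<Rightarrow> real ^ 'n \<Rightarrow> 'b::real_normed_vector) \<Rightarrow> ennreal" where
  "C_L1_norm T u = (SUP t\<in>{0..T}. L1_norm (u t))"

definition C_space :: "(real ^ 'n \<Rightarrow> 'b::real_normed_vector) set" where
  "C_space = {f. continuous_on cube f}"

definition Linf_space :: "(real ^ 'n \<Rightarrow> 'b::real_normed_vector) set" where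
  "Linf_space = {f. f \<in> borel_measurable (lebesgue_on cube) \<and> Linf_norm f < \<infinity>}"

text \<open>
  \<open>C1_with_derivative E nrm T u v\<close>: the curve \<open>u\<close> belongs to \<open>C\<^sup>1([0,T];(E,nrm))\<close> and has derivative
  \<open>v\<close>; both limits, of the difference quotients and of the derivative, are taken in the norm \<open>nrm\<close>
  and are one-sided at the endpoints.
\<close>

definition C1_with_derivative ::
  "('a \<Rightarrow> 'b::real_vector) set \<Rightarrow> (('a \<Rightarrow> 'b) \<Rightarrow> ennreal) \<Rightarrow> real \<Rightarrow>
   (real \<Rightarrow> 'a \<Rightarrow> 'b) \<Rightarrow> (real \<Rightarrow> 'a \<Rightarrow> 'b) \<Rightarrow> bool" where
  "C1_with_derivative E nrm T u v \<longleftrightarrow>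
     (\<forall>t\<in>{0..T}.
        u t \<in> E \<and> v t \<in> E \<and>
        ((\<lambda>r. nrm (\<lambda>s. (1 / (r - t)) *\<^sub>R (u r s - u t s) - v t s)) \<longlongrightarrow> 0) (at t within {0..T}) \<and>
        ((\<lambda>r. nrm (\<lambda>s. v r s - v t s)) \<longlongrightarrow> 0) (at t within {0..T}))"

subsection \<open>The graph limit equation\<close>

definition Psi ::
  "(real ^ 'n \<Rightarrow> real ^ 'n) \<Rightarrow> (real ^ 'n \<Rightarrow> real ^ 'n) \<Rightarrow>
   real ^ 'n \<Rightarrow> (real ^ 'n \<Rightarrow> real ^ 'n) \<Rightarrow> (real ^ 'n \<Rightarrow> real) \<Rightarrow> real" where
  "Psi \<a> \<s> s x m =
     m s * (LINT p:cube \<times> cube|lebesgue.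
       (case p of (s1, s2) \<Rightarrow>
          m s1 * m s2 * ((\<a> (x s2 - x s) + \<a> (x s2 - x s1)) \<bullet> \<s> (x s - x s1))))"

text \<open>
  The equation for \<open>m\<close> is an identity in \<open>L\<^sup>\<infinity>(I\<^sup>d)\<close>, hence holds for almost every \<open>s\<close> at each time,
  whereas the equation for \<open>x\<close> is an identity in \<open>C(I\<^sup>d)\<close>.
\<close>

definition graph_limit_solution ::
  "(real ^ 'n \<Rightarrow> real ^ 'n) \<Rightarrow> (real ^ 'n \<Rightarrow> real ^ 'n) \<Rightarrow>
   (real ^ 'n \<Rightarrow> real ^ 'n) \<Rightarrow> (real ^ 'n \<Rightarrow> real) \<Rightarrow> real \<Rightarrow>
   (real \<Rightarrow> real ^ 'n \<Rightarrow> real ^ 'n) \<Rightarrow> (real \<Rightarrow> real ^ 'n \<Rightarrow> real) \<Rightarrow> bool" where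
  "graph_limit_solution \<a> \<s> x0 m0 T x m \<longleftrightarrow>
     (\<exists>x' m'.
        C1_with_derivative C_space sup_norm T x x' \<and>
        C1_with_derivative Linf_space Linf_norm T m m' \<and>
        (\<forall>t\<in>{0..T}. \<forall>s\<in>cube.
           x' t s = (LINT s1:cube|lebesgue. m t s1 *\<^sub>R \<a> (x t s1 - x t s))) \<and>
        (\<forall>t\<in>{0..T}. AE s in lebesgue_on cube. m' t s = Psi \<a> \<s> s (x t) (m t))) \<and>
     (\<forall>s\<in>cube. x 0 s = x0 s) \<and>
     (AE s in lebesgue_on cube. m 0 s = m0 s)"

subsection \<open>The system of opinions and weights\<close>

definition multi_indices :: "nat \<Rightarrow> (nat ^ 'n) set" where
  "multi_indices N = {i. \<forall>k. i $ k \<in> {1..N}}"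

definition cell :: "nat \<Rightarrow> nat ^ 'n \<Rightarrow> (real ^ 'n) set" where
  "cell N i = cbox (\<chi> k. (real (i $ k) - 1) / real N) (\<chi> k. real (i $ k) / real N)"

definition cell_average ::
  "nat \<Rightarrow> nat ^ 'n \<Rightarrow> (real ^ 'n \<Rightarrow> 'b::euclidean_space) \<Rightarrow> 'b" where
  "cell_average N i f = (real N ^ CARD('n)) *\<^sub>R (LINT s:cell N i|lebesgue. f s)"

definition step_function ::
  "nat \<Rightarrow> (nat ^ 'n \<Rightarrow> nat) \<Rightarrow> (nat \<Rightarrow> 'b::real_vector) \<Rightarrow> real ^ 'n \<Rightarrow> 'b" where
  "step_function N \<sigma> y s = (\<Sum>i\<in>multi_indices N. indicat_real (cell N i) s *\<^sub>R y (\<sigma> i))"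

definition psi ::
  "(real ^ 'n \<Rightarrow> real ^ 'n) \<Rightarrow> (real ^ 'n \<Rightarrow> real ^ 'n) \<Rightarrow> nat \<Rightarrow> (nat ^ 'n \<Rightarrow> nat) \<Rightarrow> nat \<Rightarrow>
   (nat \<Rightarrow> real ^ 'n) \<Rightarrow> (nat \<Rightarrow> real) \<Rightarrow> real" where
  "psi \<a> \<s> N \<sigma> i y n =
     cell_average N (inv_into (multi_indices N) \<sigma> i)
       (\<lambda>s. Psi \<a> \<s> s (step_function N \<sigma> y) (step_function N \<sigma> n))"

text \<open>
  \<open>y t i\<close> and \<open>n t i\<close> are the \<open>i\<close>-th opinion and weight at time \<open>t\<close>; only the indices
  \<open>i \<in> {1..N\<^sup>d}\<close> matter. Continuity of the right-hand sides along the solution is the \<open>C\<^sup>1\<close> requirement.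
\<close>

definition particle_solution ::
  "(real ^ 'n \<Rightarrow> real ^ 'n) \<Rightarrow> (real ^ 'n \<Rightarrow> real ^ 'n) \<Rightarrow>
   (real ^ 'n \<Rightarrow> real ^ 'n) \<Rightarrow> (real ^ 'n \<Rightarrow> real) \<Rightarrow> real \<Rightarrow> nat \<Rightarrow> (nat ^ 'n \<Rightarrow> nat) \<Rightarrow>
   (real \<Rightarrow> nat \<Rightarrow> real ^ 'n) \<Rightarrow> (real \<Rightarrow> nat \<Rightarrow> real) \<Rightarrow> bool" where
  "particle_solution \<a> \<s> x0 m0 T N \<sigma> y n \<longleftrightarrow>
     (\<forall>i\<in>{1..N ^ CARD('n)}.
        (let F = (\<lambda>t. (1 / real N ^ CARD('n)) *\<^sub>R
                       (\<Sum>j = 1..N ^ CARD('n). n t j *\<^sub>R \<a> (y t j - y t i)));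
             G = (\<lambda>t. psi \<a> \<s> N \<sigma> i (y t) (n t))
         in (\<forall>t\<in>{0..T}.
               ((\<lambda>r. y r i) has_vector_derivative F t) (at t within {0..T}) \<and>
               ((\<lambda>r. n r i) has_vector_derivative G t) (at t within {0..T})) \<and>
            continuous_on {0..T} F \<and> continuous_on {0..T} G) \<and>
        y 0 i = cell_average N (inv_into (multi_indices N) \<sigma> i) x0 \<and>
        n 0 i = cell_average N (inv_into (multi_indices N) \<sigma> i) m0)"

definition unique_particle_solution ::
  "(real ^ 'n \<Rightarrow> real ^ 'n) \<Rightarrow> (real ^ 'n \<Rightarrow> real ^ 'n) \<Rightarrow>
   (real ^ 'n \<Rightarrow> real ^ 'n) \<Rightarrow> (real ^ 'n \<Rightarrow> real) \<Rightarrow> real \<Rightarrow> nat \<Rightarrow> (nat ^ 'n \<Rightarrow> nat) \<Rightarrow>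
   (real \<Rightarrow> nat \<Rightarrow> real ^ 'n) \<Rightarrow> (real \<Rightarrow> nat \<Rightarrow> real) \<Rightarrow> bool" where
  "unique_particle_solution \<a> \<s> x0 m0 T N \<sigma> y n \<longleftrightarrow>
     particle_solution \<a> \<s> x0 m0 T N \<sigma> y n \<and>
     (\<forall>z p. particle_solution \<a> \<s> x0 m0 T N \<sigma> z p \<longrightarrow>
        (\<forall>t\<in>{0..T}. \<forall>i\<in>{1..N ^ CARD('n)}. z t i = y t i \<and> p t i = n t i))"

subsection \<open>Hypotheses\<close>

definition has_Lip :: "('a::metric_space \<Rightarrow> 'b::metric_space) \<Rightarrow> real \<Rightarrow> bool" where
  "has_Lip f L \<longleftrightarrow> L-lipschitz_on UNIV f \<and> (\<forall>C. C-lipschitz_on UNIV f \<longrightarrow> L \<le> C)"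

text \<open>
  Locally integrable functions are allowed to be infinite on a null set, which is where singularities
  such as that of \<open>2 / \<bar>z\<bar>\<close> at the origin (the bound for \<open>z / \<bar>z\<bar>\<close>) live.
\<close>

definition locally_integrable :: "(real ^ 'n \<Rightarrow> ennreal) \<Rightarrow> bool" where
  "locally_integrable S \<longleftrightarrow>
     S \<in> borel_measurable lebesgue \<and> (\<forall>K. compact K \<longrightarrow> (\<integral>\<^sup>+ z\<in>K. S z \<partial>lebesgue) < \<infinity>)"

end

theory Submission
  imports Defs "HOL-Probability.Probability_Measure"
begin

text \<open>
  The step functions built from the particles solve the graph limit equation themselves, outside the
  null set of cell boundaries, with the cell averages of \<open>x0\<close> and \<open>m0\<close> as initial data. So it suffices
  to show that the equation is stable in \<open>L\<^sup>1\<close>, uniformly in \<open>N\<close>, and that cell averages converge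
  in \<open>L\<^sup>1\<close>.

  Oddness of \<open>\<s>\<close> conserves the total mass and the weights stay positive, which bounds the opinions and
  then the weights independently of \<open>N\<close>. In the stability estimate the only singular term is
  \<open>S (x s - x s1)\<close>, evaluated along the limit solution. The latter satisfies
  \<open>norm (x t s - x t s1) \<ge> c * norm (s - s1)\<close>, because this holds at time \<open>0\<close> and the velocity field is
  Lipschitz; hence the image of Lebesgue measure under \<open>x t\<close> has bounded density and
  \<open>\<integral> S (x s - x s1) ds1\<close> is bounded uniformly in \<open>s\<close>.

  All Gronwall arguments work with a one-point growth condition on the difference quotients, so that
  no integration in time, and no joint measurability in time and space, is needed.
\<close>

section \<open>Local Gronwall inequalities\<close>

text \<open>The comparison is asymmetric by necessity. A step function collapses each cell to one
  point, so pairs inside a cell have difference 0, where the modulus may be infinite. The inequality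
  for \<open>\<s>\<close> carries its weight at \<open>z2\<close> alone, and \<open>z2\<close> is
  always placed on the limit solution. For a map that shrinks distances at most by a factor
  \<open>c\<close>, preimages of balls have diameter at most a constant times the radius over
  \<open>c\<close>; a Vitali covering with balls enlarged five times turns this into the density
  bound \<open>(10 / c) ^ d\<close>, with no differentiability of the map involved. The double
  integral in \<open>Psi\<close> factorises: integrating out the second variable leaves the velocity
  field, which is Lipschitz. The singularity then sits in a kernel on pairs of points whose row and
  column integrals are both bounded, which is what an \<open>L1\<close> estimate needs. The a priori
  bounds form a chain: positivity needs only some bound for the given \<open>N\<close>, while the
  bounds uniform in \<open>N\<close> need positivity, because positive weights of mean one control
  velocities and rates through the average weight instead of the largest one.\<close>

lemma gronwall_local:
  fixes e :: "real \<Rightarrow> real"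
  assumes C: "0 \<le> C" and pos: "\<And>t. t \<in> {0..T} \<Longrightarrow> 0 \<le> e t"
    and loc: "\<And>t \<epsilon>. t \<in> {0..T} \<Longrightarrow> 0 < \<epsilon> \<Longrightarrow>
      \<forall>\<^sub>F r in at t within {0..T}. \<bar>e r - e t\<bar> \<le> \<bar>r - t\<bar> * (C * e t + \<epsilon>)"
    and t: "t \<in> {0..T}"
  shows "e t \<le> e 0 * exp (C * t)"
proof -
  \<comment> \<open>Integrating factor: \<open>g\<close> is shown to grow with slope at most
    \<epsilon>, for every \<epsilon>. Bisection stands in for integration, since bounds on
    increments of \<open>g\<close> add up over adjacent intervals and so only short intervals around
    each point matter.\<close>
  define g where "g r = e r * exp (- C * r)" for r
  have main: "g t - g 0 \<le> \<epsilon> * t" if \<epsilon>: "0 < \<epsilon>" for \<epsilon>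
  proof -
    define P where "P a b \<longleftrightarrow> (0 \<le> a \<and> b \<le> t \<longrightarrow> g b - g a \<le> \<epsilon> * (b - a))" for a b
    have "P 0 t"
    proof (rule Bolzano)
      show "0 \<le> t" using t by simp
      show "P a c" if "P a b" "P b c" "a \<le> b" "b \<le> c" for a b c
        using that by (auto simp: P_def algebra_simps)
      fix x assume x: "0 \<le> x" "x \<le> t"
      then have xT: "x \<in> {0..T}" using t by auto
      have ex: "0 \<le> e x" using pos xT .
      have "\<forall>\<^sub>F r in at x within {0..T}. \<bar>e r - e x\<bar> \<le> \<bar>r - x\<bar> * (C * e x + \<epsilon>/2 * exp (- C * T))"
        using loc[OF xT, of "\<epsilon>/2 * exp (- C * T)"] \<epsilon> by simp
      then obtain d where d: "d > 0"
        and d': "\<And>r. r \<in> {0..T} \<Longrightarrow> r \<noteq> x \<Longrightarrow> dist r x < d \<Longrightarrow>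
           \<bar>e r - e x\<bar> \<le> \<bar>r - x\<bar> * (C * e x + \<epsilon>/2 * exp (- C * T))"
        unfolding eventually_at by blast
      have dd: "\<bar>e r - e x\<bar> \<le> \<bar>r - x\<bar> * (C * e x + \<epsilon>/2 * exp (- C * T))"
        if "r \<in> {0..T}" "\<bar>r - x\<bar> < d" for r
        using d'[of r] that by (cases "r = x") (auto simp: dist_real_def)
      \<comment> \<open>The three bounds keep \<open>a\<close> and \<open>b\<close> inside the
        neighbourhood of the hypothesis, give \<open>C * h \<le> 1\<close> on the left of
        \<open>x\<close>, and make the quadratic error \<open>C\<^sup>2 * h\<^sup>2 * e x\<close> at
        most \<open>\<epsilon>/2 * h\<close>.\<close>
      define \<delta> where "\<delta> = min d (min (1 / (C + 1)) (\<epsilon> / 2 / (C\<^sup>2 * e x + 1)))"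
      have q: "0 < C\<^sup>2 * e x + 1" using ex by (simp add: add_nonneg_pos)
      have \<delta>: "0 < \<delta>" using d C \<epsilon> q by (auto simp: \<delta>_def)
      have "P a b" if ab: "a \<le> x" "x \<le> b" "b - a < \<delta>" for a b
        unfolding P_def
      proof (intro impI, elim conjE)
        assume a0: "0 \<le> a" and bt: "b \<le> t"
        have bT: "b \<in> {0..T}" "a \<in> {0..T}" using a0 bt ab t by auto
        have scale: "h * (\<epsilon>/2 * exp (- C * T)) * exp (- C * r) \<le> \<epsilon>/2 * h" if "0 \<le> h" "0 \<le> r" for h r
        proof -
          have "exp (- C * T) * exp (- C * r) \<le> 1"
            using C t that by (intro mult_le_one) auto
          then have "(h * (\<epsilon>/2)) * (exp (- C * T) * exp (- C * r)) \<le> (h * (\<epsilon>/2)) * 1"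
            using that \<epsilon> by (intro mult_left_mono) auto
          then show ?thesis by (simp add: algebra_simps)
        qed
        have 1: "g b - g x \<le> \<epsilon>/2 * (b - x)"
        proof -
          let ?h = "b - x"
          have "e b \<le> e x * (1 + C * ?h) + ?h * (\<epsilon>/2 * exp (- C * T))"
            using dd[OF bT(1)] ab by (auto simp: \<delta>_def algebra_simps)
          then have "g b \<le> (e x * (1 + C * ?h) + ?h * (\<epsilon>/2 * exp (- C * T))) * exp (- C * b)"
            by (simp add: g_def)
          also have "\<dots> = e x * (1 + C * ?h) * exp (- C * b) + ?h * (\<epsilon>/2 * exp (- C * T)) * exp (- C * b)"
            by (simp add: algebra_simps)
          also have "\<dots> \<le> e x * (1 + C * ?h) * exp (- C * b) + \<epsilon>/2 * ?h"
            using scale[of ?h b] ab x by simp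
          also have "e x * (1 + C * ?h) * exp (- C * b) \<le> e x * exp (C * ?h) * exp (- C * b)"
            using ex exp_ge_add_one_self[of "C * ?h"] by (intro mult_right_mono mult_left_mono) auto
          also have "\<dots> = g x"
            by (simp add: g_def mult.assoc flip: exp_add) (simp add: algebra_simps)
          finally show ?thesis by simp
        qed
        \<comment> \<open>On the left the hypothesis is still centred at \<open>x\<close>, so it
          gives the factor \<open>1 - C * h\<close> in place of \<open>exp (- C * h)\<close>. As
          \<open>(1 - C * h) * (1 + C * h) = 1 - C\<^sup>2 * h\<^sup>2\<close>, the loss is of
          second order only.\<close>
        have 2: "g x - g a \<le> \<epsilon> * (x - a)"
        proof -
          let ?h = "x - a"
          have h: "0 \<le> ?h" "C * ?h \<le> 1" "?h * (C\<^sup>2 * e x) \<le> \<epsilon>/2"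
          proof -
            show "0 \<le> ?h" using ab by simp
            have l: "?h \<le> 1 / (C + 1)" "?h \<le> \<epsilon> / 2 / (C\<^sup>2 * e x + 1)" using ab by (auto simp: \<delta>_def)
            have "?h * (C + 1) \<le> 1" using l(1) C by (simp add: pos_le_divide_eq)
            then show "C * ?h \<le> 1" using ab by (simp add: algebra_simps)
            have "?h * (C\<^sup>2 * e x + 1) \<le> \<epsilon>/2" using l(2) q by (simp only: pos_le_divide_eq)
            then show "?h * (C\<^sup>2 * e x) \<le> \<epsilon>/2" using ab by (simp add: algebra_simps)
          qed
          have "e x * (1 - C * ?h) \<le> e a + ?h * (\<epsilon>/2 * exp (- C * T))"
            using dd[OF bT(2)] ab by (auto simp: \<delta>_def algebra_simps)
          then have "e x * (1 - C * ?h) * exp (- C * a) \<le> (e a + ?h * (\<epsilon>/2 * exp (- C * T))) * exp (- C * a)"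
            by simp
          also have "\<dots> = g a + ?h * (\<epsilon>/2 * exp (- C * T)) * exp (- C * a)"
            by (simp add: g_def algebra_simps)
          also have "\<dots> \<le> g a + \<epsilon>/2 * ?h" using scale[of ?h a] ab a0 by simp
          finally have *: "e x * (1 - C * ?h) * exp (- C * a) \<le> g a + \<epsilon>/2 * ?h" .
          have "g x - \<epsilon>/2 * ?h \<le> e x * (1 - C * ?h) * exp (- C * a)"
          proof -
            have "(1 - C * ?h) * (1 + C * ?h) \<le> (1 - C * ?h) * exp (C * ?h)"
              using h exp_ge_add_one_self[of "C * ?h"] by (intro mult_left_mono) auto
            then have "1 - C\<^sup>2 * ?h\<^sup>2 \<le> (1 - C * ?h) * exp (C * ?h)"
              by (simp add: algebra_simps power2_eq_square)
            then have "g x * (1 - C\<^sup>2 * ?h\<^sup>2) \<le> g x * ((1 - C * ?h) * exp (C * ?h))"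
              using ex by (intro mult_left_mono) (auto simp: g_def)
            also have "\<dots> = e x * (1 - C * ?h) * exp (- C * a)"
              by (simp add: g_def flip: exp_add mult.assoc)
                 (simp add: algebra_simps flip: exp_add)
            finally have "g x - g x * (C\<^sup>2 * ?h\<^sup>2) \<le> e x * (1 - C * ?h) * exp (- C * a)"
              by (simp add: algebra_simps)
            moreover have "g x * (C\<^sup>2 * ?h\<^sup>2) \<le> \<epsilon>/2 * ?h"
            proof -
              have "g x \<le> e x" using ex C x by (auto simp: g_def intro: mult_left_le)
              then have "g x * (C\<^sup>2 * ?h\<^sup>2) \<le> e x * (C\<^sup>2 * ?h\<^sup>2)" by (intro mult_right_mono) auto
              also have "\<dots> = (?h * (C\<^sup>2 * e x)) * ?h" by (simp add: power2_eq_square)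
              also have "\<dots> \<le> \<epsilon>/2 * ?h" using h by (intro mult_right_mono) auto
              finally show ?thesis .
            qed
            ultimately show ?thesis by simp
          qed
          from order_trans[OF this *] show ?thesis by (simp add: field_simps)
        qed
        have "\<epsilon>/2 * (b - x) \<le> \<epsilon> * (b - x)" using ab \<epsilon> by (intro mult_right_mono) auto
        with 1 have "g b - g x \<le> \<epsilon> * (b - x)" by (rule order_trans)
        with 2 show "g b - g a \<le> \<epsilon> * (b - a)" by (simp add: algebra_simps)
      qed
      with \<delta> show "\<exists>d>0. \<forall>a b. a \<le> x \<and> x \<le> b \<and> b - a < d \<longrightarrow> P a b" by blast
    qed
    then show ?thesis by (simp add: P_def)
  qed
  have "g t - g 0 \<le> 0"
  proof (rule field_le_epsilon)
    fix \<eta> :: real assume "0 < \<eta>"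
    have t0: "0 \<le> t" using t by simp
    have "g t - g 0 \<le> \<eta> / (t + 1) * t" by (rule main) (use \<open>0 < \<eta>\<close> t0 in auto)
    also have "\<dots> \<le> \<eta>" using \<open>0 < \<eta>\<close> t0 by (simp add: field_simps)
    finally show "g t - g 0 \<le> 0 + \<eta>" by simp
  qed
  then have "e t * exp (- C * t) * exp (C * t) \<le> e 0 * exp (C * t)"
    by (intro mult_right_mono) (auto simp: g_def)
  then show ?thesis by (simp add: mult.assoc flip: exp_add)
qed

text \<open>The growth condition is two-sided, hence invariant under reversing time about
  \<open>t\<close>. This direction supplies lower bounds: weights do not vanish and trajectories do
  not merge.\<close>

lemma gronwall_local_backward:
  fixes e :: "real \<Rightarrow> real"
  assumes C: "0 \<le> C" and pos: "\<And>t. t \<in> {0..T} \<Longrightarrow> 0 \<le> e t"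
    and loc: "\<And>t \<epsilon>. t \<in> {0..T} \<Longrightarrow> 0 < \<epsilon> \<Longrightarrow>
      \<forall>\<^sub>F r in at t within {0..T}. \<bar>e r - e t\<bar> \<le> \<bar>r - t\<bar> * (C * e t + \<epsilon>)"
    and t: "t \<in> {0..T}"
  shows "e 0 \<le> e t * exp (C * t)"
proof -
  have "e (t - t) \<le> e (t - 0) * exp (C * t)"
  proof (rule gronwall_local[where T = t and e = "\<lambda>r. e (t - r)"])
    fix \<tau> \<epsilon> :: real assume \<tau>: "\<tau> \<in> {0..t}" and \<epsilon>: "0 < \<epsilon>"
    have "t - \<tau> \<in> {0..T}" using \<tau> t by auto
    from loc[OF this \<epsilon>] obtain d where "d > 0"
      and d: "\<And>r. r \<in> {0..T} \<Longrightarrow> r \<noteq> t - \<tau> \<Longrightarrow> \<bar>r - (t - \<tau>)\<bar> < d \<Longrightarrow>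
         \<bar>e r - e (t - \<tau>)\<bar> \<le> \<bar>r - (t - \<tau>)\<bar> * (C * e (t - \<tau>) + \<epsilon>)"
      unfolding eventually_at by (auto simp: dist_real_def)
    show "\<forall>\<^sub>F r in at \<tau> within {0..t}. \<bar>e (t - r) - e (t - \<tau>)\<bar> \<le> \<bar>r - \<tau>\<bar> * (C * e (t - \<tau>) + \<epsilon>)"
      unfolding eventually_at
    proof (intro exI[of _ d] conjI ballI impI)
      fix r assume "r \<in> {0..t}" "r \<noteq> \<tau> \<and> dist r \<tau> < d"
      then show "\<bar>e (t - r) - e (t - \<tau>)\<bar> \<le> \<bar>r - \<tau>\<bar> * (C * e (t - \<tau>) + \<epsilon>)"
        using d[of "t - r"] t by (auto simp: dist_real_def abs_minus_commute)
    qed fact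
  qed (use t pos C in auto)
  then show ?thesis by simp
qed

text \<open>Compactness of the time interval, obtained by bisection. The predicate \<open>b\<close>
  is abstract so that pointwise bounds and almost-everywhere bounds with time-dependent null sets
  are both instances.\<close>

lemma locally_bounded_imp_bounded:
  fixes b :: "real \<Rightarrow> real \<Rightarrow> bool"
  assumes mono: "\<And>t B B'. b t B \<Longrightarrow> B \<le> B' \<Longrightarrow> b t B'"
    and loc: "\<And>t. t \<in> {0..T} \<Longrightarrow> \<exists>B. b t B \<and> (\<forall>\<^sub>F r in at t within {0..T}. b r B)"
  shows "\<exists>B\<ge>0. \<forall>t\<in>{0..T}. b t B"
proof (cases "0 \<le> T")
  case True
  define P where "P a c \<longleftrightarrow> (\<exists>B\<ge>0. \<forall>t\<in>{a..c} \<inter> {0..T}. b t B)" for a c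
  have "P 0 T"
  proof (rule Bolzano)
    show "P a c" if P: "P a y" "P y c" and le: "a \<le> y" "y \<le> c" for a y c
    proof -
      obtain B1 B2 where B: "B1 \<ge> 0" "B2 \<ge> 0"
        "\<forall>t\<in>{a..y} \<inter> {0..T}. b t B1" "\<forall>t\<in>{y..c} \<inter> {0..T}. b t B2"
        using P unfolding P_def by blast
      have "\<forall>t\<in>{a..c} \<inter> {0..T}. b t (max B1 B2)"
      proof
        fix t assume t: "t \<in> {a..c} \<inter> {0..T}"
        show "b t (max B1 B2)"
          by (cases "t \<le> y"; rule mono[of t "if t \<le> y then B1 else B2"]) (use B t in auto)
      qed
      then show ?thesis using B unfolding P_def by (intro exI[of _ "max B1 B2"]) auto
    qed
    fix x assume x: "0 \<le> x" "x \<le> T"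
    then obtain B d where B: "b x B" "d > 0" "\<forall>r\<in>{0..T}. r \<noteq> x \<and> dist r x < d \<longrightarrow> b r B"
      using loc[of x] unfolding eventually_at by auto
    then have B': "b r B" if "r \<in> {0..T}" "\<bar>r - x\<bar> < d" for r
      using that by (cases "r = x") (auto simp: dist_real_def)
    have "P a c" if "a \<le> x \<and> x \<le> c \<and> c - a < d" for a c
      unfolding P_def using that
      by (intro exI[of _ "max B 0"]) (auto intro!: mono[OF B'])
    then show "\<exists>d>0. \<forall>a b. a \<le> x \<and> x \<le> b \<and> b - a < d \<longrightarrow> P a b" using \<open>d > 0\<close> by blast
  qed (use True in auto)
  then show ?thesis unfolding P_def by auto
qed auto

lemma has_vector_derivative_local:
  assumes "(f has_vector_derivative f') (at t within A)" and "0 < \<epsilon>"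
  shows "\<forall>\<^sub>F r in at t within A. norm (f r - f t - (r - t) *\<^sub>R f') \<le> \<epsilon> * \<bar>r - t\<bar>"
proof -
  from assms(1) have "(f has_derivative (\<lambda>h. h *\<^sub>R f')) (at t within A)"
    by (simp add: has_vector_derivative_def)
  then obtain d where "d > 0" "\<And>r. r \<in> A \<Longrightarrow> norm (r - t) < d \<Longrightarrow>
      norm (f r - f t - (r - t) *\<^sub>R f') \<le> \<epsilon> * norm (r - t)"
    using \<open>0 < \<epsilon>\<close> unfolding has_derivative_within_alt by metis
  then show ?thesis unfolding eventually_at by (auto simp: dist_norm)
qed

text \<open>The norm need not be differentiable at 0, but the reverse triangle inequality passes the
  first-order expansion of \<open>u\<close> to \<open>norm (u r)\<close> in exactly the form that
  the Gronwall lemmas take.\<close>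

lemma local_growth_norm:
  fixes u :: "real \<Rightarrow> 'a::real_normed_vector"
  assumes "\<forall>\<^sub>F r in F. norm (u r - u t - (r - t) *\<^sub>R w) \<le> \<epsilon> * \<bar>r - t\<bar>"
    and "norm w \<le> c"
  shows "\<forall>\<^sub>F r in F. \<bar>norm (u r) - norm (u t)\<bar> \<le> \<bar>r - t\<bar> * (c + \<epsilon>)"
  using assms(1)
proof eventually_elim
  case (elim r)
  have "\<bar>norm (u r) - norm (u t)\<bar> \<le> norm (u r - u t)" by (rule norm_triangle_ineq3)
  also have "\<dots> \<le> norm (u r - u t - (r - t) *\<^sub>R w) + norm ((r - t) *\<^sub>R w)"
    using norm_triangle_ineq[of "u r - u t - (r - t) *\<^sub>R w" "(r - t) *\<^sub>R w"] by simp
  also have "\<dots> \<le> \<epsilon> * \<bar>r - t\<bar> + \<bar>r - t\<bar> * c"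
    using elim assms(2) by (intro add_mono) (auto intro: mult_left_mono)
  finally show ?case by (simp add: algebra_simps)
qed

section \<open>Lebesgue measure on products and under maps bounded below\<close>

text \<open>Each factor is Borel up to a null set, and the strips \<open>N' \<times> UNIV\<close>
  and \<open>UNIV \<times> Q'\<close> over null sets are null. So the product is Borel up to a null
  set, and the formula for Borel rectangles carries over.\<close>

lemma lebesgue_Times:
  fixes A :: "'a::euclidean_space set" and B :: "'b::euclidean_space set"
  assumes A: "A \<in> sets lebesgue" and B: "B \<in> sets lebesgue"
  shows "A \<times> B \<in> sets lebesgue"
    and "emeasure lebesgue (A \<times> B) = emeasure lebesgue A * emeasure lebesgue B"
proof -
  obtain S N N' where A': "A = S \<union> N" "N \<subseteq> N'" "N' \<in> null_sets lborel" "S \<in> sets lborel"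
    using A by (rule sets_completionE)
  obtain R Q Q' where B': "B = R \<union> Q" "Q \<subseteq> Q'" "Q' \<in> null_sets lborel" "R \<in> sets lborel"
    using B by (rule sets_completionE)
  have times: "emeasure lborel (U \<times> V) = emeasure lborel U * emeasure lborel V"
    if "U \<in> sets lborel" "V \<in> sets lborel" for U :: "'a set" and V :: "'b set"
    using lborel.emeasure_pair_measure_Times[OF that] by (simp add: lborel_prod)
  have sets: "U \<times> V \<in> sets lborel"
    if "U \<in> sets lborel" "V \<in> sets lborel" for U :: "'a set" and V :: "'b set"
    using pair_measureI[OF that] by (simp only: lborel_prod)
  let ?Z = "N' \<times> UNIV \<union> UNIV \<times> Q' :: ('a \<times> 'b) set"
  let ?W = "A \<times> B - S \<times> R"
  have "N' \<times> UNIV \<in> null_sets (lborel :: ('a \<times> 'b) measure)"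
    using A'(3) sets[of N' UNIV] by (simp add: times null_sets_def)
  moreover have "UNIV \<times> Q' \<in> null_sets (lborel :: ('a \<times> 'b) measure)"
    using B'(3) sets[of UNIV Q'] by (simp add: times null_sets_def)
  ultimately have Z: "?Z \<in> null_sets lborel" by (rule null_sets.Un)
  have W: "?W \<subseteq> ?Z" using A'(1,2) B'(1,2) by auto
  have Wn: "?W \<in> null_sets lebesgue"
    using Z W unfolding null_sets_completion_iff2 by blast
  have eq: "A \<times> B = S \<times> R \<union> ?W" using A'(1) B'(1) by auto
  have SR: "S \<times> R \<in> sets lborel" using sets A'(4) B'(4) .
  have SRW: "S \<times> R \<union> ?W \<in> sets lebesgue"
    by (rule sets.Un[OF sets_completionI_sets[OF SR] null_setsD2[OF Wn]])
  show "A \<times> B \<in> sets lebesgue" using SRW by (simp only: eq[symmetric])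
  have eA: "emeasure lebesgue A = emeasure lborel S"
  proof -
    have "N \<in> null_sets lebesgue" using A'(2,3) unfolding null_sets_completion_iff2 by blast
    from emeasure_Un_null_set[OF sets_completionI_sets[OF A'(4)] this]
    have "emeasure lebesgue A = emeasure lebesgue S" by (simp only: A'(1))
    also have "\<dots> = emeasure lborel S" using A'(4) by simp
    finally show ?thesis .
  qed
  have eB: "emeasure lebesgue B = emeasure lborel R"
  proof -
    have "Q \<in> null_sets lebesgue" using B'(2,3) unfolding null_sets_completion_iff2 by blast
    from emeasure_Un_null_set[OF sets_completionI_sets[OF B'(4)] this]
    have "emeasure lebesgue B = emeasure lebesgue R" by (simp only: B'(1))
    also have "\<dots> = emeasure lborel R" using B'(4) by simp
    finally show ?thesis .
  qed
  have "emeasure lebesgue (A \<times> B) = emeasure lborel (S \<times> R)"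
  proof -
    have "emeasure lebesgue (A \<times> B) = emeasure lebesgue (S \<times> R)"
      using emeasure_Un_null_set[OF sets_completionI_sets[OF SR] Wn] by (simp only: eq[symmetric])
    also have "\<dots> = emeasure lborel (S \<times> R)" using SR by simp
    finally show ?thesis .
  qed
  then show "emeasure lebesgue (A \<times> B) = emeasure lebesgue A * emeasure lebesgue B"
    using times[OF A'(4) B'(4)] eA eB by simp
qed

lemma sigma_finite_lebesgue_on:
  fixes C :: "'a::euclidean_space set"
  assumes "C \<in> lmeasurable"
  shows "sigma_finite_measure (lebesgue_on C)"
  using finite_measure_lebesgue_on[OF assms] by (rule finite_measure.axioms)

text \<open>The completed measure on \<open>C \<times> D\<close> may have more measurable sets than
  the product of the completed measures, so the two are related through the image under the identity
  map instead of an equation between them.\<close>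

lemma lebesgue_on_Times:
  fixes C :: "'a::euclidean_space set" and D :: "'b::euclidean_space set"
  assumes C: "C \<in> lmeasurable" and D: "D \<in> lmeasurable"
  shows "(\<lambda>p. p) \<in> measurable (lebesgue_on (C \<times> D)) (lebesgue_on C \<Otimes>\<^sub>M lebesgue_on D)"
    and "lebesgue_on C \<Otimes>\<^sub>M lebesgue_on D
      = distr (lebesgue_on (C \<times> D)) (lebesgue_on C \<Otimes>\<^sub>M lebesgue_on D) (\<lambda>p. p)"
proof -
  have CD[simp]: "C \<in> sets lebesgue" "D \<in> sets lebesgue" "C \<times> D \<in> sets lebesgue"
    using C D lebesgue_Times(1) by auto
  show m: "(\<lambda>p. p) \<in> measurable (lebesgue_on (C \<times> D)) (lebesgue_on C \<Otimes>\<^sub>M lebesgue_on D)"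
  proof (rule measurable_pair)
    have "fst -` A \<inter> (C \<times> D) \<in> sets (lebesgue_on (C \<times> D))" if "A \<in> sets (lebesgue_on C)" for A
    proof -
      have "A \<in> sets lebesgue" "A \<subseteq> C" using that by (auto simp: sets_restrict_space_iff)
      moreover then have "fst -` A \<inter> (C \<times> D) = A \<times> D" by auto
      ultimately show ?thesis by (auto simp: sets_restrict_space_iff intro!: lebesgue_Times)
    qed
    then show "fst \<circ> (\<lambda>p. p) \<in> lebesgue_on (C \<times> D) \<rightarrow>\<^sub>M lebesgue_on C" by (intro measurableI) (auto simp: comp_def)
    have "snd -` A \<inter> (C \<times> D) \<in> sets (lebesgue_on (C \<times> D))" if "A \<in> sets (lebesgue_on D)" for A
    proof -
      have "A \<in> sets lebesgue" "A \<subseteq> D" using that by (auto simp: sets_restrict_space_iff)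
      moreover then have "snd -` A \<inter> (C \<times> D) = C \<times> A" by auto
      ultimately show ?thesis by (auto simp: sets_restrict_space_iff intro!: lebesgue_Times)
    qed
    then show "snd \<circ> (\<lambda>p. p) \<in> lebesgue_on (C \<times> D) \<rightarrow>\<^sub>M lebesgue_on D" by (intro measurableI) (auto simp: comp_def)
  qed
  show "lebesgue_on C \<Otimes>\<^sub>M lebesgue_on D
      = distr (lebesgue_on (C \<times> D)) (lebesgue_on C \<Otimes>\<^sub>M lebesgue_on D) (\<lambda>p. p)"
  proof (rule pair_measure_eqI)
    show "sigma_finite_measure (lebesgue_on C)" "sigma_finite_measure (lebesgue_on D)"
      using C D by (auto intro: sigma_finite_lebesgue_on)
    fix A B assume AB: "A \<in> sets (lebesgue_on C)" "B \<in> sets (lebesgue_on D)"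
    then have *: "A \<in> sets lebesgue" "A \<subseteq> C" "B \<in> sets lebesgue" "B \<subseteq> D"
      by (auto simp: sets_restrict_space_iff)
    have "emeasure (distr (lebesgue_on (C \<times> D)) (lebesgue_on C \<Otimes>\<^sub>M lebesgue_on D) (\<lambda>p. p)) (A \<times> B)
      = emeasure (lebesgue_on (C \<times> D)) (A \<times> B)"
    proof (subst emeasure_distr[OF m])
      show "A \<times> B \<in> sets (lebesgue_on C \<Otimes>\<^sub>M lebesgue_on D)" using AB by auto
      show "emeasure (lebesgue_on (C \<times> D)) ((\<lambda>p. p) -` (A \<times> B) \<inter> space (lebesgue_on (C \<times> D))) =
        emeasure (lebesgue_on (C \<times> D)) (A \<times> B)"
        using * by (intro arg_cong[where f = "emeasure _"]) auto
    qed
    also have "\<dots> = emeasure lebesgue (A \<times> B)"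
      using * by (intro emeasure_restrict_space) auto
    also have "\<dots> = emeasure (lebesgue_on C) A * emeasure (lebesgue_on D) B"
      using * by (simp add: lebesgue_Times emeasure_restrict_space del: emeasure_completion)
    finally show "emeasure (lebesgue_on C) A * emeasure (lebesgue_on D) B
      = emeasure (distr (lebesgue_on (C \<times> D)) (lebesgue_on C \<Otimes>\<^sub>M lebesgue_on D) (\<lambda>p. p)) (A \<times> B)" by simp
  qed simp
qed

lemma integral_lebesgue_on_Times:
  fixes f :: "'a::euclidean_space \<times> 'b::euclidean_space \<Rightarrow> 'c::{banach, second_countable_topology}"
  assumes C: "C \<in> lmeasurable" and D: "D \<in> lmeasurable"
    and f: "f \<in> borel_measurable (lebesgue_on C \<Otimes>\<^sub>M lebesgue_on D)"
  shows "(LINT p:C \<times> D|lebesgue. f p) = integral\<^sup>L (lebesgue_on C \<Otimes>\<^sub>M lebesgue_on D) f"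
proof -
  have "C \<times> D \<in> sets lebesgue" using C D by (intro lebesgue_Times) auto
  then have "(LINT p:C \<times> D|lebesgue. f p) = integral\<^sup>L (lebesgue_on (C \<times> D)) f"
    unfolding set_lebesgue_integral_def by (subst integral_restrict_space) auto
  also have "\<dots> = integral\<^sup>L (distr (lebesgue_on (C \<times> D)) (lebesgue_on C \<Otimes>\<^sub>M lebesgue_on D) (\<lambda>p. p)) f"
    by (rule integral_distr[OF lebesgue_on_Times(1)[OF C D] f, symmetric])
  finally show ?thesis using lebesgue_on_Times(2)[OF C D] by simp
qed

section \<open>Covering argument for image measures of maps bounded below\<close>

lemma emeasure_UN_le_nn_integral:
  assumes V: "countable V" and F: "\<And>i. i \<in> V \<Longrightarrow> F i \<in> sets M"
  shows "emeasure M (\<Union>i\<in>V. F i) \<le> (\<integral>\<^sup>+i. emeasure M (F i) \<partial>count_space V)"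
proof -
  let ?A = "to_nat_on V ` V" and ?g = "from_nat_into V"
  define G where "G n = (if n \<in> ?A then F (?g n) else {})" for n
  have bij: "bij_betw ?g ?A V"
  proof (rule bij_betw_byWitness[where f' = "to_nat_on V"])
    show "\<forall>a\<in>?A. to_nat_on V (?g a) = a" using V by auto
    show "\<forall>a'\<in>V. ?g (to_nat_on V a') = a'" using V by auto
  qed (use V in auto)
  have "(\<Union>i\<in>V. F i) = (\<Union>n. G n)"
    using V by (auto simp: G_def split: if_splits)
  also have "emeasure M (\<Union>n. G n) \<le> (\<Sum>n. emeasure M (G n))"
    by (rule emeasure_subadditive_countably) (use V F in \<open>auto simp: G_def\<close>)
  also have "\<dots> = (\<integral>\<^sup>+n. emeasure M (G n) \<partial>count_space UNIV)"
    by (simp add: nn_integral_count_space_nat)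
  also have "\<dots> = (\<integral>\<^sup>+n. emeasure M (F (?g n)) * indicator ?A n \<partial>count_space UNIV)"
    by (intro nn_integral_cong) (auto simp: G_def indicator_def)
  also have "\<dots> = (\<integral>\<^sup>+n. emeasure M (F (?g n)) \<partial>count_space ?A)"
    by (simp add: nn_integral_count_space_indicator)
  also have "\<dots> = (\<integral>\<^sup>+i. emeasure M (F i) \<partial>count_space V)"
    by (rule nn_integral_bij_count_space[OF bij])
  finally show ?thesis .
qed

lemma emeasure_lborel_cball:
  fixes z :: "'a::euclidean_space"
  assumes "0 \<le> r" "0 \<le> k"
  shows "emeasure lborel (cball z (k * r)) = ennreal (k ^ DIM('a)) * emeasure lborel (ball z r)"
  using assms
  by (simp add: emeasure_cball emeasure_ball power_mult_distrib mult_ac flip: ennreal_mult)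

text \<open>The density bound is verified on balls, extended to open neighbourhoods of
  \<open>E\<close> by a Vitali covering, and brought to \<open>E\<close> by outer regularity of
  Lebesgue measure.\<close>

lemma pushforward_le_lborel:
  fixes f :: "'a::euclidean_space \<Rightarrow> 'a"
  assumes D: "D \<in> sets lebesgue" and f: "f \<in> borel_measurable (lebesgue_on D)"
    and c: "0 < c" and low: "\<And>x y. x \<in> D \<Longrightarrow> y \<in> D \<Longrightarrow> c * norm (x - y) \<le> norm (f x - f y)"
    and E: "E \<in> sets borel"
  shows "emeasure (distr (lebesgue_on D) borel f) E \<le> ennreal ((10 / c) ^ DIM('a)) * emeasure lborel E"
proof -
  let ?\<nu> = "distr (lebesgue_on D) borel f"
  let ?K = "ennreal ((10 / c) ^ DIM('a))"
  \<comment> \<open>Two points of the preimage have images at distance at most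
    \<open>10 * r\<close>, so their own distance is at most \<open>10 * r / c\<close>: the preimage
    lies in a ball around any of its points. The radius \<open>5 * r\<close> anticipates the
    enlargement in the Vitali covering.\<close>
  have ball: "emeasure ?\<nu> (cball z (5 * r)) \<le> ?K * emeasure lborel (ball z r)" if r: "0 < r" for z r
  proof -
    let ?P = "f -` cball z (5 * r) \<inter> D"
    have eq: "emeasure ?\<nu> (cball z (5 * r)) = emeasure lebesgue ?P"
    proof -
      have "f -` cball z (5 * r) \<inter> space (lebesgue_on D) \<in> sets (lebesgue_on D)"
        using f by (rule measurable_sets) auto
      then show ?thesis using D f by (subst emeasure_distr) (auto simp: emeasure_restrict_space sets_restrict_space_iff)
    qed
    show ?thesis
    proof (cases "?P = {}")
      case False
      then obtain s where s: "s \<in> D" "f s \<in> cball z (5 * r)" by auto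
      have "?P \<subseteq> cball s (10 / c * r)"
      proof
        fix t assume t: "t \<in> ?P"
        have "c * norm (s - t) \<le> norm (f s - f t)" using low s t by auto
        also have "\<dots> \<le> dist z (f s) + dist z (f t)"
          using dist_triangle3[of "f s" "f t" z] by (simp add: dist_norm)
        also have "\<dots> \<le> 10 * r" using s t by auto
        finally have "norm (s - t) \<le> 10 * r / c" using c by (simp add: field_simps)
        then show "t \<in> cball s (10 / c * r)" by (simp add: dist_norm)
      qed
      then have "emeasure lebesgue ?P \<le> emeasure lebesgue (cball s (10 / c * r))"
        by (rule emeasure_mono) auto
      also have "\<dots> = emeasure lborel (cball s (10 / c * r))" by simp
      also have "\<dots> = ?K * emeasure lborel (ball s r)"
        by (rule emeasure_lborel_cball) (use r c in auto)
      also have "emeasure lborel (ball s r) = emeasure lborel (ball z r)"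
        using r by (simp add: emeasure_ball)
      finally show ?thesis using eq by simp
    qed (use eq in simp)
  qed
  have U: "emeasure ?\<nu> E \<le> ?K * emeasure lborel U" if U: "open U" "E \<subseteq> U" for U
  proof -
    \<comment> \<open>The cap at 1 is there because the covering lemma requires bounded radii. The
      small balls stay disjoint and inside \<open>U\<close>, whereas the enlarged ones, which cover
      \<open>E\<close>, may leave \<open>U\<close>.\<close>
    have "\<exists>r. 0 < r \<and> r \<le> 1 \<and> cball z r \<subseteq> U" if "z \<in> E" for z
    proof -
      have "z \<in> U" using that U(2) by auto
      then obtain e where "0 < e" "cball z e \<subseteq> U" using U(1) open_contains_cball by blast
      then show ?thesis by (intro exI[of _ "min e 1"]) auto
    qed
    then obtain r where r: "\<And>z. z \<in> E \<Longrightarrow> 0 < r z \<and> r z \<le> 1 \<and> cball z (r z) \<subseteq> U" by metis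
    have "E \<subseteq> (\<Union>i\<in>E. cball i (r i))" using r by force
    then obtain V where V: "countable V" "V \<subseteq> E"
      "pairwise (\<lambda>i j. disjnt (cball i (r i)) (cball j (r j))) V"
      "E \<subseteq> (\<Union>i\<in>V. cball i (5 * r i))"
      by (rule Vitali_covering_lemma_cballs[of E "\<lambda>x. x" r E 1]) (use r in auto)
    have "emeasure ?\<nu> E \<le> emeasure ?\<nu> (\<Union>i\<in>V. cball i (5 * r i))"
      using V by (intro emeasure_mono) (auto intro!: sets.countable_UN')
    also have "\<dots> \<le> (\<integral>\<^sup>+i. emeasure ?\<nu> (cball i (5 * r i)) \<partial>count_space V)"
      using V by (intro emeasure_UN_le_nn_integral) auto
    also have "\<dots> \<le> (\<integral>\<^sup>+i. ?K * emeasure lborel (ball i (r i)) \<partial>count_space V)"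
      using V(2) r by (intro nn_integral_mono ball) auto
    also have "\<dots> = ?K * (\<integral>\<^sup>+i. emeasure lborel (ball i (r i)) \<partial>count_space V)"
      by (rule nn_integral_cmult) auto
    also have "(\<integral>\<^sup>+i. emeasure lborel (ball i (r i)) \<partial>count_space V) = emeasure lborel (\<Union>i\<in>V. ball i (r i))"
    proof (rule emeasure_UN_countable[symmetric])
      show "disjoint_family_on (\<lambda>i. ball i (r i)) V"
        using V(3) unfolding disjoint_family_on_def pairwise_def disjnt_def
        by (meson ball_subset_cball disjoint_iff subsetD)
    qed (use V in auto)
    also have "\<dots> \<le> emeasure lborel U"
    proof (rule emeasure_mono)
      show "(\<Union>i\<in>V. ball i (r i)) \<subseteq> U"
        using V(2) r ball_subset_cball by blast
    qed (use U in auto)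
    finally show ?thesis by (simp add: mult_left_mono)
  qed
  show ?thesis
  proof (rule ennreal_le_epsilon)
    fix e :: real assume e: "0 < e"
    define k where "k = (10 / c) ^ DIM('a)"
    have k: "0 < k" using c by (simp add: k_def)
    obtain W where W: "open W" "E \<subseteq> W" "emeasure lborel (W - E) \<le> ennreal (e / k)"
      using outer_regular_lborel_le[OF E, of "e / k"] e k by auto
    have "emeasure lborel W = emeasure lborel E + emeasure lborel (W - E)"
      using W E by (subst plus_emeasure) (auto intro!: arg_cong[where f="emeasure _"])
    also have "\<dots> \<le> emeasure lborel E + ennreal (e / k)" using W by (intro add_left_mono)
    finally have "?K * emeasure lborel W \<le> ?K * (emeasure lborel E + ennreal (e / k))"
      by (rule mult_left_mono) auto
    also have "\<dots> = ?K * emeasure lborel E + ennreal e"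
      using e k by (simp add: distrib_left k_def[symmetric] flip: ennreal_mult)
    finally show "emeasure ?\<nu> E \<le> ?K * emeasure lborel E + ennreal e"
      using U[OF W(1,2)] by simp
  qed
qed

lemma nn_integral_pushforward_le:
  fixes f :: "'a::euclidean_space \<Rightarrow> 'a"
  assumes D: "D \<in> sets lebesgue" and f: "f \<in> borel_measurable (lebesgue_on D)"
    and c: "0 < c" and low: "\<And>x y. x \<in> D \<Longrightarrow> y \<in> D \<Longrightarrow> c * norm (x - y) \<le> norm (f x - f y)"
    and g: "g \<in> borel_measurable borel"
  shows "(\<integral>\<^sup>+x. g (f x) \<partial>lebesgue_on D) \<le> ennreal ((10 / c) ^ DIM('a)) * (\<integral>\<^sup>+z. g z \<partial>lborel)"
proof -
  let ?K = "ennreal ((10 / c) ^ DIM('a))"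
  have "(\<integral>\<^sup>+x. g (f x) \<partial>lebesgue_on D) = (\<integral>\<^sup>+z. g z \<partial>distr (lebesgue_on D) borel f)"
    using f g by (simp add: nn_integral_distr)
  also have "\<dots> \<le> (\<integral>\<^sup>+z. g z \<partial>scale_measure ?K lborel)"
  proof (rule nn_integral_mono_measure)
    show "distr (lebesgue_on D) borel f \<le> scale_measure ?K lborel"
      using pushforward_le_lborel[OF D f c low]
      by (subst le_measure) auto
  qed simp
  also have "\<dots> = ?K * (\<integral>\<^sup>+z. g z \<partial>lborel)"
    using g by (intro nn_integral_scale_measure) auto
  finally show ?thesis .
qed

section \<open>The unit cube and its cells\<close>

abbreviation (input) cube_measure :: "(real ^ 'n) measure" ("\<mu>") where
  "\<mu> \<equiv> lebesgue_on cube"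

lemma cube_lmeasurable[simp]: "cube \<in> lmeasurable"
  and cube_sets[simp]: "cube \<in> sets lebesgue"
  by (auto simp: cube_def)

lemma content_cube: "measure lebesgue (cube :: (real ^ 'n) set) = 1"
proof -
  have "cbox 0 (1 :: real ^ 'n) \<noteq> {}" by (simp add: interval_eq_empty_cart)
  then show ?thesis by (simp add: cube_def content_cbox_cart)
qed

lemma prob_space_cube_measure: "prob_space (\<mu> :: (real ^ 'n) measure)"
proof
  have "emeasure \<mu> (space (\<mu> :: (real ^ 'n) measure)) = emeasure lebesgue (cube :: (real ^ 'n) set)"
    by (subst emeasure_restrict_space) auto
  also have "\<dots> = ennreal 1"
    using content_cube by (subst emeasure_eq_measure2) (auto simp: cube_def)
  finally show "emeasure \<mu> (space (\<mu> :: (real ^ 'n) measure)) = 1" by simp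
qed

interpretation cube: prob_space "\<mu> :: (real ^ 'n) measure"
  by (rule prob_space_cube_measure)

interpretation cube_pair: pair_prob_space "\<mu> :: (real ^ 'n) measure" "\<mu> :: (real ^ 'n) measure" ..

lemma prob_cube[simp]: "measure \<mu> (cube :: (real ^ 'n) set) = 1"
  using cube.prob_space by simp

lemma emeasure_cube: "emeasure \<mu> (cube :: (real ^ 'n) set) = 1"
  using cube.emeasure_space_1 by simp

lemma AE_cube_measure: "(AE s in \<mu>. P s) \<longleftrightarrow> (AE s in lebesgue. s \<in> cube \<longrightarrow> P s)"
  by (simp add: AE_restrict_space_iff)

text \<open>Completeness of Lebesgue measure. It is the way to measurability for functions that are
  understood only off cell boundaries or off the set of infinite modulus.\<close>

lemma borel_measurable_cube_AE:
  fixes f g :: "real ^ 'n \<Rightarrow> 'b::euclidean_space"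
  assumes g: "g \<in> borel_measurable \<mu>" and eq: "AE s in \<mu>. g s = f s"
  shows "f \<in> borel_measurable \<mu>"
proof -
  let ?r = "\<lambda>f s. if s \<in> cube then f s else (0 :: 'b)"
  have "?r g \<in> borel_measurable lebesgue" using g by (simp add: borel_measurable_if)
  moreover have "AE s in lebesgue. ?r g s = ?r f s"
    using eq unfolding AE_cube_measure by eventually_elim auto
  ultimately have "?r f \<in> borel_measurable lebesgue" by (rule borel_measurable_AE)
  then show ?thesis by (simp add: borel_measurable_if)
qed

section \<open>Partition of the cube into cells and averages over them\<close>

definition grid_index :: "nat \<Rightarrow> real ^ 'n \<Rightarrow> nat ^ 'n" where
  "grid_index N s = (\<chi> k. nat \<lceil>real N * s $ k\<rceil>)"

text \<open>
  Points on no cell boundary: there exactly one cell indicator is nonzero.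
\<close>

definition generic :: "nat \<Rightarrow> (real ^ 'n) set" where
  "generic N = {s \<in> cube. \<forall>k. real N * s $ k \<notin> \<int>}"

lemma mem_cube: "s \<in> cube \<longleftrightarrow> (\<forall>k. 0 \<le> s $ k \<and> s $ k \<le> 1)"
  by (simp add: cube_def mem_box_cart)

lemma AE_generic:
  assumes N: "1 \<le> N"
  shows "AE s::real ^ 'n in \<mu>. s \<in> generic N"
proof -
  have "AE s::real ^ 'n in lebesgue. real N * s $ k \<noteq> c" for k :: 'n and c
  proof -
    have "negligible {s :: real ^ 'n. s $ k = c / real N}"
      by (rule negligible_standard_hyperplane[of "axis k 1 :: real ^ 'n" "c / real N", simplified inner_axis, simplified])
    then have "AE s in lebesgue. s \<notin> {s :: real ^ 'n. s $ k = c / real N}"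
      by (intro AE_not_in) (simp add: negligible_iff_null_sets)
    then show ?thesis by (rule eventually_mono) (use N in \<open>auto simp: field_simps\<close>)
  qed
  then have "AE s::real ^ 'n in lebesgue. \<forall>k. \<forall>c\<in>\<int>. real N * s $ k \<noteq> c"
    by (subst AE_all_countable) (auto simp: AE_ball_countable countable_int)
  then show ?thesis unfolding AE_cube_measure
    by eventually_elim (auto simp: generic_def)
qed

text \<open>With one-based indices, cell \<open>i\<close> spans \<open>i $ k - 1\<close> to
  \<open>i $ k\<close> after scaling by \<open>N\<close>, which is the range of the ceiling; a
  generic point meets neither endpoint, so closed and half-open cells agree there.\<close>

lemma mem_cell_iff:
  assumes N: "1 \<le> N" and s: "s \<in> generic N" and i: "i \<in> multi_indices N"
  shows "s \<in> cell N i \<longleftrightarrow> i = grid_index N s"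
proof -
  have *: "(real (i $ k) - 1) / real N \<le> s $ k \<and> s $ k \<le> real (i $ k) / real N
     \<longleftrightarrow> i $ k = nat \<lceil>real N * s $ k\<rceil>" for k
  proof -
    let ?y = "real N * s $ k"
    have y: "?y \<notin> \<int>" using s by (simp add: generic_def)
    then have ne: "?y \<noteq> real (i $ k)" "?y \<noteq> real (i $ k) - 1" by auto
    have i1: "1 \<le> i $ k" using i by (auto simp: multi_indices_def)
    have "(real (i $ k) - 1) / real N \<le> s $ k \<and> s $ k \<le> real (i $ k) / real N
       \<longleftrightarrow> real (i $ k) - 1 \<le> ?y \<and> ?y \<le> real (i $ k)"
      using N by (simp add: field_simps)
    also have "\<dots> \<longleftrightarrow> real_of_int (int (i $ k)) - 1 < ?y \<and> ?y \<le> real_of_int (int (i $ k))"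
      using ne by auto
    also have "\<dots> \<longleftrightarrow> \<lceil>?y\<rceil> = int (i $ k)" by (simp only: ceiling_eq_iff)
    also have "\<dots> \<longleftrightarrow> i $ k = nat \<lceil>?y\<rceil>" using i1 by linarith
    finally show ?thesis .
  qed
  show ?thesis
    by (simp add: cell_def mem_box_cart * grid_index_def vec_eq_iff)
qed

lemma grid_index_mem:
  assumes N: "1 \<le> N" and s: "s \<in> generic N"
  shows "grid_index N s \<in> multi_indices N"
proof -
  have "nat \<lceil>real N * s $ k\<rceil> \<in> {1..N}" for k
  proof -
    have s01: "0 \<le> s $ k" "s $ k \<le> 1" using s by (auto simp: generic_def mem_cube)
    have "real N * s $ k \<noteq> 0" using s unfolding generic_def by (metis (mono_tags, lifting) Ints_0 mem_Collect_eq)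
    then have "0 < real N * s $ k" using s01 N by (simp add: less_le)
    moreover have "real N * s $ k \<le> real N" using s01 by (simp add: mult_left_le)
    ultimately show ?thesis by (auto simp: le_nat_iff nat_le_iff ceiling_le_iff less_ceiling_iff Suc_le_eq)
  qed
  then show ?thesis by (simp add: multi_indices_def grid_index_def)
qed

lemma finite_multi_indices: "finite (multi_indices N :: (nat ^ 'n) set)"
proof -
  have "multi_indices N \<subseteq> vec_lambda ` (UNIV \<rightarrow>\<^sub>E {1..N} :: ('n \<Rightarrow> nat) set)"
  proof
    fix i :: "nat ^ 'n" assume "i \<in> multi_indices N"
    then have "i = vec_lambda (\<lambda>k. i $ k)" "(\<lambda>k. i $ k) \<in> UNIV \<rightarrow>\<^sub>E {1..N}"
      by (auto simp: multi_indices_def)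
    then show "i \<in> vec_lambda ` (UNIV \<rightarrow>\<^sub>E {1..N})" by blast
  qed
  then show ?thesis by (rule finite_subset) (intro finite_imageI finite_PiE; simp)
qed

lemma indicator_cell_generic:
  assumes "1 \<le> N" "s \<in> generic N" "i \<in> multi_indices N"
  shows "indicat_real (cell N i) s = of_bool (i = grid_index N s)"
  using mem_cell_iff[OF assms] by (simp add: indicator_def)

lemma sum_cells_generic:
  fixes v :: "nat ^ 'n \<Rightarrow> 'b::real_vector"
  assumes "1 \<le> N" "s \<in> generic N"
  shows "(\<Sum>i\<in>multi_indices N. indicat_real (cell N i) s *\<^sub>R v i) = v (grid_index N s)"
proof -
  have "(\<Sum>i\<in>multi_indices N. indicat_real (cell N i) s *\<^sub>R v i)
     = (\<Sum>i\<in>multi_indices N. if i = grid_index N s then v i else 0)"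
    by (intro sum.cong) (auto simp: indicator_cell_generic[OF assms])
  also have "\<dots> = v (grid_index N s)"
    using grid_index_mem[OF assms] by (subst sum.delta) (auto simp: finite_multi_indices)
  finally show ?thesis .
qed

lemma step_function_generic:
  fixes y :: "nat \<Rightarrow> 'b::real_vector"
  assumes "1 \<le> N" "s \<in> generic N"
  shows "step_function N \<sigma> y s = y (\<sigma> (grid_index N s))"
  unfolding step_function_def using sum_cells_generic[OF assms, of "\<lambda>i. y (\<sigma> i)"] .

lemma cell_subset_cube:
  assumes N: "1 \<le> N" and i: "i \<in> multi_indices N"
  shows "cell N i \<subseteq> cube"
proof -
  have "0 \<le> (real (i $ k) - 1) / real N \<and> real (i $ k) / real N \<le> 1" for k
    using i N by (auto simp: multi_indices_def field_simps Suc_le_eq)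
  then show ?thesis
    unfolding cell_def mem_cube subset_iff mem_box_cart by (auto intro: order_trans)
qed

lemma cell_borel[measurable]: "cell N i \<in> sets borel"
  by (simp add: cell_def)

lemma cell_sets[measurable]:
  assumes "1 \<le> N" "i \<in> multi_indices N"
  shows "cell N i \<in> sets \<mu>"
  using cell_subset_cube[OF assms] by (simp add: sets_restrict_space_iff)

lemma measure_cell:
  fixes i :: "nat ^ 'n"
  assumes N: "1 \<le> N" and i: "i \<in> multi_indices N"
  shows "measure \<mu> (cell N i) = 1 / real N ^ CARD('n)"
proof -
  have "measure \<mu> (cell N i) = measure lebesgue (cell N i)"
    using cell_subset_cube[OF assms] by (intro measure_restrict_space) auto
  also have "\<dots> = measure lborel (cell N i)" by simp
  also have "\<dots> = (\<Prod>k\<in>(UNIV::'n set). 1 / real N)"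
  proof -
    have "cell N i \<noteq> {}" by (auto simp: cell_def interval_eq_empty_cart divide_right_mono not_less)
    then show ?thesis using N
      by (simp add: cell_def content_cbox_cart flip: diff_divide_distrib)
  qed
  finally show ?thesis by (simp add: power_one_over)
qed

lemma cell_average_eq:
  fixes f :: "real ^ 'n \<Rightarrow> 'b::euclidean_space" and i :: "nat ^ 'n"
  assumes "1 \<le> N" "i \<in> multi_indices N"
  shows "cell_average N i f = (real N ^ CARD('n)) *\<^sub>R (LINT s|\<mu>. indicat_real (cell N i) s *\<^sub>R f s)"
proof -
  have "(LINT s|\<mu>. indicat_real (cell N i) s *\<^sub>R f s)
     = (LINT s|lebesgue. indicat_real cube s *\<^sub>R (indicat_real (cell N i) s *\<^sub>R f s))"
    by (rule integral_restrict_space) simp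
  also have "\<dots> = (LINT s|lebesgue. indicat_real (cell N i) s *\<^sub>R f s)"
    using cell_subset_cube[OF assms] by (intro Bochner_Integration.integral_cong) (auto simp: indicator_def)
  finally show ?thesis by (simp add: cell_average_def set_lebesgue_integral_def)
qed

text \<open>Nothing is assumed about measurability of \<open>f\<close>; it follows on the cell from
  agreeing almost everywhere with a constant. This is how the averages defining \<open>psi\<close>
  are evaluated.\<close>

lemma cell_average_AE_const:
  fixes f :: "real ^ 'n \<Rightarrow> 'b::euclidean_space" and i :: "nat ^ 'n"
  assumes N: "1 \<le> N" and i: "i \<in> multi_indices N"
    and eq: "AE s in \<mu>. s \<in> cell N i \<longrightarrow> f s = c"
  shows "cell_average N i f = c"
proof -
  note [measurable] = cell_sets[OF N i]
  have c: "(\<lambda>s. indicat_real (cell N i) s *\<^sub>R c) \<in> borel_measurable \<mu>" by measurable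
  have eq': "AE s in \<mu>. indicat_real (cell N i) s *\<^sub>R c = indicat_real (cell N i) s *\<^sub>R f s"
    using eq by eventually_elim (auto simp: indicator_def)
  have "(LINT s|\<mu>. indicat_real (cell N i) s *\<^sub>R f s) = (LINT s|\<mu>. indicat_real (cell N i) s *\<^sub>R c)"
    using eq' c borel_measurable_cube_AE[OF c eq'] by (intro integral_cong_AE) auto
  also have "\<dots> = measure \<mu> (cell N i) *\<^sub>R c"
    using cell_subset_cube[OF N i] by (subst integral_scaleR_left) (auto simp: Int_absorb1 Int_absorb2 less_top[symmetric] intro!: integrable_real_indicator)
  finally show ?thesis using N by (simp add: cell_average_eq[OF N i] measure_cell[OF N i])
qed

text \<open>The cells partition the cube up to a null set. The identity gives the initial total
  weight and the contraction property of cell averaging.\<close>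

lemma sum_cell_average:
  fixes f :: "real ^ 'n \<Rightarrow> 'b::euclidean_space"
  assumes N: "1 \<le> N" and f: "integrable \<mu> f"
  shows "(\<Sum>i\<in>multi_indices N. cell_average N i f) = (real N ^ CARD('n)) *\<^sub>R (LINT s|\<mu>. f s)"
proof -
  have int: "integrable \<mu> (\<lambda>s. indicat_real (cell N i) s *\<^sub>R f s)" if "i \<in> multi_indices N" for i :: "nat ^ 'n"
    using cell_sets[OF N that] f by (rule integrable_mult_indicator)
  have "(\<Sum>i\<in>multi_indices N. cell_average N i f)
    = (real N ^ CARD('n)) *\<^sub>R (\<Sum>i\<in>multi_indices N. LINT s|\<mu>. indicat_real (cell N i) s *\<^sub>R f s)"
    by (simp add: cell_average_eq[OF N] scaleR_sum_right)
  also have "(\<Sum>i\<in>multi_indices N. LINT s|\<mu>. indicat_real (cell N i) s *\<^sub>R f s)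
     = (LINT s|\<mu>. (\<Sum>i\<in>multi_indices N. indicat_real (cell N i) s *\<^sub>R f s))"
    using int by (simp add: integral_sum)
  also have "\<dots> = (LINT s|\<mu>. f s)"
  proof (rule integral_cong_AE)
    show "(\<lambda>s. \<Sum>i\<in>multi_indices N. indicat_real (cell N i) s *\<^sub>R f s) \<in> borel_measurable \<mu>"
      using int by (intro borel_measurable_sum) auto
    show "AE s in \<mu>. (\<Sum>i\<in>multi_indices N. indicat_real (cell N i) s *\<^sub>R f s) = f s"
      using AE_generic[OF N] by eventually_elim (rule sum_cells_generic[OF N])
  qed (use f in auto)
  finally show ?thesis .
qed

lemma step_function_measurable[measurable]:
  fixes y :: "nat \<Rightarrow> 'b::euclidean_space"
  shows "step_function N \<sigma> y \<in> borel_measurable borel"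
  unfolding step_function_def[abs_def] by measurable

lemma borel_imp_cube_measurable: "f \<in> borel_measurable borel \<Longrightarrow> f \<in> borel_measurable \<mu>"
  by (intro measurable_restrict_space1 measurable_completion) simp

section \<open>Interaction kernels\<close>

text \<open>The modulus inequality is required at every point, so \<open>S\<close> may be increased
  but not decreased. Setting the value to \<open>top\<close> on a Borel null set that contains all
  discrepancies keeps the inequality and all integrals.\<close>

lemma borel_majorant:
  fixes S :: "'a::euclidean_space \<Rightarrow> ennreal"
  assumes "S \<in> borel_measurable lebesgue"
  obtains S' where "S' \<in> borel_measurable borel" "\<And>z. S z \<le> S' z" "AE z in lebesgue. S' z = S z"
proof -
  obtain g where g: "g \<in> borel_measurable lborel" "AE z in lborel. S z = g z"
    using completion_ex_borel_measurable[OF assms] by blast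
  obtain N where N: "N \<in> null_sets lborel" "{z \<in> space lborel. S z \<noteq> g z} \<subseteq> N"
    using g(2) unfolding eventually_ae_filter by auto
  define S' where "S' z = (if z \<in> N then top else g z)" for z
  have [measurable]: "N \<in> sets borel" "g \<in> borel_measurable borel"
    using N(1) g(1) by (auto simp: null_sets_def)
  have "S' \<in> borel_measurable borel" unfolding S'_def[abs_def] by measurable
  moreover have eq: "g z = S z" if "z \<notin> N" for z using that subsetD[OF N(2), of z] by (cases "S z = g z") auto
  then have "S z \<le> S' z" for z by (auto simp: S'_def)
  moreover have "AE z in lebesgue. S' z = S z"
  proof -
    have "AE z in lebesgue. z \<notin> N"
      using N(1) by (intro AE_not_in) (auto intro: null_sets_completionI)
    then show ?thesis using eq by (auto simp: S'_def elim!: eventually_mono)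
  qed
  ultimately show ?thesis using that by blast
qed

text \<open>
  The singular weight is Borel here, so that its compositions with measurable maps are measurable;
  hypothesis (A3) provides this after passing to a Borel majorant.
\<close>

locale interaction =
  fixes \<a> \<s> :: "real ^ 'n \<Rightarrow> real ^ 'n" and S :: "real ^ 'n \<Rightarrow> ennreal" and L :: real
  assumes lipschitz: "L-lipschitz_on UNIV \<a>" and a_zero: "\<a> 0 = 0"
    and odd: "\<s> (- z) = - \<s> z"
    and S_borel[measurable]: "S \<in> borel_measurable borel"
    and S_integrable: "(\<integral>\<^sup>+z\<in>cball 0 r. S z \<partial>lborel) < \<infinity>"
    and s_modulus: "ennreal (norm (\<s> z1 - \<s> z2)) \<le> S z2 * ennreal (norm (z1 - z2))"
begin

lemma L_nonneg: "0 \<le> L" and a_diff: "norm (\<a> u - \<a> v) \<le> L * norm (u - v)"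
  using lipschitz lipschitz_onD[OF lipschitz, of u v] by (auto simp: lipschitz_on_def dist_norm)

lemma a_bound: "norm (\<a> u) \<le> L * norm u"
  using a_diff[of u 0] by (simp add: a_zero)

lemma a_borel[measurable]: "\<a> \<in> borel_measurable borel"
  using lipschitz_on_continuous_on[OF lipschitz] by (rule borel_measurable_continuous_onI)

section \<open>Growth and measurability of the force kernel, integrals of its modulus\<close>

lemma ex_finite_modulus: "\<exists>z. S z < \<infinity>"
proof (rule ccontr)
  assume "\<nexists>z. S z < \<infinity>"
  then have "S = (\<lambda>_. \<infinity>)" by (auto simp: less_top[symmetric])
  then have "(\<integral>\<^sup>+z\<in>cball 0 1. S z \<partial>lborel) = \<infinity> * emeasure lborel (cball (0 :: real ^ 'n) 1)"
    by (simp add: nn_integral_cmult_indicator)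
  moreover have "emeasure lborel (cball (0 :: real ^ 'n) 1) \<noteq> 0"
    using less_imp_neq[OF unit_ball_vol_pos[of "real CARD('n)"]] by (simp add: emeasure_cball)
  ultimately show False using S_integrable[of 1] by (simp add: ennreal_top_mult)
qed

text \<open>One point \<open>z0\<close> of finite modulus is enough: the inequality with
  \<open>z2 = z0\<close> holds for all \<open>z1\<close> and gives linear growth. Hence
  \<open>\<s>\<close> is bounded on balls however singular \<open>S\<close> is.\<close>

lemma s_growth: "\<exists>k\<ge>0. \<forall>z. norm (\<s> z) \<le> k * (1 + norm z)"
proof -
  obtain z0 where "S z0 < \<infinity>" using ex_finite_modulus by blast
  then obtain b where b: "S z0 = ennreal b" "0 \<le> b" by (cases "S z0") auto
  have "norm (\<s> z) \<le> (norm (\<s> z0) + b * (norm z0 + 1)) * (1 + norm z)" for z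
  proof -
    have "norm (\<s> z - \<s> z0) \<le> b * norm (z - z0)"
      using s_modulus[of z z0] b by (simp flip: ennreal_mult)
    also have "\<dots> \<le> b * (norm z + norm z0)"
      using b by (intro mult_left_mono norm_triangle_ineq4) auto
    finally have "norm (\<s> z) \<le> norm (\<s> z0) + b * (norm z + norm z0)"
      using norm_triangle_ineq2[of "\<s> z" "\<s> z0"] by simp
    also have "\<dots> \<le> norm (\<s> z0) * (1 + norm z) + b * ((norm z0 + 1) * (1 + norm z))"
      using b by (intro add_mono mult_left_mono) (auto simp: algebra_simps)
    finally show ?thesis by (simp add: algebra_simps)
  qed
  then show ?thesis using b by (intro exI[of _ "norm (\<s> z0) + b * (norm z0 + 1)"]) auto
qed

lemma s_bounded: "\<exists>k\<ge>0. \<forall>z. norm z \<le> r \<longrightarrow> norm (\<s> z) \<le> k"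
proof -
  obtain k where k: "k \<ge> 0" "\<And>z. norm (\<s> z) \<le> k * (1 + norm z)" using s_growth by blast
  have "norm (\<s> z) \<le> k * (1 + \<bar>r\<bar>)" if "norm z \<le> r" for z
    using k(2)[of z] mult_left_mono[of "1 + norm z" "1 + \<bar>r\<bar>" k] k(1) that by linarith
  then show ?thesis using k(1) by (intro exI[of _ "k * (1 + \<bar>r\<bar>)"]) auto
qed

text \<open>A finite modulus at \<open>z0\<close> bounds the increments from \<open>z0\<close>
  linearly. The restriction of \<open>\<s>\<close> to this Borel set therefore gives a Borel
  function, which composes with measurable maps; a merely Lebesgue measurable function need
  not.\<close>

lemma s_continuous: "continuous_on {z. S z < \<infinity>} \<s>"
proof (unfold continuous_on_iff, intro ballI allI impI)
  fix z0 e assume "z0 \<in> {z. S z < \<infinity>}" and e: "(0::real) < e"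
  then obtain b where b: "S z0 = ennreal b" "0 \<le> b" by (cases "S z0") auto
  show "\<exists>d>0. \<forall>z\<in>{z. S z < \<infinity>}. dist z z0 < d \<longrightarrow> dist (\<s> z) (\<s> z0) < e"
  proof (intro exI[of _ "e / (b + 1)"] conjI ballI impI)
    show "0 < e / (b + 1)" using b e by simp
    fix z assume "dist z z0 < e / (b + 1)"
    then have "norm (z - z0) * (b + 1) < e" using b by (simp add: dist_norm pos_less_divide_eq)
    moreover have "norm (\<s> z - \<s> z0) \<le> b * norm (z - z0)"
      using s_modulus[of z z0] b by (simp flip: ennreal_mult)
    moreover have "b * norm (z - z0) \<le> norm (z - z0) * (b + 1)" by (simp add: algebra_simps)
    ultimately show "dist (\<s> z) (\<s> z0) < e" by (simp add: dist_norm)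
  qed
qed

lemma S_finite_borel: "{z. S z < \<infinity>} \<in> sets borel"
  by measurable

lemma s_truncated_borel: "(\<lambda>z. indicat_real {z. S z < \<infinity>} z *\<^sub>R \<s> z) \<in> borel_measurable borel"
  using S_finite_borel s_continuous by (rule borel_measurable_continuous_on_indicator)

text \<open>Density bound of the image measure times the integral of \<open>S\<close> over the ball
  that contains all differences of points of norm at most \<open>R\<close>.\<close>

definition modulus_bound :: "real \<Rightarrow> real \<Rightarrow> ennreal" where
  "modulus_bound c R = ennreal ((10 / c) ^ CARD('n)) * (\<integral>\<^sup>+z\<in>cball 0 (2 * R). S z \<partial>lborel)"

lemma modulus_bound_finite: "modulus_bound c R < \<infinity>"
  unfolding modulus_bound_def using S_integrable by (simp add: ennreal_mult_less_top)

text \<open>Translation and reflection preserve the lower bound \<open>c\<close>, so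
  \<open>f x - v\<close> and \<open>v - f x\<close> are both covered by the density bound. Both are
  stated because \<open>S\<close> is not assumed even.\<close>

lemma nn_integral_modulus_le:
  fixes f :: "real ^ 'n \<Rightarrow> real ^ 'n"
  assumes f: "f \<in> borel_measurable \<mu>" and c: "0 < c"
    and low: "\<And>x y. x \<in> cube \<Longrightarrow> y \<in> cube \<Longrightarrow> c * norm (x - y) \<le> norm (f x - f y)"
    and R: "\<And>x. x \<in> cube \<Longrightarrow> norm (f x) \<le> R" and v: "norm v \<le> R"
  shows "(\<integral>\<^sup>+x. S (f x - v) \<partial>\<mu>) \<le> modulus_bound c R"
    and "(\<integral>\<^sup>+x. S (v - f x) \<partial>\<mu>) \<le> modulus_bound c R"
proof -
  let ?g = "\<lambda>z. S z * indicator (cball 0 (2 * R)) z"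
  have [measurable]: "cball 0 (2 * R) \<in> sets borel" by simp
  have [measurable]: "?g \<in> borel_measurable borel" by measurable
  have *: "(\<integral>\<^sup>+x. S (h x) \<partial>\<mu>) \<le> modulus_bound c R"
    if h: "h \<in> borel_measurable \<mu>"
      and lowh: "\<And>x y. x \<in> cube \<Longrightarrow> y \<in> cube \<Longrightarrow> c * norm (x - y) \<le> norm (h x - h y)"
      and bh: "\<And>x. x \<in> cube \<Longrightarrow> norm (h x) \<le> 2 * R"
    for h :: "real ^ 'n \<Rightarrow> real ^ 'n"
  proof -
    have "(\<integral>\<^sup>+x. S (h x) \<partial>\<mu>) = (\<integral>\<^sup>+x. ?g (h x) \<partial>\<mu>)"
      using bh by (intro nn_integral_cong) (auto simp: indicator_def)
    also have "\<dots> \<le> ennreal ((10 / c) ^ DIM(real ^ 'n)) * (\<integral>\<^sup>+z. ?g z \<partial>lborel)"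
      by (rule nn_integral_pushforward_le[OF cube_sets h c lowh]) auto
    finally show ?thesis by (simp add: modulus_bound_def)
  qed
  have b: "norm (f x - v) \<le> 2 * R" if "x \<in> cube" for x
    using norm_triangle_ineq4[of "f x" v] R[OF that] v by linarith
  show "(\<integral>\<^sup>+x. S (f x - v) \<partial>\<mu>) \<le> modulus_bound c R"
    by (rule *) (use f low b in auto)
  show "(\<integral>\<^sup>+x. S (v - f x) \<partial>\<mu>) \<le> modulus_bound c R"
    by (rule *) (use f low b in \<open>auto simp: norm_minus_commute\<close>)
qed

text \<open>A finite integral makes the modulus finite almost everywhere along the map, so the Borel
  truncation of \<open>\<s>\<close> agrees with \<open>\<s>\<close> there up to a null set.\<close>

lemma s_along_measurable:
  assumes f: "f \<in> borel_measurable \<mu>" and fin: "(\<integral>\<^sup>+x. S (v - f x) \<partial>\<mu>) < \<infinity>"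
  shows "(\<lambda>x. \<s> (v - f x)) \<in> borel_measurable \<mu>"
proof (rule borel_measurable_cube_AE)
  note [measurable] = f s_truncated_borel
  show "(\<lambda>x. indicat_real {z. S z < \<infinity>} (v - f x) *\<^sub>R \<s> (v - f x)) \<in> borel_measurable \<mu>"
    using measurable_compose[OF _ s_truncated_borel, of "\<lambda>x. v - f x" \<mu>] by simp
  have "AE x in \<mu>. S (v - f x) \<noteq> \<infinity>"
    using fin by (intro nn_integral_PInf_AE) auto
  then show "AE x in \<mu>. indicat_real {z. S z < \<infinity>} (v - f x) *\<^sub>R \<s> (v - f x) = \<s> (v - f x)"
    by eventually_elim (simp add: indicator_def less_top)
qed

text \<open>The velocity field generated by a profile, at an arbitrary point \<open>v\<close>. It is
  the right-hand side for the opinions and also what remains of the inner integral of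
  \<open>Psi\<close>.\<close>

definition drift :: "(real ^ 'n \<Rightarrow> real ^ 'n) \<Rightarrow> (real ^ 'n \<Rightarrow> real) \<Rightarrow> real ^ 'n \<Rightarrow> real ^ 'n" where
  "drift f m v = (LINT s|\<mu>. m s *\<^sub>R \<a> (f s - v))"

text \<open>The bounds hold only almost everywhere, since weights are determined up to null sets and
  a step function adds several values on a cell boundary.\<close>

definition bounded_profile :: "real \<Rightarrow> real \<Rightarrow> (real ^ 'n \<Rightarrow> real ^ 'n) \<Rightarrow> (real ^ 'n \<Rightarrow> real) \<Rightarrow> bool" where
  "bounded_profile R B f m \<longleftrightarrow> f \<in> borel_measurable \<mu> \<and> m \<in> borel_measurable \<mu> \<and>
     (AE s in \<mu>. norm (f s) \<le> R) \<and> (AE s in \<mu>. \<bar>m s\<bar> \<le> B)"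

lemma bounded_profile_nonneg:
  assumes "bounded_profile R B f m" shows "0 \<le> R" "0 \<le> B"
proof -
  have "AE s in \<mu>. norm (f s) \<le> R" "AE s in \<mu>. \<bar>m s\<bar> \<le> B"
    using assms by (auto simp: bounded_profile_def)
  then have "AE s::real ^ 'n in \<mu>. 0 \<le> R \<and> 0 \<le> B"
    by eventually_elim (use norm_ge_zero abs_ge_zero order_trans in blast)
  then show "0 \<le> R" "0 \<le> B" by simp_all
qed

lemma bounded_profile_mono:
  assumes P: "bounded_profile R B f m" and le: "R \<le> R'" "B \<le> B'"
  shows "bounded_profile R' B' f m"
proof -
  have ae: "AE s in \<mu>. norm (f s) \<le> R" "AE s in \<mu>. \<bar>m s\<bar> \<le> B"
    using P by (auto simp: bounded_profile_def)
  have "AE s in \<mu>. norm (f s) \<le> R'" using ae(1) by eventually_elim (use le in simp)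
  moreover have "AE s in \<mu>. \<bar>m s\<bar> \<le> B'" using ae(2) by eventually_elim (use le in simp)
  ultimately show ?thesis using P by (simp add: bounded_profile_def)
qed

lemma drift_integrand_bound:
  assumes "norm (f s) \<le> R" "norm v \<le> R'" "\<bar>m s\<bar> \<le> B"
  shows "norm (m s *\<^sub>R \<a> (f s - v)) \<le> B * (L * (R + R'))"
proof -
  have "norm (\<a> (f s - v)) \<le> L * norm (f s - v)" by (rule a_bound)
  also have "\<dots> \<le> L * (R + R')"
    using norm_triangle_ineq4[of "f s" v] assms L_nonneg by (intro mult_left_mono) auto
  finally show ?thesis using assms by (auto intro!: mult_mono)
qed

lemma drift_integrable:
  assumes P: "bounded_profile R B f m"
  shows "integrable \<mu> (\<lambda>s. m s *\<^sub>R \<a> (f s - v))"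
proof (rule cube.integrable_const_bound[where B = "B * (L * (R + norm v))"])
  have [measurable]: "f \<in> borel_measurable \<mu>" "m \<in> borel_measurable \<mu>"
    using P by (auto simp: bounded_profile_def)
  show "(\<lambda>s. m s *\<^sub>R \<a> (f s - v)) \<in> borel_measurable \<mu>" by measurable
  have "AE s in \<mu>. norm (f s) \<le> R" "AE s in \<mu>. \<bar>m s\<bar> \<le> B" using P by (auto simp: bounded_profile_def)
  then show "AE s in \<mu>. norm (m s *\<^sub>R \<a> (f s - v)) \<le> B * (L * (R + norm v))"
    by eventually_elim (rule drift_integrand_bound, auto)
qed

lemma norm_integral_cube_le:
  fixes g :: "real ^ 'n \<Rightarrow> 'b::euclidean_space"
  assumes "g \<in> borel_measurable \<mu>" "AE s in \<mu>. norm (g s) \<le> K"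
  shows "norm (LINT s|\<mu>. g s) \<le> K"
proof -
  have g: "integrable \<mu> g" using assms by (intro cube.integrable_const_bound) auto
  have "norm (LINT s|\<mu>. g s) \<le> (LINT s|\<mu>. norm (g s))" by (rule integral_norm_bound)
  also have "\<dots> \<le> (LINT s::real ^ 'n|\<mu>. K)" using assms g by (intro integral_mono_AE) auto
  finally show ?thesis by (simp add: cube.prob_space)
qed

lemma drift_bound:
  assumes P: "bounded_profile R B f m" and v: "norm v \<le> R"
  shows "norm (drift f m v) \<le> 2 * L * R * B"
proof -
  have "AE s in \<mu>. norm (f s) \<le> R" "AE s in \<mu>. \<bar>m s\<bar> \<le> B" using P by (auto simp: bounded_profile_def)
  then have "AE s in \<mu>. norm (m s *\<^sub>R \<a> (f s - v)) \<le> B * (L * (R + R))"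
    by eventually_elim (rule drift_integrand_bound, use v in auto)
  then have "norm (drift f m v) \<le> B * (L * (R + R))"
    unfolding drift_def using drift_integrable[OF P] by (intro norm_integral_cube_le) auto
  then show ?thesis by (simp add: algebra_simps)
qed

lemma drift_measurable[measurable]:
  assumes [measurable]: "f \<in> borel_measurable \<mu>" "m \<in> borel_measurable \<mu>"
  shows "drift f m \<in> borel_measurable borel"
  unfolding drift_def[abs_def] by measurable

lemma bounded_profile_diff_integrable:
  assumes P: "bounded_profile R B f m" and Q: "bounded_profile R B g n"
  shows "integrable \<mu> (\<lambda>s. \<bar>n s - m s\<bar>)" and "integrable \<mu> (\<lambda>s. norm (g s - f s))"
proof -
  have [measurable]: "f \<in> borel_measurable \<mu>" "m \<in> borel_measurable \<mu>" "g \<in> borel_measurable \<mu>" "n \<in> borel_measurable \<mu>"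
    using P Q by (auto simp: bounded_profile_def)
  have ae: "AE s in \<mu>. norm (f s) \<le> R" "AE s in \<mu>. \<bar>m s\<bar> \<le> B" "AE s in \<mu>. norm (g s) \<le> R" "AE s in \<mu>. \<bar>n s\<bar> \<le> B"
    using P Q by (auto simp: bounded_profile_def)
  show "integrable \<mu> (\<lambda>s. \<bar>n s - m s\<bar>)"
  proof (rule cube.integrable_const_bound[where B = "2 * B"])
    show "AE s in \<mu>. norm \<bar>n s - m s\<bar> \<le> 2 * B" using ae(2,4) by eventually_elim auto
  qed measurable
  show "integrable \<mu> (\<lambda>s. norm (g s - f s))"
  proof (rule cube.integrable_const_bound[where B = "2 * R"])
    show "AE s in \<mu>. norm (norm (g s - f s)) \<le> 2 * R" using ae(1,3)
    proof eventually_elim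
      case (elim s) then show ?case using norm_triangle_ineq4[of "g s" "f s"] by simp
    qed
  qed measurable
qed

text \<open>The difference splits into a change of weight, where the kernel \<open>\<a>\<close> is
  at most \<open>2 * L * R\<close>, and a change of argument, where it is
  \<open>L\<close>-Lipschitz. With both profiles equal it yields the Lipschitz constant
  \<open>B * L\<close> of a single velocity field.\<close>

lemma drift_diff:
  assumes P: "bounded_profile R B f m" and Q: "bounded_profile R B g n"
    and u: "norm u \<le> R" and v: "norm v \<le> R"
  shows "norm (drift g n u - drift f m v)
    \<le> 2 * L * R * (LINT s|\<mu>. \<bar>n s - m s\<bar>) + B * L * ((LINT s|\<mu>. norm (g s - f s)) + norm (u - v))"
proof -
  have [measurable]: "f \<in> borel_measurable \<mu>" "m \<in> borel_measurable \<mu>" "g \<in> borel_measurable \<mu>" "n \<in> borel_measurable \<mu>"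
    using P Q by (auto simp: bounded_profile_def)
  have ae: "AE s in \<mu>. norm (f s) \<le> R" "AE s in \<mu>. \<bar>m s\<bar> \<le> B" "AE s in \<mu>. norm (g s) \<le> R" "AE s in \<mu>. \<bar>n s\<bar> \<le> B"
    using P Q by (auto simp: bounded_profile_def)
  note int = bounded_profile_diff_integrable[OF P Q]
  have "drift g n u - drift f m v = (LINT s|\<mu>. n s *\<^sub>R \<a> (g s - u) - m s *\<^sub>R \<a> (f s - v))"
    unfolding drift_def using drift_integrable[OF P] drift_integrable[OF Q] by simp
  also have "norm \<dots> \<le> (LINT s|\<mu>. norm (n s *\<^sub>R \<a> (g s - u) - m s *\<^sub>R \<a> (f s - v)))"
    by (rule integral_norm_bound)
  also have "\<dots> \<le> (LINT s|\<mu>. 2 * L * R * \<bar>n s - m s\<bar> + B * L * (norm (g s - f s) + norm (u - v)))"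
  proof (rule integral_mono_AE)
    show "integrable \<mu> (\<lambda>s. norm (n s *\<^sub>R \<a> (g s - u) - m s *\<^sub>R \<a> (f s - v)))"
      using drift_integrable[OF P] drift_integrable[OF Q] by auto
    show "integrable \<mu> (\<lambda>s. 2 * L * R * \<bar>n s - m s\<bar> + B * L * (norm (g s - f s) + norm (u - v)))"
      using int by auto
    show "AE s in \<mu>. norm (n s *\<^sub>R \<a> (g s - u) - m s *\<^sub>R \<a> (f s - v))
      \<le> 2 * L * R * \<bar>n s - m s\<bar> + B * L * (norm (g s - f s) + norm (u - v))"
      using ae
    proof eventually_elim
      case (elim s)
      have "norm (\<a> (g s - u)) \<le> L * norm (g s - u)" by (rule a_bound)
      also have "\<dots> \<le> L * (2 * R)"
        using norm_triangle_ineq4[of "g s" u] elim u L_nonneg by (intro mult_left_mono) auto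
      finally have 1: "\<bar>n s - m s\<bar> * norm (\<a> (g s - u)) \<le> \<bar>n s - m s\<bar> * (L * (2 * R))"
        by (rule mult_left_mono) auto
      have "norm (\<a> (g s - u) - \<a> (f s - v)) \<le> L * norm ((g s - u) - (f s - v))" by (rule a_diff)
      also have "\<dots> \<le> L * (norm (g s - f s) + norm (u - v))"
        using norm_triangle_ineq4[of "g s - f s" "u - v"] L_nonneg
        by (intro mult_left_mono) (auto simp: algebra_simps)
      finally have 2: "\<bar>m s\<bar> * norm (\<a> (g s - u) - \<a> (f s - v)) \<le> B * (L * (norm (g s - f s) + norm (u - v)))"
        using elim by (intro mult_mono) auto
      have "n s *\<^sub>R \<a> (g s - u) - m s *\<^sub>R \<a> (f s - v)
        = (n s - m s) *\<^sub>R \<a> (g s - u) + m s *\<^sub>R (\<a> (g s - u) - \<a> (f s - v))"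
        by (simp add: algebra_simps)
      then have "norm (n s *\<^sub>R \<a> (g s - u) - m s *\<^sub>R \<a> (f s - v))
        \<le> \<bar>n s - m s\<bar> * norm (\<a> (g s - u)) + \<bar>m s\<bar> * norm (\<a> (g s - u) - \<a> (f s - v))"
        by (metis norm_triangle_ineq norm_scaleR real_norm_def)
      with 1 2 show ?case by (simp add: algebra_simps)
    qed
  qed
  also have "\<dots> = 2 * L * R * (LINT s|\<mu>. \<bar>n s - m s\<bar>) + B * L * ((LINT s|\<mu>. norm (g s - f s)) + norm (u - v))"
    using int by (simp add: cube.prob_space)
  finally show ?thesis .
qed

section \<open>Stability of the right-hand side\<close>

text \<open>The relative rate of change of the weight at \<open>s\<close>: \<open>Psi\<close>
  without its prefactor \<open>m s\<close> and with the second integration variable integrated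
  out.\<close>

definition force :: "(real ^ 'n \<Rightarrow> real ^ 'n) \<Rightarrow> (real ^ 'n \<Rightarrow> real) \<Rightarrow> real ^ 'n \<Rightarrow> real" where
  "force f m s = (LINT s1|\<mu>. m s1 * ((drift f m (f s) + drift f m (f s1)) \<bullet> \<s> (f s - f s1)))"

text \<open>Fubini: the integrand is bounded, as \<open>\<s>\<close> is bounded on balls, and the
  second variable enters only through \<open>m s2\<close> and the two values of \<open>\<a>\<close>,
  which integrate to two drifts. Measurability of the singular factor is a hypothesis because limit
  profiles and step functions obtain it for different reasons.\<close>

lemma Psi_eq_force:
  assumes P: "bounded_profile R B f m" and v: "norm (f s) \<le> R"
    and h: "(\<lambda>s1. \<s> (f s - f s1)) \<in> borel_measurable \<mu>"
  shows "Psi \<a> \<s> s f m = m s * force f m s"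
proof -
  have [measurable]: "f \<in> borel_measurable \<mu>" "m \<in> borel_measurable \<mu>"
    using P by (auto simp: bounded_profile_def)
  have ae: "AE s in \<mu>. norm (f s) \<le> R \<and> \<bar>m s\<bar> \<le> B"
    using P by (auto simp: bounded_profile_def)
  note nn = bounded_profile_nonneg[OF P]
  define H where "H s1 = \<s> (f s - f s1)" for s1
  have [measurable]: "H \<in> borel_measurable \<mu>" using h by (simp add: H_def[abs_def])
  define F where "F s1 s2 = m s1 * m s2 * ((\<a> (f s2 - f s) + \<a> (f s2 - f s1)) \<bullet> H s1)" for s1 s2
  obtain k where k: "k \<ge> 0" "\<And>z. norm z \<le> 2 * R \<Longrightarrow> norm (\<s> z) \<le> k"
    using s_bounded[of "2 * R"] by blast
  have Fm: "(\<lambda>p. F (fst p) (snd p)) \<in> borel_measurable (\<mu> \<Otimes>\<^sub>M \<mu>)"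
    unfolding F_def by measurable
  have Fi: "integrable (\<mu> \<Otimes>\<^sub>M \<mu>) (\<lambda>p. F (fst p) (snd p))"
  proof (rule cube_pair.P.integrable_const_bound[OF _ Fm])
    show "AE p in \<mu> \<Otimes>\<^sub>M \<mu>. norm (F (fst p) (snd p)) \<le> B * B * (4 * L * R * k)"
    proof (rule cube_pair.AE_pair_measure)
      show "{p \<in> space (\<mu> \<Otimes>\<^sub>M \<mu>). norm (F (fst p) (snd p)) \<le> B * B * (4 * L * R * k)} \<in> sets (\<mu> \<Otimes>\<^sub>M \<mu>)"
        using Fm by measurable
      show "AE s1 in \<mu>. AE s2 in \<mu>. norm (F (fst (s1, s2)) (snd (s1, s2))) \<le> B * B * (4 * L * R * k)"
        using ae
      proof eventually_elim
        case s1: (elim s1)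
        show ?case using ae
        proof eventually_elim
          case s2: (elim s2)
          have H: "norm (H s1) \<le> k"
            unfolding H_def using norm_triangle_ineq4[of "f s" "f s1"] v s1 by (intro k(2)) auto
          have A: "norm (\<a> (f s2 - w)) \<le> 2 * L * R" if "norm w \<le> R" for w
          proof -
            have "norm (\<a> (f s2 - w)) \<le> L * norm (f s2 - w)" by (rule a_bound)
            also have "\<dots> \<le> L * (2 * R)"
              using norm_triangle_ineq4[of "f s2" w] that s2 L_nonneg by (intro mult_left_mono) auto
            finally show ?thesis by simp
          qed
          have "norm (\<a> (f s2 - f s) + \<a> (f s2 - f s1)) \<le> 4 * L * R"
            using norm_triangle_ineq[of "\<a> (f s2 - f s)" "\<a> (f s2 - f s1)"] A[OF v] A[of "f s1"] s1 by simp
          then have "norm (\<a> (f s2 - f s) + \<a> (f s2 - f s1)) * norm (H s1) \<le> 4 * L * R * k"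
            using H L_nonneg nn by (intro mult_mono) auto
          then have "\<bar>(\<a> (f s2 - f s) + \<a> (f s2 - f s1)) \<bullet> H s1\<bar> \<le> 4 * L * R * k"
            using Cauchy_Schwarz_ineq2 order_trans by blast
          then show ?case
            using s1 s2 nn by (auto simp: F_def abs_mult intro!: mult_mono)
        qed
      qed
    qed
  qed
  have "Psi \<a> \<s> s f m = m s * (LINT p:cube \<times> cube|lebesgue. F (fst p) (snd p))"
    by (simp add: Psi_def F_def H_def case_prod_beta)
  also have "(LINT p:cube \<times> cube|lebesgue. F (fst p) (snd p)) = (LINT p|(\<mu> \<Otimes>\<^sub>M \<mu>). F (fst p) (snd p))"
    by (rule integral_lebesgue_on_Times[OF cube_lmeasurable cube_lmeasurable Fm])
  also have "\<dots> = (LINT s1|\<mu>. (LINT s2|\<mu>. F s1 s2))"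
    using cube_pair.integral_fst[of F] Fi by (simp add: case_prod_unfold)
  also have "(\<lambda>s1. (LINT s2|\<mu>. F s1 s2)) = (\<lambda>s1. m s1 * ((drift f m (f s) + drift f m (f s1)) \<bullet> H s1))"
  proof
    fix s1
    have "(LINT s2|\<mu>. F s1 s2)
      = (LINT s2|\<mu>. m s1 * ((m s2 *\<^sub>R \<a> (f s2 - f s) + m s2 *\<^sub>R \<a> (f s2 - f s1)) \<bullet> H s1))"
      by (intro Bochner_Integration.integral_cong) (auto simp: F_def algebra_simps)
    also have "\<dots> = m s1 * ((drift f m (f s) + drift f m (f s1)) \<bullet> H s1)"
      using drift_integrable[OF P] by (simp add: drift_def)
    finally show "(LINT s2|\<mu>. F s1 s2) = m s1 * ((drift f m (f s) + drift f m (f s1)) \<bullet> H s1)" .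
  qed
  finally show ?thesis by (simp add: force_def H_def)
qed

lemma force_integrand_bound:
  assumes P: "bounded_profile R B f m" and v: "norm (f s) \<le> R" "norm (f s1) \<le> R" "\<bar>m s1\<bar> \<le> B"
    and k: "\<And>z. norm z \<le> 2 * R \<Longrightarrow> norm (\<s> z) \<le> k"
  shows "norm (drift f m (f s) + drift f m (f s1)) \<le> 4 * L * R * B" (is ?A)
    and "norm (\<s> (f s - f s1)) \<le> k" (is ?B)
    and "\<bar>m s1 * ((drift f m (f s) + drift f m (f s1)) \<bullet> \<s> (f s - f s1))\<bar> \<le> B * (4 * L * R * B * k)"
proof -
  show A: ?A
    using norm_triangle_ineq[of "drift f m (f s)" "drift f m (f s1)"]
      drift_bound[OF P v(1)] drift_bound[OF P v(2)] by simp
  show B: ?B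
    using norm_triangle_ineq4[of "f s" "f s1"] v by (intro k) auto
  have "norm (drift f m (f s) + drift f m (f s1)) * norm (\<s> (f s - f s1)) \<le> 4 * L * R * B * k"
    using A B bounded_profile_nonneg[OF P] L_nonneg by (intro mult_mono) auto
  then have "\<bar>(drift f m (f s) + drift f m (f s1)) \<bullet> \<s> (f s - f s1)\<bar> \<le> 4 * L * R * B * k"
    using Cauchy_Schwarz_ineq2 order_trans by blast
  then show "\<bar>m s1 * ((drift f m (f s) + drift f m (f s1)) \<bullet> \<s> (f s - f s1))\<bar> \<le> B * (4 * L * R * B * k)"
    using v(3) bounded_profile_nonneg[OF P] by (auto simp: abs_mult intro!: mult_mono)
qed

lemma force_integrand:
  assumes P: "bounded_profile R B f m" and v: "norm (f s) \<le> R"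
    and h: "(\<lambda>s1. \<s> (f s - f s1)) \<in> borel_measurable \<mu>"
    and k: "\<And>z. norm z \<le> 2 * R \<Longrightarrow> norm (\<s> z) \<le> k"
  shows "integrable \<mu> (\<lambda>s1. m s1 * ((drift f m (f s) + drift f m (f s1)) \<bullet> \<s> (f s - f s1)))" (is ?I)
    and "\<bar>force f m s\<bar> \<le> B * (4 * L * R * B * k)"
proof -
  have [measurable]: "f \<in> borel_measurable \<mu>" "m \<in> borel_measurable \<mu>"
    using P by (auto simp: bounded_profile_def)
  note h[measurable]
  have m: "(\<lambda>s1. m s1 * ((drift f m (f s) + drift f m (f s1)) \<bullet> \<s> (f s - f s1))) \<in> borel_measurable \<mu>"
    by measurable
  have "AE s1 in \<mu>. norm (f s1) \<le> R" "AE s1 in \<mu>. \<bar>m s1\<bar> \<le> B"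
    using P by (auto simp: bounded_profile_def)
  then have b: "AE s1 in \<mu>. norm (m s1 * ((drift f m (f s) + drift f m (f s1)) \<bullet> \<s> (f s - f s1)))
      \<le> B * (4 * L * R * B * k)"
    by eventually_elim (use force_integrand_bound(3)[OF P v _ _ k] in auto)
  show ?I using b m by (rule cube.integrable_const_bound)
  show "\<bar>force f m s\<bar> \<le> B * (4 * L * R * B * k)"
    unfolding force_def using norm_integral_cube_le[OF m b] by simp
qed

text \<open>A Schur test for the kernel \<open>S (f s - f s1)\<close>: row integrals control the
  term with \<open>\<delta> s\<close>, and after exchanging the integrals column integrals control
  the term with \<open>\<delta> s1\<close>.\<close>

lemma nn_integral_weighted_modulus_le:
  fixes f g :: "real ^ 'n \<Rightarrow> real ^ 'n"
  assumes f[measurable]: "f \<in> borel_measurable \<mu>" and d[measurable]: "\<delta> \<in> borel_measurable \<mu>"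
    and c: "0 < c" and low: "\<And>x y. x \<in> cube \<Longrightarrow> y \<in> cube \<Longrightarrow> c * norm (x - y) \<le> norm (f x - f y)"
    and R: "\<And>x. x \<in> cube \<Longrightarrow> norm (f x) \<le> R"
  shows "(\<integral>\<^sup>+s. (\<integral>\<^sup>+s1. S (f s - f s1) * (\<delta> s + \<delta> s1) \<partial>\<mu>) \<partial>\<mu>) \<le> 2 * modulus_bound c R * (\<integral>\<^sup>+s. \<delta> s \<partial>\<mu>)"
proof -
  let ?\<Sigma> = "modulus_bound c R"
  have le: "(\<integral>\<^sup>+s1. S (f s - f s1) \<partial>\<mu>) \<le> ?\<Sigma>" "(\<integral>\<^sup>+s1. S (f s1 - f s) \<partial>\<mu>) \<le> ?\<Sigma>" if "s \<in> cube" for s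
    using nn_integral_modulus_le[OF f c low R, of "f s"] R[OF that] by auto
  have "(\<integral>\<^sup>+s. (\<integral>\<^sup>+s1. S (f s - f s1) * (\<delta> s + \<delta> s1) \<partial>\<mu>) \<partial>\<mu>)
    = (\<integral>\<^sup>+s. (\<integral>\<^sup>+s1. S (f s - f s1) * \<delta> s \<partial>\<mu>) + (\<integral>\<^sup>+s1. S (f s - f s1) * \<delta> s1 \<partial>\<mu>) \<partial>\<mu>)"
    by (simp add: distrib_left nn_integral_add)
  also have "\<dots> = (\<integral>\<^sup>+s. (\<integral>\<^sup>+s1. S (f s - f s1) * \<delta> s \<partial>\<mu>) \<partial>\<mu>) + (\<integral>\<^sup>+s. (\<integral>\<^sup>+s1. S (f s - f s1) * \<delta> s1 \<partial>\<mu>) \<partial>\<mu>)"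
    by (rule nn_integral_add) measurable
  also have "(\<integral>\<^sup>+s. (\<integral>\<^sup>+s1. S (f s - f s1) * \<delta> s1 \<partial>\<mu>) \<partial>\<mu>) = (\<integral>\<^sup>+s1. (\<integral>\<^sup>+s. S (f s - f s1) * \<delta> s1 \<partial>\<mu>) \<partial>\<mu>)"
    by (rule cube_pair.Fubini') measurable
  also have "(\<integral>\<^sup>+s. (\<integral>\<^sup>+s1. S (f s - f s1) * \<delta> s \<partial>\<mu>) \<partial>\<mu>) = (\<integral>\<^sup>+s. (\<integral>\<^sup>+s1. S (f s - f s1) \<partial>\<mu>) * \<delta> s \<partial>\<mu>)"
    by (intro nn_integral_cong nn_integral_multc) measurable
  also have "(\<integral>\<^sup>+s1. (\<integral>\<^sup>+s. S (f s - f s1) * \<delta> s1 \<partial>\<mu>) \<partial>\<mu>) = (\<integral>\<^sup>+s1. (\<integral>\<^sup>+s. S (f s - f s1) \<partial>\<mu>) * \<delta> s1 \<partial>\<mu>)"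
    by (intro nn_integral_cong nn_integral_multc) measurable
  also have "(\<integral>\<^sup>+s. (\<integral>\<^sup>+s1. S (f s - f s1) \<partial>\<mu>) * \<delta> s \<partial>\<mu>) + (\<integral>\<^sup>+s1. (\<integral>\<^sup>+s. S (f s - f s1) \<partial>\<mu>) * \<delta> s1 \<partial>\<mu>)
    \<le> (\<integral>\<^sup>+s. ?\<Sigma> * \<delta> s \<partial>\<mu>) + (\<integral>\<^sup>+s. ?\<Sigma> * \<delta> s \<partial>\<mu>)"
    by (intro add_mono nn_integral_mono mult_right_mono) (auto intro: le)
  also have "\<dots> = 2 * ?\<Sigma> * (\<integral>\<^sup>+s. \<delta> s \<partial>\<mu>)"
    by (simp add: nn_integral_cmult mult_2 distrib_right)
  finally show ?thesis .
qed

text \<open>Three changes made one at a time: weight, drifts, interaction. The last is left as a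
  difference of values of \<open>\<s>\<close>, because a bound for it involves the possibly infinite
  modulus and is useful only after integration.\<close>

lemma force_integrand_diff:
  assumes P: "bounded_profile R B f m" and Q: "bounded_profile R B g n"
    and s: "norm (f s) \<le> R" "norm (g s) \<le> R"
    and s1: "norm (f s1) \<le> R" "norm (g s1) \<le> R" "\<bar>m s1\<bar> \<le> B" "\<bar>n s1\<bar> \<le> B"
    and k: "\<And>z. norm z \<le> 2 * R \<Longrightarrow> norm (\<s> z) \<le> k"
    and E: "E = (LINT s|\<mu>. \<bar>n s - m s\<bar>)" and D: "D = (LINT s|\<mu>. norm (g s - f s))"
  shows "\<bar>n s1 * ((drift g n (g s) + drift g n (g s1)) \<bullet> \<s> (g s - g s1))
       - m s1 * ((drift f m (f s) + drift f m (f s1)) \<bullet> \<s> (f s - f s1))\<bar>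
    \<le> 4 * L * R * B * k * \<bar>n s1 - m s1\<bar>
      + B * k * (4 * L * R * E + B * L * (2 * D + norm (g s - f s) + norm (g s1 - f s1)))
      + B * (4 * L * R * B) * norm (\<s> (g s - g s1) - \<s> (f s - f s1))"
proof -
  define Wg Wf hg hf where "Wg = drift g n (g s) + drift g n (g s1)" and "Wf = drift f m (f s) + drift f m (f s1)"
    and "hg = \<s> (g s - g s1)" and "hf = \<s> (f s - f s1)"
  note nn = bounded_profile_nonneg[OF P]
  have Wg: "norm Wg \<le> 4 * L * R * B" and hg: "norm hg \<le> k"
    using force_integrand_bound(1,2)[OF Q s(2) s1(2,4) k] by (auto simp: Wg_def hg_def)
  have Wf: "norm Wf \<le> 4 * L * R * B" and hf: "norm hf \<le> k"
    using force_integrand_bound(1,2)[OF P s(1) s1(1,3) k] by (auto simp: Wf_def hf_def)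
  have k0: "0 \<le> k" using hg norm_ge_zero order_trans by blast
  have WW: "norm (Wg - Wf) \<le> 4 * L * R * E + B * L * (2 * D + norm (g s - f s) + norm (g s1 - f s1))"
  proof -
    have "norm (Wg - Wf) \<le> norm (drift g n (g s) - drift f m (f s)) + norm (drift g n (g s1) - drift f m (f s1))"
      unfolding Wg_def Wf_def by (metis add_diff_add norm_triangle_ineq)
    then show ?thesis
      using drift_diff[OF P Q s(2) s(1)] drift_diff[OF P Q s1(2) s1(1)] unfolding E D
      by (simp add: algebra_simps)
  qed
  have 1: "\<bar>(n s1 - m s1) * (Wg \<bullet> hg)\<bar> \<le> 4 * L * R * B * k * \<bar>n s1 - m s1\<bar>"
  proof -
    have "\<bar>Wg \<bullet> hg\<bar> \<le> norm Wg * norm hg" by (rule Cauchy_Schwarz_ineq2)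
    also have "\<dots> \<le> 4 * L * R * B * k" using Wg hg L_nonneg nn k0 by (intro mult_mono) auto
    finally have "\<bar>n s1 - m s1\<bar> * \<bar>Wg \<bullet> hg\<bar> \<le> \<bar>n s1 - m s1\<bar> * (4 * L * R * B * k)"
      by (rule mult_left_mono) simp
    then show ?thesis by (simp add: abs_mult mult_ac)
  qed
  have 2: "\<bar>m s1 * ((Wg - Wf) \<bullet> hg)\<bar> \<le> B * k * (4 * L * R * E + B * L * (2 * D + norm (g s - f s) + norm (g s1 - f s1)))"
  proof -
    have "\<bar>(Wg - Wf) \<bullet> hg\<bar> \<le> norm (Wg - Wf) * norm hg" by (rule Cauchy_Schwarz_ineq2)
    also have "\<dots> \<le> norm (Wg - Wf) * k" using hg by (intro mult_left_mono) auto
    also have "\<dots> \<le> (4 * L * R * E + B * L * (2 * D + norm (g s - f s) + norm (g s1 - f s1))) * k"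
      using WW k0 by (intro mult_right_mono) auto
    finally have "\<bar>m s1\<bar> * \<bar>(Wg - Wf) \<bullet> hg\<bar>
       \<le> B * ((4 * L * R * E + B * L * (2 * D + norm (g s - f s) + norm (g s1 - f s1))) * k)"
      using s1(3) nn by (intro mult_mono) auto
    then show ?thesis by (simp add: abs_mult mult_ac)
  qed
  have 3: "\<bar>m s1 * (Wf \<bullet> (hg - hf))\<bar> \<le> B * (4 * L * R * B) * norm (hg - hf)"
  proof -
    have "\<bar>Wf \<bullet> (hg - hf)\<bar> \<le> norm Wf * norm (hg - hf)" by (rule Cauchy_Schwarz_ineq2)
    also have "\<dots> \<le> 4 * L * R * B * norm (hg - hf)" using Wf by (intro mult_right_mono) auto
    finally have "\<bar>m s1\<bar> * \<bar>Wf \<bullet> (hg - hf)\<bar> \<le> B * (4 * L * R * B * norm (hg - hf))"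
      using s1(3) nn by (intro mult_mono) auto
    then show ?thesis by (simp add: abs_mult mult_ac)
  qed
  have "n s1 * (Wg \<bullet> hg) - m s1 * (Wf \<bullet> hf)
    = (n s1 - m s1) * (Wg \<bullet> hg) + m s1 * ((Wg - Wf) \<bullet> hg) + m s1 * (Wf \<bullet> (hg - hf))"
    by (simp add: algebra_simps inner_diff_left inner_diff_right)
  then have "\<bar>n s1 * (Wg \<bullet> hg) - m s1 * (Wf \<bullet> hf)\<bar>
    \<le> \<bar>(n s1 - m s1) * (Wg \<bullet> hg)\<bar> + \<bar>m s1 * ((Wg - Wf) \<bullet> hg)\<bar> + \<bar>m s1 * (Wf \<bullet> (hg - hf))\<bar>"
    by linarith
  with 1 2 3 show ?thesis unfolding Wg_def Wf_def hg_def hf_def by linarith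
qed

text \<open>\<open>C\<close> is chosen before the profiles, which makes the estimate uniform in
  \<open>N\<close>. Only \<open>f\<close> is assumed bounded below. The majorant \<open>b\<close> is
  used so that measurability of \<open>Psi\<close> in \<open>s\<close> never has to be
  discussed.\<close>

lemma Psi_stability:
  fixes R B c :: real
  assumes c: "0 < c"
  shows "\<exists>C\<ge>0. \<forall>f m g n. bounded_profile R B f m \<longrightarrow> bounded_profile R B g n \<longrightarrow>
      (\<forall>s\<in>cube. norm (f s) \<le> R) \<longrightarrow>
      (\<forall>s\<in>cube. \<forall>s1\<in>cube. c * norm (s - s1) \<le> norm (f s - f s1)) \<longrightarrow>
      (AE s in \<mu>. (\<lambda>s1. \<s> (g s - g s1)) \<in> borel_measurable \<mu>) \<longrightarrow>
      (\<exists>b\<in>borel_measurable \<mu>. (AE s in \<mu>. ennreal \<bar>Psi \<a> \<s> s g n - Psi \<a> \<s> s f m\<bar> \<le> b s) \<and>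
         (\<integral>\<^sup>+s. b s \<partial>\<mu>) \<le> ennreal (C * ((LINT s|\<mu>. norm (g s - f s)) + (LINT s|\<mu>. \<bar>n s - m s\<bar>))))"
proof -
  obtain k where k: "k \<ge> 0" "\<And>z. norm z \<le> 2 * R \<Longrightarrow> norm (\<s> z) \<le> k"
    using s_bounded[of "2 * R"] by blast
  obtain \<Sigma> where \<Sigma>: "modulus_bound c R = ennreal \<Sigma>" "0 \<le> \<Sigma>"
    using modulus_bound_finite[of c R] by (cases "modulus_bound c R") auto
  \<comment> \<open>Absolute values, because no profile is given yet and nonnegativity of
    \<open>R\<close> and \<open>B\<close> follows only from the existence of one.\<close>
  define B' R' where "B' = \<bar>B\<bar>" and "R' = \<bar>R\<bar>"
  \<comment> \<open>The sum of the bound for \<open>force\<close> and of the coefficients in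
    \<open>force_integrand_diff\<close>, so that each of them can be replaced by the single constant
    \<open>K\<close>.\<close>
  define K where "K = B' * (4 * L * R' * B' * k) + 4 * L * R' * B' * k + B' * k * (4 * L * R' + 2 * B' * L) + B' * (4 * L * R' * B')"
  have K0: "0 \<le> K" using k(1) L_nonneg by (auto simp: K_def B'_def R'_def)
  \<comment> \<open>\<open>K\<close> comes from the change of the prefactor,
    \<open>3 * B' * K\<close> from the regular terms of the force, and \<open>2 * \<Sigma>\<close>
    from the Schur test.\<close>
  define C where "C = K + 3 * B' * K + B' * K * (2 * \<Sigma>)"
  have "0 \<le> C" using K0 \<Sigma> by (simp add: C_def B'_def)
  show ?thesis
  proof (intro exI[of _ C] conjI allI impI, fact)
    fix f g :: "real ^ 'n \<Rightarrow> real ^ 'n" and m n :: "real ^ 'n \<Rightarrow> real"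
    assume P: "bounded_profile R B f m" and Q: "bounded_profile R B g n"
      and fR: "\<forall>s\<in>cube. norm (f s) \<le> R"
      and low: "\<forall>s\<in>cube. \<forall>s1\<in>cube. c * norm (s - s1) \<le> norm (f s - f s1)"
      and hg: "AE s in \<mu>. (\<lambda>s1. \<s> (g s - g s1)) \<in> borel_measurable \<mu>"
    have [measurable]: "f \<in> borel_measurable \<mu>" "m \<in> borel_measurable \<mu>" "g \<in> borel_measurable \<mu>" "n \<in> borel_measurable \<mu>"
      using P Q by (auto simp: bounded_profile_def)
    have ae: "AE s in \<mu>. norm (f s) \<le> R" "AE s in \<mu>. \<bar>m s\<bar> \<le> B" "AE s in \<mu>. norm (g s) \<le> R" "AE s in \<mu>. \<bar>n s\<bar> \<le> B"
      using P Q by (auto simp: bounded_profile_def)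
    note nn = bounded_profile_nonneg[OF P]
    then have BR: "B' = B" "R' = R" by (auto simp: B'_def R'_def)
    note int = bounded_profile_diff_integrable[OF P Q]
    define E D where "E = (LINT s|\<mu>. \<bar>n s - m s\<bar>)" and "D = (LINT s|\<mu>. norm (g s - f s))"
    have ED: "0 \<le> E" "0 \<le> D" by (auto simp: E_def D_def)
    let ?\<delta> = "\<lambda>s. norm (g s - f s)"
    let ?G = "\<lambda>s. \<integral>\<^sup>+s1. S (f s - f s1) * (ennreal (?\<delta> s) + ennreal (?\<delta> s1)) \<partial>\<mu>"
    \<comment> \<open>The regular and the singular contributions are kept apart: the first has a
      real integral, the second is an extended integral whose size is known only after integrating
      over \<open>s\<close> as well.\<close>
    define b where "b s = ennreal (K * \<bar>n s - m s\<bar> + B * K * (2 * E + 2 * D + ?\<delta> s)) + ennreal (B * K) * ?G s" for s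
    have [measurable]: "b \<in> borel_measurable \<mu>" unfolding b_def[abs_def] by measurable
    have hf: "(\<lambda>s1. \<s> (f s - f s1)) \<in> borel_measurable \<mu>" if "s \<in> cube" for s
    proof (rule s_along_measurable)
      have "(\<integral>\<^sup>+x. S (f s - f x) \<partial>\<mu>) \<le> modulus_bound c R"
        by (rule nn_integral_modulus_le(2)) (use low fR that c in auto)
      then show "(\<integral>\<^sup>+x. S (f s - f x) \<partial>\<mu>) < \<infinity>" using modulus_bound_finite by (rule order.strict_trans1)
    qed measurable
    have "AE s in \<mu>. ennreal \<bar>Psi \<a> \<s> s g n - Psi \<a> \<s> s f m\<bar> \<le> b s"
      using ae hg AE_space
    proof eventually_elim
      case (elim s)
      note hfs = hf[of s]
      have sc: "s \<in> cube" using elim by simp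
      have Pf: "Psi \<a> \<s> s f m = m s * force f m s"
        using elim by (intro Psi_eq_force[OF P] hf) auto
      have Pg: "Psi \<a> \<s> s g n = n s * force g n s"
        using elim by (intro Psi_eq_force[OF Q]) auto
      note fi = force_integrand[OF P elim(1) hf[OF sc] k(2)] force_integrand[OF Q elim(3) elim(5) k(2)]
      have "\<bar>n s * force g n s - m s * force f m s\<bar>
        = \<bar>(n s - m s) * force f m s + n s * (force g n s - force f m s)\<bar>" by (simp add: algebra_simps)
      also have "\<dots> \<le> \<bar>n s - m s\<bar> * \<bar>force f m s\<bar> + \<bar>n s\<bar> * \<bar>force g n s - force f m s\<bar>"
        by (metis abs_mult abs_triangle_ineq)
      also have "\<dots> \<le> \<bar>n s - m s\<bar> * K + B * \<bar>force g n s - force f m s\<bar>"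
      proof (intro add_mono mult_left_mono mult_right_mono)
        have "\<bar>force f m s\<bar> \<le> B * (4 * L * R * B * k)" by (rule fi(2))
        also have "\<dots> \<le> K" using nn k(1) L_nonneg by (simp add: K_def BR)
        finally show "\<bar>force f m s\<bar> \<le> K" .
      qed (use elim in auto)
      finally have 1: "\<bar>Psi \<a> \<s> s g n - Psi \<a> \<s> s f m\<bar> \<le> K * \<bar>n s - m s\<bar> + B * \<bar>force g n s - force f m s\<bar>"
        unfolding Pf Pg by (simp add: mult.commute)
      let ?\<phi> = "\<lambda>s1. n s1 * ((drift g n (g s) + drift g n (g s1)) \<bullet> \<s> (g s - g s1))
          - m s1 * ((drift f m (f s) + drift f m (f s1)) \<bullet> \<s> (f s - f s1))"
      let ?r = "\<lambda>s1. K * (\<bar>n s1 - m s1\<bar> + E + D + ?\<delta> s + ?\<delta> s1)"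
      have "ennreal \<bar>force g n s - force f m s\<bar> = ennreal (norm (LINT s1|\<mu>. ?\<phi> s1))"
        unfolding force_def using fi(1,3) by simp
      also have "\<dots> \<le> (\<integral>\<^sup>+s1. ennreal (norm (?\<phi> s1)) \<partial>\<mu>)"
        using fi(1,3) by (intro integral_norm_bound_ennreal) auto
      also have "\<dots> \<le> (\<integral>\<^sup>+s1. ennreal (?r s1) + ennreal K * (S (f s - f s1) * (ennreal (?\<delta> s) + ennreal (?\<delta> s1))) \<partial>\<mu>)"
      proof (rule nn_integral_mono_AE)
        show "AE s1 in \<mu>. ennreal (norm (?\<phi> s1))
          \<le> ennreal (?r s1) + ennreal K * (S (f s - f s1) * (ennreal (?\<delta> s) + ennreal (?\<delta> s1)))"
          using ae
        proof eventually_elim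
          case e1: (elim s1)
          let ?h = "norm (\<s> (g s - g s1) - \<s> (f s - f s1))"
          have "\<bar>?\<phi> s1\<bar> \<le> 4 * L * R * B * k * \<bar>n s1 - m s1\<bar>
            + B * k * (4 * L * R * E + B * L * (2 * D + ?\<delta> s + ?\<delta> s1))
            + B * (4 * L * R * B) * ?h"
            by (rule force_integrand_diff[OF P Q elim(1,3) e1(1,3,2,4) k(2) E_def D_def])
          also have "\<dots> \<le> K * \<bar>n s1 - m s1\<bar> + K * (E + D + ?\<delta> s + ?\<delta> s1) + K * ?h"
          proof (intro add_mono)
            have z: "0 \<le> B * (4 * L * R * B * k)" "0 \<le> 4 * L * R * B * k" "0 \<le> B * k * (4 * L * R)" "0 \<le> B * k * (2 * B * L)"
               "0 \<le> B * (4 * L * R * B)" "0 \<le> B * k * (B * L)"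
              using nn k(1) L_nonneg by auto
            have KK: "K = B * (4 * L * R * B * k) + 4 * L * R * B * k + B * k * (4 * L * R) + B * k * (2 * B * L) + B * (4 * L * R * B)"
              by (simp add: K_def BR algebra_simps)
            show "4 * L * R * B * k * \<bar>n s1 - m s1\<bar> \<le> K * \<bar>n s1 - m s1\<bar>"
              by (rule mult_right_mono) (use z in \<open>auto simp: KK\<close>)
            show "B * (4 * L * R * B) * ?h \<le> K * ?h"
              by (rule mult_right_mono) (use z in \<open>auto simp: KK\<close>)
            have "B * k * (4 * L * R * E + B * L * (2 * D + ?\<delta> s + ?\<delta> s1))
              = B * k * (4 * L * R) * E + B * k * (2 * B * L) * D + B * k * (B * L) * (?\<delta> s + ?\<delta> s1)"
              by (simp add: algebra_simps)
            also have "\<dots> \<le> K * E + K * D + K * (?\<delta> s + ?\<delta> s1)"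
            proof (intro add_mono mult_right_mono)
              show "B * k * (B * L) \<le> K" using z by (simp add: KK)
            qed (use z ED in \<open>auto simp: KK\<close>)
            finally show "B * k * (4 * L * R * E + B * L * (2 * D + ?\<delta> s + ?\<delta> s1)) \<le> K * (E + D + ?\<delta> s + ?\<delta> s1)"
              by (simp add: algebra_simps)
          qed
          finally have "\<bar>?\<phi> s1\<bar> \<le> ?r s1 + K * ?h" by (simp add: algebra_simps)
          then have "ennreal (norm (?\<phi> s1)) \<le> ennreal (?r s1) + ennreal K * ennreal ?h"
            using K0 ED by (simp add: ennreal_leI flip: ennreal_plus ennreal_mult)
          \<comment> \<open>The modulus is taken at \<open>f s - f s1\<close>, on the profile that
            is bounded below; at \<open>g s - g s1\<close> no integral bound is available.\<close>
          also have "ennreal ?h \<le> S (f s - f s1) * ennreal (norm ((g s - g s1) - (f s - f s1)))"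
            by (rule s_modulus)
          also have "\<dots> \<le> S (f s - f s1) * (ennreal (?\<delta> s) + ennreal (?\<delta> s1))"
          proof (rule mult_left_mono)
            have "norm ((g s - g s1) - (f s - f s1)) \<le> ?\<delta> s + ?\<delta> s1"
              using norm_triangle_ineq4[of "g s - f s" "g s1 - f s1"] by (simp add: algebra_simps)
            then show "ennreal (norm ((g s - g s1) - (f s - f s1))) \<le> ennreal (?\<delta> s) + ennreal (?\<delta> s1)"
              by (simp add: ennreal_leI flip: ennreal_plus)
          qed simp
          finally show ?case by (simp add: mult_left_mono)
        qed
      qed
      also have "\<dots> = (\<integral>\<^sup>+s1. ennreal (?r s1) \<partial>\<mu>) + ennreal K * ?G s"
        by (subst nn_integral_add) (auto simp: nn_integral_cmult)
      also have "(\<integral>\<^sup>+s1. ennreal (?r s1) \<partial>\<mu>) = ennreal (LINT s1|\<mu>. ?r s1)"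
        using int K0 ED by (intro nn_integral_eq_integral) auto
      \<comment> \<open>\<open>E\<close> and \<open>D\<close> occur twice: once as constants over a
        cube of measure one, once as the integrals of the terms in \<open>s1\<close>.\<close>
      also have "(LINT s1|\<mu>. ?r s1) = K * (2 * E + 2 * D + ?\<delta> s)"
        using int by (simp add: E_def[symmetric] D_def[symmetric])
      finally have 2: "ennreal \<bar>force g n s - force f m s\<bar> \<le> ennreal (K * (2 * E + 2 * D + ?\<delta> s)) + ennreal K * ?G s" .
      have "ennreal \<bar>Psi \<a> \<s> s g n - Psi \<a> \<s> s f m\<bar>
        \<le> ennreal (K * \<bar>n s - m s\<bar>) + ennreal B * ennreal \<bar>force g n s - force f m s\<bar>"
        using 1 K0 nn by (simp add: ennreal_leI flip: ennreal_plus ennreal_mult)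
      also have "\<dots> \<le> ennreal (K * \<bar>n s - m s\<bar>)
        + ennreal B * (ennreal (K * (2 * E + 2 * D + ?\<delta> s)) + ennreal K * ?G s)"
        by (intro add_left_mono mult_left_mono 2) simp
      also have "\<dots> = b s"
        unfolding b_def using K0 nn ED by (simp add: distrib_left ennreal_mult mult.assoc add.assoc)
      finally show ?case .
    qed
    moreover have "(\<integral>\<^sup>+s. b s \<partial>\<mu>) \<le> ennreal (C * (D + E))"
    proof -
      have "(\<integral>\<^sup>+s. b s \<partial>\<mu>) = (\<integral>\<^sup>+s. ennreal (K * \<bar>n s - m s\<bar> + B * K * (2 * E + 2 * D + ?\<delta> s)) \<partial>\<mu>)
         + ennreal (B * K) * (\<integral>\<^sup>+s. ?G s \<partial>\<mu>)"
        unfolding b_def by (subst nn_integral_add) (auto simp: nn_integral_cmult)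
      also have "(\<integral>\<^sup>+s. ennreal (K * \<bar>n s - m s\<bar> + B * K * (2 * E + 2 * D + ?\<delta> s)) \<partial>\<mu>)
        = ennreal (LINT s|\<mu>. K * \<bar>n s - m s\<bar> + B * K * (2 * E + 2 * D + ?\<delta> s))"
        using int K0 ED nn by (intro nn_integral_eq_integral) auto
      also have "(LINT s|\<mu>. K * \<bar>n s - m s\<bar> + B * K * (2 * E + 2 * D + ?\<delta> s)) = K * E + B * K * (2 * E + 3 * D)"
        using int by (simp add: E_def[symmetric] D_def[symmetric])
      also have "(\<integral>\<^sup>+s. ?G s \<partial>\<mu>) \<le> 2 * modulus_bound c R * (\<integral>\<^sup>+s. ennreal (?\<delta> s) \<partial>\<mu>)"
        by (rule nn_integral_weighted_modulus_le) (use c low fR in auto)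
      also have "(\<integral>\<^sup>+s. ennreal (?\<delta> s) \<partial>\<mu>) = ennreal D"
        unfolding D_def using int by (intro nn_integral_eq_integral) auto
      finally have "(\<integral>\<^sup>+s. b s \<partial>\<mu>) \<le> ennreal (K * E + B * K * (2 * E + 3 * D))
        + ennreal (B * K) * (2 * modulus_bound c R * ennreal D)"
        by (simp add: mult_left_mono)
      also have "2 * modulus_bound c R * ennreal D = ennreal (2 * \<Sigma> * D)"
        using \<Sigma> ED by (simp add: ennreal_mult)
      also have "ennreal (K * E + B * K * (2 * E + 3 * D)) + ennreal (B * K) * ennreal (2 * \<Sigma> * D)
        = ennreal (K * E + B * K * (2 * E + 3 * D) + B * K * (2 * \<Sigma> * D))"
        using K0 nn ED \<Sigma> by (simp add: ennreal_mult)
      also have "\<dots> \<le> ennreal (C * (D + E))"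
      proof (rule ennreal_leI)
        have "0 \<le> K * D + B * K * E + B * K * (2 * \<Sigma> * E)" using K0 nn ED \<Sigma> by simp
        then show "K * E + B * K * (2 * E + 3 * D) + B * K * (2 * \<Sigma> * D) \<le> C * (D + E)"
          by (simp add: C_def BR algebra_simps)
      qed
      finally show ?thesis .
    qed
    ultimately show "\<exists>b\<in>borel_measurable \<mu>. (AE s in \<mu>. ennreal \<bar>Psi \<a> \<s> s g n - Psi \<a> \<s> s f m\<bar> \<le> b s) \<and>
         (\<integral>\<^sup>+s. b s \<partial>\<mu>) \<le> ennreal (C * ((LINT s|\<mu>. norm (g s - f s)) + (LINT s|\<mu>. \<bar>n s - m s\<bar>)))"
      unfolding E_def D_def by (intro bexI[of _ b]) auto
  qed
qed

end

lemma integrable_indicator_cell: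
  fixes i :: "nat ^ 'n"
  assumes N: "1 \<le> N" and i: "i \<in> multi_indices N"
  shows "integrable \<mu> (indicat_real (cell N i))"
    and "(LINT s|\<mu>. indicat_real (cell N i) s) = 1 / real N ^ CARD('n)"
proof -
  show "integrable \<mu> (indicat_real (cell N i))"
    using cell_sets[OF assms] by (intro integrable_real_indicator) (auto simp: less_top[symmetric])
  have "(LINT s|\<mu>. indicat_real (cell N i) s) = measure \<mu> (cell N i)"
    using cell_subset_cube[OF assms] by (simp add: Int_absorb2)
  then show "(LINT s|\<mu>. indicat_real (cell N i) s) = 1 / real N ^ CARD('n)"
    by (simp add: measure_cell[OF assms])
qed

section \<open>The particle system\<close>

text \<open>This turns each integral over a step profile into a mean over particles, with
  measurability included whatever the function does on cell boundaries.\<close>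

lemma integral_grid:
  fixes v :: "nat ^ 'n \<Rightarrow> 'b::euclidean_space"
  assumes N: "1 \<le> N" and eq: "\<And>s. s \<in> generic N \<Longrightarrow> \<phi> s = v (grid_index N s)"
  shows "\<phi> \<in> borel_measurable \<mu>"
    and "(LINT s|\<mu>. \<phi> s) = (1 / real N ^ CARD('n)) *\<^sub>R (\<Sum>i\<in>multi_indices N. v i)"
proof -
  let ?g = "\<lambda>s. \<Sum>i\<in>multi_indices N. indicat_real (cell N i) s *\<^sub>R v i"
  have g: "?g \<in> borel_measurable \<mu>"
    by (intro borel_imp_cube_measurable) measurable
  have ae: "AE s in \<mu>. ?g s = \<phi> s"
    using AE_generic[OF N] by eventually_elim (simp add: sum_cells_generic[OF N] eq)
  show m: "\<phi> \<in> borel_measurable \<mu>" using g ae by (rule borel_measurable_cube_AE)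
  have "(LINT s|\<mu>. \<phi> s) = (LINT s|\<mu>. ?g s)"
    using ae m g by (intro integral_cong_AE) auto
  also have "\<dots> = (\<Sum>i\<in>multi_indices N. LINT s|\<mu>. indicat_real (cell N i) s *\<^sub>R v i)"
    by (intro Bochner_Integration.integral_sum integrable_scaleR_left integrable_indicator_cell(1)[OF N])
  also have "\<dots> = (\<Sum>i\<in>multi_indices N. (1 / real N ^ CARD('n)) *\<^sub>R v i)"
  proof (intro sum.cong refl)
    fix i :: "nat ^ 'n" assume i: "i \<in> multi_indices N"
    have "(LINT s|\<mu>. indicat_real (cell N i) s *\<^sub>R v i) = (LINT s|\<mu>. indicat_real (cell N i) s) *\<^sub>R v i"
      by (rule integral_scaleR_left) (rule integrable_indicator_cell(1)[OF N i])
    then show "(LINT s|\<mu>. indicat_real (cell N i) s *\<^sub>R v i) = (1 / real N ^ CARD('n)) *\<^sub>R v i"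
      by (simp only: integrable_indicator_cell(2)[OF N i])
  qed
  also have "\<dots> = (1 / real N ^ CARD('n)) *\<^sub>R (\<Sum>i\<in>multi_indices N. v i)"
    by (simp only: scaleR_sum_right)
  finally show "(LINT s|\<mu>. \<phi> s) = (1 / real N ^ CARD('n)) *\<^sub>R (\<Sum>i\<in>multi_indices N. v i)" .
qed

lemma norm_cell_average_le:
  fixes f :: "real ^ 'n \<Rightarrow> 'b::euclidean_space" and i :: "nat ^ 'n"
  assumes N: "1 \<le> N" and i: "i \<in> multi_indices N" and f: "f \<in> borel_measurable \<mu>"
    and K: "AE s in \<mu>. norm (f s) \<le> K"
  shows "norm (cell_average N i f) \<le> K"
proof -
  note [measurable] = f cell_sets[OF N i]
  have int: "integrable \<mu> f" using K f by (rule cube.integrable_const_bound)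
  have int_K: "integrable \<mu> (\<lambda>s. indicat_real (cell N i) s * K)"
    and eq_K: "(LINT s|\<mu>. indicat_real (cell N i) s * K) = K / real N ^ CARD('n)"
    using integrable_indicator_cell[OF N i] by auto
  have "norm (LINT s|\<mu>. indicat_real (cell N i) s *\<^sub>R f s) \<le> (LINT s|\<mu>. norm (indicat_real (cell N i) s *\<^sub>R f s))"
    by (rule integral_norm_bound)
  also have "\<dots> \<le> (LINT s|\<mu>. indicat_real (cell N i) s * K)"
  proof (rule integral_mono_AE)
    show "integrable \<mu> (\<lambda>s. norm (indicat_real (cell N i) s *\<^sub>R f s))"
      using int by (intro integrable_norm integrable_mult_indicator) auto
    show "AE s in \<mu>. norm (indicat_real (cell N i) s *\<^sub>R f s) \<le> indicat_real (cell N i) s * K"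
      using K by eventually_elim (auto simp: indicator_def)
  qed (rule int_K)
  also have "\<dots> = K / real N ^ CARD('n)"
    by (rule eq_K)
  finally have "norm (LINT s|\<mu>. indicat_real (cell N i) s *\<^sub>R f s) \<le> K / real N ^ CARD('n)" .
  then have "norm (LINT s|\<mu>. indicat_real (cell N i) s *\<^sub>R f s) * real N ^ CARD('n) \<le> K"
    using N by (subst (asm) pos_le_divide_eq) auto
  then show ?thesis by (simp add: cell_average_eq[OF N i] mult.commute)
qed

lemma cell_average_ge:
  fixes f :: "real ^ 'n \<Rightarrow> real" and i :: "nat ^ 'n"
  assumes N: "1 \<le> N" and i: "i \<in> multi_indices N" and f: "integrable \<mu> f"
    and K: "AE s in \<mu>. K \<le> f s"
  shows "K \<le> cell_average N i f"
proof -
  note [measurable] = cell_sets[OF N i]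
  have int_K: "integrable \<mu> (\<lambda>s. indicat_real (cell N i) s * K)"
    and eq_K: "(LINT s|\<mu>. indicat_real (cell N i) s * K) = K / real N ^ CARD('n)"
    using integrable_indicator_cell[OF N i] by auto
  have "K / real N ^ CARD('n) = (LINT s|\<mu>. indicat_real (cell N i) s * K)"
    by (rule eq_K[symmetric])
  also have "\<dots> \<le> (LINT s|\<mu>. indicat_real (cell N i) s *\<^sub>R f s)"
  proof (rule integral_mono_AE)
    show "integrable \<mu> (\<lambda>s. indicat_real (cell N i) s *\<^sub>R f s)"
      using f by (intro integrable_mult_indicator) auto
    show "AE s in \<mu>. indicat_real (cell N i) s * K \<le> indicat_real (cell N i) s *\<^sub>R f s"
      using K by eventually_elim (auto simp: indicator_def)
  qed (rule int_K)
  finally have "K \<le> (LINT s|\<mu>. indicat_real (cell N i) s *\<^sub>R f s) * real N ^ CARD('n)"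
    using N by (subst (asm) pos_divide_le_eq) auto
  then show ?thesis by (simp add: cell_average_eq[OF N i] mult.commute)
qed

locale particles = interaction \<a> \<s> S L
  for \<a> \<s> :: "real ^ 'n \<Rightarrow> real ^ 'n" and S :: "real ^ 'n \<Rightarrow> ennreal" and L :: real +
  fixes N :: nat and \<sigma> :: "nat ^ 'n \<Rightarrow> nat"
  assumes N: "1 \<le> N" and sigma: "bij_betw \<sigma> (multi_indices N) {1..N ^ CARD('n)}"
begin

definition idx :: "nat set" where "idx = \<sigma> ` multi_indices N"

lemma idx_eq: "idx = {1..N ^ CARD('n)}"
  using sigma by (simp add: idx_def bij_betw_def)

lemma finite_idx[simp]: "finite idx"
  by (simp add: idx_eq)

definition velocity :: "(nat \<Rightarrow> real ^ 'n) \<Rightarrow> (nat \<Rightarrow> real) \<Rightarrow> nat \<Rightarrow> real ^ 'n" where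
  "velocity y n i = (1 / real N ^ CARD('n)) *\<^sub>R (\<Sum>j\<in>idx. n j *\<^sub>R \<a> (y j - y i))"

text \<open>The discrete form of \<open>force\<close>. Separating the factor \<open>n i\<close>
  shows that each weight solves an equation linear in itself, which is what preserves its
  sign.\<close>

definition rate :: "(nat \<Rightarrow> real ^ 'n) \<Rightarrow> (nat \<Rightarrow> real) \<Rightarrow> nat \<Rightarrow> real" where
  "rate y n i = (1 / real N ^ CARD('n)) * (\<Sum>j\<in>idx. n j * ((velocity y n i + velocity y n j) \<bullet> \<s> (y i - y j)))"

lemma idx_nonempty: "1 \<in> idx" "idx \<noteq> {}"
  using N by (auto simp: idx_eq Suc_le_eq)

lemma sigma_mem: "i \<in> multi_indices N \<Longrightarrow> \<sigma> i \<in> idx"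
  by (simp add: idx_def)

lemma inv_sigma: "i \<in> idx \<Longrightarrow> inv_into (multi_indices N) \<sigma> i \<in> multi_indices N"
    "i \<in> idx \<Longrightarrow> \<sigma> (inv_into (multi_indices N) \<sigma> i) = i"
  by (auto simp: idx_def intro: inv_into_into f_inv_into_f)

lemma sum_sigma: "(\<Sum>i\<in>multi_indices N. v (\<sigma> i)) = (\<Sum>j\<in>idx. v j)"
  using sum.reindex_bij_betw[OF sigma] by (simp add: idx_eq)

lemma step_generic_mem: "s \<in> generic N \<Longrightarrow> \<sigma> (grid_index N s) \<in> idx"
  using sigma_mem grid_index_mem[OF N] by blast

lemma step_bounded_profile:
  assumes "\<And>j. j \<in> idx \<Longrightarrow> norm (y j) \<le> R" "\<And>j. j \<in> idx \<Longrightarrow> \<bar>n j\<bar> \<le> B"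
  shows "bounded_profile R B (step_function N \<sigma> y) (step_function N \<sigma> n)"
  unfolding bounded_profile_def
proof (intro conjI)
  show "AE s in \<mu>. norm (step_function N \<sigma> y s) \<le> R"
    using AE_generic[OF N] by eventually_elim (use step_generic_mem assms in \<open>auto simp: step_function_generic[OF N]\<close>)
  show "AE s in \<mu>. \<bar>step_function N \<sigma> n s\<bar> \<le> B"
    using AE_generic[OF N] by eventually_elim (use step_generic_mem assms in \<open>auto simp: step_function_generic[OF N]\<close>)
qed (intro borel_imp_cube_measurable step_function_measurable)+

lemma drift_step: "drift (step_function N \<sigma> y) (step_function N \<sigma> n) (y i) = velocity y n i"
  unfolding drift_def velocity_def
  by (subst integral_grid(2)[OF N, where v = "\<lambda>k. n (\<sigma> k) *\<^sub>R \<a> (y (\<sigma> k) - y i)"])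
    (simp_all add: step_function_generic[OF N] sum_sigma[where v = "\<lambda>j. n j *\<^sub>R \<a> (y j - y i)"])

lemma s_step_measurable:
  "(\<lambda>s1. \<s> (v - step_function N \<sigma> y s1)) \<in> borel_measurable \<mu>"
  by (rule integral_grid(1)[OF N, where v = "\<lambda>k. \<s> (v - y (\<sigma> k))"]) (simp add: step_function_generic[OF N])

lemma force_step:
  assumes s: "s \<in> generic N" and i: "\<sigma> (grid_index N s) = i"
  shows "force (step_function N \<sigma> y) (step_function N \<sigma> n) s = rate y n i"
  unfolding force_def rate_def
  by (subst integral_grid(2)[OF N, where v = "\<lambda>k. n (\<sigma> k) * ((velocity y n i + velocity y n (\<sigma> k)) \<bullet> \<s> (y i - y (\<sigma> k)))"])
    (simp_all add: step_function_generic[OF N] s i drift_step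
      sum_sigma[where v = "\<lambda>j. n j * ((velocity y n i + velocity y n j) \<bullet> \<s> (y i - y j))"])

lemma Psi_step:
  assumes s: "s \<in> generic N"
  shows "Psi \<a> \<s> s (step_function N \<sigma> y) (step_function N \<sigma> n)
    = n (\<sigma> (grid_index N s)) * rate y n (\<sigma> (grid_index N s))"
proof -
  let ?y = "step_function N \<sigma> y" and ?n = "step_function N \<sigma> n"
  \<comment> \<open>Any finite bounds will do here, since the factorisation of \<open>Psi\<close>
    needs only that some bounds exist; they may depend on the particles.\<close>
  have P: "bounded_profile (Max ((\<lambda>j. norm (y j)) ` idx)) (Max ((\<lambda>j. \<bar>n j\<bar>) ` idx)) ?y ?n"
    by (rule step_bounded_profile) auto
  have "Psi \<a> \<s> s ?y ?n = ?n s * force ?y ?n s"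
  proof (rule Psi_eq_force[OF P _ s_step_measurable])
    show "norm (?y s) \<le> Max ((\<lambda>j. norm (y j)) ` idx)"
      using step_generic_mem[OF s] by (simp add: step_function_generic[OF N s])
  qed
  then show ?thesis by (simp add: step_function_generic[OF N s] force_step[OF s refl])
qed

text \<open>For step profiles \<open>Psi\<close> is constant on each cell up to a null set, so
  averaging it over the cell loses nothing. For this reason the step functions satisfy the limit
  equation without any consistency error.\<close>

lemma psi_eq_rate:
  assumes i: "i \<in> idx"
  shows "psi \<a> \<s> N \<sigma> i y n = n i * rate y n i"
  unfolding psi_def
proof (rule cell_average_AE_const[OF N inv_sigma(1)[OF i]])
  show "AE s in \<mu>. s \<in> cell N (inv_into (multi_indices N) \<sigma> i) \<longrightarrow>
      Psi \<a> \<s> s (step_function N \<sigma> y) (step_function N \<sigma> n) = n i * rate y n i"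
    using AE_generic[OF N]
  proof eventually_elim
    case (elim s)
    show ?case
      using Psi_step[OF elim] mem_cell_iff[OF N elim inv_sigma(1)[OF i]] inv_sigma(2)[OF i] by metis
  qed
qed

text \<open>The sum of two velocities is symmetric in the pair and \<open>\<s> (y i - y j)\<close>
  is antisymmetric, so the double sum equals its own negative.\<close>

lemma sum_rate_zero: "(\<Sum>i\<in>idx. n i * rate y n i) = 0"
proof -
  define G where "G i j = n i * n j * ((velocity y n i + velocity y n j) \<bullet> \<s> (y i - y j))" for i j
  have anti: "G j i = - G i j" for i j
    using odd[of "y i - y j"] by (simp add: G_def algebra_simps)
  have "(\<Sum>i\<in>idx. \<Sum>j\<in>idx. G i j) = (\<Sum>j\<in>idx. \<Sum>i\<in>idx. G i j)" by (rule sum.swap)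
  also have "\<dots> = - (\<Sum>j\<in>idx. \<Sum>i\<in>idx. G j i)" by (subst anti) (simp add: sum_negf)
  finally have "(\<Sum>i\<in>idx. \<Sum>j\<in>idx. G i j) = 0" by simp
  moreover have "(\<Sum>i\<in>idx. n i * rate y n i) = (1 / real N ^ CARD('n)) * (\<Sum>i\<in>idx. \<Sum>j\<in>idx. G i j)"
    by (simp add: rate_def G_def sum_distrib_left mult_ac)
  ultimately show ?thesis by simp
qed

text \<open>The weights enter only through a bound \<open>w\<close> for their mean modulus. For
  given \<open>N\<close> any bound on the weights serves as \<open>w\<close>; once the mass is
  known, \<open>w = 1\<close> makes both estimates independent of \<open>N\<close>.\<close>

lemma velocity_rate_bound:
  assumes y: "\<And>j. j \<in> idx \<Longrightarrow> norm (y j) \<le> R" and w: "(\<Sum>j\<in>idx. \<bar>n j\<bar>) \<le> w * real N ^ CARD('n)"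
    and k: "\<And>z. norm z \<le> 2 * R \<Longrightarrow> norm (\<s> z) \<le> k" and i: "i \<in> idx"
  shows "norm (velocity y n i) \<le> w * (2 * L * R)"
    and "\<bar>rate y n i\<bar> \<le> w * (w * (4 * L * R) * k)"
proof -
  have Nd: "0 < real N ^ CARD('n)" using N by simp
  have w0: "0 \<le> w"
  proof -
    have "0 \<le> w * real N ^ CARD('n)" using w by (rule order_trans[rotated]) (simp add: sum_nonneg)
    then show ?thesis using Nd by (simp add: zero_le_mult_iff)
  qed
  have R0: "0 \<le> R" using y[OF idx_nonempty(1)] norm_ge_zero order_trans by blast
  have k0: "0 \<le> k" using k[of 0] R0 norm_ge_zero order_trans by (metis mult_nonneg_nonneg norm_zero zero_le_numeral)
  have avg: "(1 / real N ^ CARD('n)) * (\<Sum>j\<in>idx. \<bar>n j\<bar> * K) \<le> w * K" if "0 \<le> K" for K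
  proof -
    have "(\<Sum>j\<in>idx. \<bar>n j\<bar> * K) = (\<Sum>j\<in>idx. \<bar>n j\<bar>) * K" by (simp add: sum_distrib_right)
    also have "\<dots> \<le> (w * real N ^ CARD('n)) * K" using w that by (rule mult_right_mono)
    finally show ?thesis using Nd by (simp add: field_simps)
  qed
  have velocity: "norm (velocity y n i) \<le> w * (2 * L * R)" if i: "i \<in> idx" for i
  proof -
    have "norm (\<Sum>j\<in>idx. n j *\<^sub>R \<a> (y j - y i)) \<le> (\<Sum>j\<in>idx. \<bar>n j\<bar> * (2 * L * R))"
    proof (rule sum_norm_le)
      fix j assume j: "j \<in> idx"
      have "norm (\<a> (y j - y i)) \<le> L * norm (y j - y i)" by (rule a_bound)
      also have "\<dots> \<le> L * (2 * R)"
        using norm_triangle_ineq4[of "y j" "y i"] y[OF i] y[OF j] L_nonneg by (intro mult_left_mono) auto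
      finally show "norm (n j *\<^sub>R \<a> (y j - y i)) \<le> \<bar>n j\<bar> * (2 * L * R)"
        by (simp add: mult_left_mono)
    qed
    then have "norm (velocity y n i) \<le> (1 / real N ^ CARD('n)) * (\<Sum>j\<in>idx. \<bar>n j\<bar> * (2 * L * R))"
      using Nd by (simp add: velocity_def divide_right_mono)
    also have "\<dots> \<le> w * (2 * L * R)" by (rule avg) (use L_nonneg R0 in simp)
    finally show ?thesis .
  qed
  show "norm (velocity y n i) \<le> w * (2 * L * R)" using velocity i .
  have "\<bar>\<Sum>j\<in>idx. n j * ((velocity y n i + velocity y n j) \<bullet> \<s> (y i - y j))\<bar> \<le> (\<Sum>j\<in>idx. \<bar>n j\<bar> * (w * (4 * L * R) * k))"
  proof (rule order_trans[OF sum_abs sum_mono])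
    fix j assume j: "j \<in> idx"
    have "norm (velocity y n i + velocity y n j) \<le> w * (4 * L * R)"
      using norm_triangle_ineq[of "velocity y n i" "velocity y n j"] velocity[OF i] velocity[OF j] by simp
    moreover have "norm (\<s> (y i - y j)) \<le> k"
      using norm_triangle_ineq4[of "y i" "y j"] y[OF i] y[OF j] by (intro k) auto
    ultimately have "norm (velocity y n i + velocity y n j) * norm (\<s> (y i - y j)) \<le> w * (4 * L * R) * k"
      using w0 L_nonneg R0 by (intro mult_mono) auto
    then have "\<bar>(velocity y n i + velocity y n j) \<bullet> \<s> (y i - y j)\<bar> \<le> w * (4 * L * R) * k"
      using Cauchy_Schwarz_ineq2 order_trans by blast
    then show "\<bar>n j * ((velocity y n i + velocity y n j) \<bullet> \<s> (y i - y j))\<bar> \<le> \<bar>n j\<bar> * (w * (4 * L * R) * k)"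
      by (simp add: abs_mult mult_left_mono)
  qed
  then have "\<bar>rate y n i\<bar> \<le> (1 / real N ^ CARD('n)) * (\<Sum>j\<in>idx. \<bar>n j\<bar> * (w * (4 * L * R) * k))"
    using Nd by (simp add: rate_def abs_mult divide_right_mono)
  also have "\<dots> \<le> w * (w * (4 * L * R) * k)" by (rule avg) (use L_nonneg R0 w0 k0 in simp)
  finally show "\<bar>rate y n i\<bar> \<le> w * (w * (4 * L * R) * k)" .
qed

end

text \<open>The maximum is 1-Lipschitz in the uniform norm, so a growth estimate common to all
  particles passes to the largest opinion.\<close>

lemma Max_diff_le:
  fixes f g :: "'a \<Rightarrow> real"
  assumes A: "finite A" "A \<noteq> {}" and d: "\<And>i. i \<in> A \<Longrightarrow> \<bar>f i - g i\<bar> \<le> d"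
  shows "\<bar>Max (f ` A) - Max (g ` A)\<bar> \<le> d"
proof -
  have le: "Max (f ` A) \<le> Max (g ` A) + d" if "\<And>i. i \<in> A \<Longrightarrow> \<bar>f i - g i\<bar> \<le> d" for f g :: "'a \<Rightarrow> real"
  proof (rule Max.boundedI)
    fix v assume "v \<in> f ` A"
    then obtain i where "i \<in> A" "v = f i" by auto
    moreover have "g i \<le> Max (g ` A)" using A \<open>i \<in> A\<close> by simp
    ultimately show "v \<le> Max (g ` A) + d" using that[of i] by simp
  qed (use A in auto)
  from le[of f g] le[of g f] d show ?thesis by (force simp: abs_minus_commute)
qed

section \<open>A priori bounds for the particle flow\<close>

locale particle_flow = particles \<a> \<s> S L N \<sigma>
  for \<a> \<s> :: "real ^ 'n \<Rightarrow> real ^ 'n" and S :: "real ^ 'n \<Rightarrow> ennreal" and L :: real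
    and N :: nat and \<sigma> :: "nat ^ 'n \<Rightarrow> nat" +
  fixes x0 :: "real ^ 'n \<Rightarrow> real ^ 'n" and m0 :: "real ^ 'n \<Rightarrow> real" and M X T :: real
    and y :: "real \<Rightarrow> nat \<Rightarrow> real ^ 'n" and n :: "real \<Rightarrow> nat \<Rightarrow> real"
  assumes T: "0 < T" and x0: "x0 \<in> borel_measurable \<mu>" "AE s in \<mu>. norm (x0 s) \<le> X"
    and m0: "integrable \<mu> m0" "AE s in \<mu>. 1 / M \<le> m0 s \<and> m0 s \<le> M" "(LINT s|\<mu>. m0 s) = 1"
    and M: "0 < M"
    and sol: "particle_solution \<a> \<s> x0 m0 T N \<sigma> y n"
begin

lemma y_deriv: "t \<in> {0..T} \<Longrightarrow> i \<in> idx \<Longrightarrow>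
    ((\<lambda>r. y r i) has_vector_derivative velocity (y t) (n t) i) (at t within {0..T})"
  and n_deriv: "t \<in> {0..T} \<Longrightarrow> i \<in> idx \<Longrightarrow>
    ((\<lambda>r. n r i) has_vector_derivative n t i * rate (y t) (n t) i) (at t within {0..T})"
  and y_init: "i \<in> idx \<Longrightarrow> y 0 i = cell_average N (inv_into (multi_indices N) \<sigma> i) x0"
  and n_init: "i \<in> idx \<Longrightarrow> n 0 i = cell_average N (inv_into (multi_indices N) \<sigma> i) m0"
proof -
  show "((\<lambda>r. n r i) has_vector_derivative n t i * rate (y t) (n t) i) (at t within {0..T})"
    if "t \<in> {0..T}" and i: "i \<in> idx"
    unfolding psi_eq_rate[OF i, symmetric]
    using sol that unfolding particle_solution_def Let_def idx_eq by auto
qed (use sol in \<open>auto simp: particle_solution_def Let_def velocity_def idx_eq\<close>)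

lemma y_continuous: "i \<in> idx \<Longrightarrow> continuous_on {0..T} (\<lambda>r. y r i)"
  and n_continuous: "i \<in> idx \<Longrightarrow> continuous_on {0..T} (\<lambda>r. n r i)"
  by (rule continuous_on_vector_derivative, erule y_deriv, assumption)
    (rule continuous_on_vector_derivative, erule n_deriv, assumption)

lemma n_init_bounds:
  assumes i: "i \<in> idx"
  shows "1 / M \<le> n 0 i" "n 0 i \<le> M"
proof -
  have *: "AE s in \<mu>. norm (m0 s) \<le> M"
    using m0(2)
  proof eventually_elim
    case (elim s) then show ?case using M by (smt (verit) divide_pos_pos real_norm_def)
  qed
  show "1 / M \<le> n 0 i"
    unfolding n_init[OF i] by (rule cell_average_ge[OF N inv_sigma(1)[OF i] m0(1)]) (use m0(2) in auto)
  show "n 0 i \<le> M"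
    using norm_cell_average_le[OF N inv_sigma(1)[OF i] _ *] m0(1) by (auto simp: n_init[OF i])
qed

lemma y_init_bound: "i \<in> idx \<Longrightarrow> norm (y 0 i) \<le> X"
  using norm_cell_average_le[OF N inv_sigma(1) x0] by (simp add: y_init)

text \<open>This bound depends on \<open>N\<close> and on the solution. It serves to start the
  argument: positivity needs a bounded rate before the uniform bounds, which rest on positivity, are
  available.\<close>

lemma crude_bound: "\<exists>K. \<forall>t\<in>{0..T}. \<forall>i\<in>idx. norm (y t i) \<le> K \<and> \<bar>n t i\<bar> \<le> K"
proof -
  have "\<exists>K. \<forall>t\<in>{0..T}. norm (y t i) \<le> K \<and> \<bar>n t i\<bar> \<le> K" if i: "i \<in> idx" for i
  proof -
    have "bounded ((\<lambda>r. y r i) ` {0..T})" "bounded ((\<lambda>r. n r i) ` {0..T})"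
      using y_continuous[OF i] n_continuous[OF i]
      by (auto intro!: compact_imp_bounded compact_continuous_image)
    then obtain K1 K2 where "\<forall>t\<in>{0..T}. norm (y t i) \<le> K1" "\<forall>t\<in>{0..T}. \<bar>n t i\<bar> \<le> K2"
      unfolding bounded_iff by auto
    then show ?thesis by (intro exI[of _ "max K1 K2"]) (auto simp: le_max_iff_disj)
  qed
  then obtain K where K: "\<And>i. i \<in> idx \<Longrightarrow> \<forall>t\<in>{0..T}. norm (y t i) \<le> K i \<and> \<bar>n t i\<bar> \<le> K i" by metis
  have "K i \<le> Max (K ` idx)" if "i \<in> idx" for i using that by simp
  then show ?thesis using K by (intro exI[of _ "Max (K ` idx)"]) (meson order_trans)
qed

text \<open>The derivative of \<open>n\<close> is \<open>n\<close> times the rate, so a bound on the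
  rate limits growth and decay alike.\<close>

lemma n_growth:
  assumes rate: "\<And>t. t \<in> {0..T} \<Longrightarrow> \<bar>rate (y t) (n t) i\<bar> \<le> C" and i: "i \<in> idx" and t: "t \<in> {0..T}"
  shows "\<bar>n t i\<bar> \<le> \<bar>n 0 i\<bar> * exp (C * t)" and "\<bar>n 0 i\<bar> \<le> \<bar>n t i\<bar> * exp (C * t)"
proof -
  have C: "0 \<le> C" using rate[OF t] by linarith
  have loc: "\<forall>\<^sub>F r in at t within {0..T}. \<bar>\<bar>n r i\<bar> - \<bar>n t i\<bar>\<bar> \<le> \<bar>r - t\<bar> * (C * \<bar>n t i\<bar> + \<epsilon>)"
    if t: "t \<in> {0..T}" and \<epsilon>: "0 < \<epsilon>" for t \<epsilon>
  proof -
    have "norm (n t i * rate (y t) (n t) i) \<le> C * \<bar>n t i\<bar>"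
      using mult_right_mono[OF rate[OF t], of "\<bar>n t i\<bar>"] by (simp add: abs_mult mult.commute)
    from local_growth_norm[OF has_vector_derivative_local[OF n_deriv[OF t i] \<epsilon>] this]
    show ?thesis by simp
  qed
  show "\<bar>n t i\<bar> \<le> \<bar>n 0 i\<bar> * exp (C * t)"
    by (rule gronwall_local[OF C _ loc t]) auto
  show "\<bar>n 0 i\<bar> \<le> \<bar>n t i\<bar> * exp (C * t)"
    by (rule gronwall_local_backward[OF C _ loc t]) auto
qed

text \<open>A weight that is not positive would have passed through zero at some earlier or equal
  time. By backward Gronwall it would then have vanished at time 0, where it is at least
  \<open>1 / M\<close>.\<close>

lemma n_pos:
  assumes i: "i \<in> idx" and t: "t \<in> {0..T}"
  shows "0 < n t i"
proof (rule ccontr)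
  assume "\<not> 0 < n t i"
  obtain K where K: "\<And>t i. t \<in> {0..T} \<Longrightarrow> i \<in> idx \<Longrightarrow> norm (y t i) \<le> K \<and> \<bar>n t i\<bar> \<le> K"
    using crude_bound by blast
  obtain k where k: "\<And>z. norm z \<le> 2 * K \<Longrightarrow> norm (\<s> z) \<le> k" using s_bounded[of "2 * K"] by blast
  have rate: "\<bar>rate (y t) (n t) i\<bar> \<le> K * (K * (4 * L * K) * k)" if t: "t \<in> {0..T}" for t
  proof (rule velocity_rate_bound(2)[OF _ _ k i])
    have "(\<Sum>j\<in>idx. \<bar>n t j\<bar>) \<le> (\<Sum>j\<in>idx. K)" by (intro sum_mono) (use K t in auto)
    then show "(\<Sum>j\<in>idx. \<bar>n t j\<bar>) \<le> K * real N ^ CARD('n)" by (simp add: idx_eq mult.commute)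
  qed (use K t in auto)
  have "\<exists>r. 0 \<le> r \<and> r \<le> t \<and> n r i = 0"
  proof (rule IVT2')
    show "n t i \<le> 0" using \<open>\<not> 0 < n t i\<close> by simp
    show "0 \<le> n 0 i" using n_init_bounds(1)[OF i] M by (smt (verit) divide_pos_pos)
    show "continuous_on {0..t} (\<lambda>r. n r i)"
      using n_continuous[OF i] t by (auto intro: continuous_on_subset)
  qed (use t in auto)
  then obtain r where "0 \<le> r" "r \<le> t" and nr: "n r i = 0" by blast
  then have r: "r \<in> {0..T}" using t by auto
  have "\<bar>n 0 i\<bar> \<le> \<bar>n r i\<bar> * exp (K * (K * (4 * L * K) * k) * r)" by (rule n_growth(2)[OF rate i r])
  then show False using nr n_init_bounds(1)[OF i] M by (auto simp: field_simps)
qed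

text \<open>The sum of weights has zero derivative and starts at \<open>N ^ d\<close> because
  \<open>m0\<close> has integral one. Stated with moduli, which positivity permits, since
  \<open>velocity_rate_bound\<close> takes this form.\<close>

lemma mass:
  assumes t: "t \<in> {0..T}"
  shows "(\<Sum>i\<in>idx. \<bar>n t i\<bar>) = real N ^ CARD('n)"
proof -
  have "((\<lambda>r. \<Sum>i\<in>idx. n r i) has_vector_derivative 0) (at t within {0..T})" if t: "t \<in> {0..T}" for t
    using has_vector_derivative_sum[of idx "\<lambda>i r. n r i" "\<lambda>i. n t i * rate (y t) (n t) i" "at t within {0..T}"] n_deriv[OF t]
    by (simp add: sum_rate_zero)
  then obtain c where c: "\<And>t. t \<in> {0..T} \<Longrightarrow> (\<Sum>i\<in>idx. n t i) = c"
    using has_vector_derivative_zero_constant[of "{0..T}" "\<lambda>r. \<Sum>i\<in>idx. n r i"] by auto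
  have "(\<Sum>i\<in>idx. n 0 i) = (\<Sum>j\<in>multi_indices N. n 0 (\<sigma> j))"
    by (rule sum_sigma[symmetric])
  also have "\<dots> = (\<Sum>j\<in>multi_indices N. cell_average N j m0)"
    using sigma by (intro sum.cong) (auto simp: n_init sigma_mem bij_betw_def)
  also have "\<dots> = real N ^ CARD('n)"
    using sum_cell_average[OF N m0(1)] m0(3) by simp
  finally have "(\<Sum>i\<in>idx. n t i) = real N ^ CARD('n)" using c[OF t] c[of 0] T by auto
  moreover have "(\<Sum>i\<in>idx. \<bar>n t i\<bar>) = (\<Sum>i\<in>idx. n t i)"
    using n_pos[OF _ t] by (intro sum.cong) (auto simp: less_imp_le)
  ultimately show ?thesis by simp
qed

text \<open>Mean weight one bounds all speeds by \<open>2 * L\<close> times the largest opinion, so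
  the largest opinion obeys a closed Gronwall inequality in which neither \<open>N\<close> nor the
  size of single weights occurs.\<close>

lemma y_bound:
  assumes t: "t \<in> {0..T}" and i: "i \<in> idx"
  shows "norm (y t i) \<le> X * exp (2 * L * T)"
proof -
  define e where "e t = Max ((\<lambda>i. norm (y t i)) ` idx)" for t
  have e_ge: "norm (y t i) \<le> e t" if "i \<in> idx" for t i using that by (simp add: e_def)
  have e0: "0 \<le> e t" for t using e_ge[OF idx_nonempty(1), of t] norm_ge_zero order_trans by blast
  have "e t \<le> e 0 * exp (2 * L * t)"
  proof (rule gronwall_local[OF _ _ _ t])
    fix t \<epsilon> :: real assume t: "t \<in> {0..T}" and \<epsilon>: "0 < \<epsilon>"
    have "norm (velocity (y t) (n t) i) \<le> 2 * L * e t" if "i \<in> idx" for i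
    proof -
      obtain k where k: "\<And>z. norm z \<le> 2 * e t \<Longrightarrow> norm (\<s> z) \<le> k" using s_bounded[of "2 * e t"] by blast
      have "norm (velocity (y t) (n t) i) \<le> 1 * (2 * L * e t)"
        by (rule velocity_rate_bound(1)[OF e_ge _ k that]) (auto simp: mass[OF t])
      then show ?thesis by simp
    qed
    then have "\<forall>\<^sub>F r in at t within {0..T}. \<bar>norm (y r i) - norm (y t i)\<bar> \<le> \<bar>r - t\<bar> * (2 * L * e t + \<epsilon>)" if "i \<in> idx" for i
      using local_growth_norm[OF has_vector_derivative_local[OF y_deriv[OF t that] \<epsilon>]] that by blast
    then have "\<forall>\<^sub>F r in at t within {0..T}. \<forall>i\<in>idx. \<bar>norm (y r i) - norm (y t i)\<bar> \<le> \<bar>r - t\<bar> * (2 * L * e t + \<epsilon>)"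
      by (simp add: eventually_ball_finite_distrib)
    then show "\<forall>\<^sub>F r in at t within {0..T}. \<bar>e r - e t\<bar> \<le> \<bar>r - t\<bar> * (2 * L * e t + \<epsilon>)"
      unfolding e_def by eventually_elim (rule Max_diff_le, use idx_nonempty in auto)
  qed (use L_nonneg e0 in auto)
  also have "\<dots> \<le> X * exp (2 * L * T)"
  proof (intro mult_mono)
    show "e 0 \<le> X" unfolding e_def using idx_nonempty y_init_bound by (intro Max.boundedI) auto
    then show "0 \<le> X" using e0[of 0] by simp
  qed (use L_nonneg t in \<open>auto intro!: mult_left_mono\<close>)
  finally show ?thesis using e_ge[OF i, of t] by simp
qed

text \<open>With mean weight one and opinions in a fixed ball, the rate is bounded independently of
  \<open>N\<close>, and each weight grows at most exponentially from an initial value of at most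
  \<open>M\<close>.\<close>

lemma n_bound:
  assumes k: "\<And>z. norm z \<le> 2 * (X * exp (2 * L * T)) \<Longrightarrow> norm (\<s> z) \<le> k"
    and t: "t \<in> {0..T}" and i: "i \<in> idx"
  shows "\<bar>n t i\<bar> \<le> M * exp (4 * L * (X * exp (2 * L * T)) * k * T)"
proof -
  let ?C = "4 * L * (X * exp (2 * L * T)) * k"
  have rate: "\<bar>rate (y t) (n t) i\<bar> \<le> ?C" if t: "t \<in> {0..T}" for t
  proof -
    have "\<bar>rate (y t) (n t) i\<bar> \<le> 1 * (1 * (4 * L * (X * exp (2 * L * T))) * k)"
      by (rule velocity_rate_bound(2)[OF y_bound[OF t] _ k i]) (auto simp: mass[OF t])
    then show ?thesis by simp
  qed
  have C: "0 \<le> ?C" using rate[OF t] by linarith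
  have "\<bar>n t i\<bar> \<le> \<bar>n 0 i\<bar> * exp (?C * t)" by (rule n_growth(1)[OF rate i t])
  also have "\<dots> \<le> M * exp (?C * T)"
  proof (intro mult_mono)
    show "\<bar>n 0 i\<bar> \<le> M" using n_init_bounds[OF i] M by (smt (verit) divide_pos_pos)
    show "exp (?C * t) \<le> exp (?C * T)" using C t by (simp only: exp_le_cancel_iff) (rule mult_left_mono; simp)
  qed (use M in auto)
  finally show ?thesis .
qed

text \<open>Finitely many particles share one neighbourhood of \<open>t\<close>, so the expansion
  holds there uniformly in all generic \<open>s\<close>.\<close>

lemma step_local:
  assumes t: "t \<in> {0..T}" and \<epsilon>: "0 < \<epsilon>"
  shows "\<forall>\<^sub>F r in at t within {0..T}. \<forall>s\<in>(generic N :: (real ^ 'n) set).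
      norm (step_function N \<sigma> (y r) s - step_function N \<sigma> (y t) s
        - (r - t) *\<^sub>R drift (step_function N \<sigma> (y t)) (step_function N \<sigma> (n t)) (step_function N \<sigma> (y t) s)) \<le> \<epsilon> * \<bar>r - t\<bar>
    \<and> \<bar>step_function N \<sigma> (n r) s - step_function N \<sigma> (n t) s
        - (r - t) * Psi \<a> \<s> s (step_function N \<sigma> (y t)) (step_function N \<sigma> (n t))\<bar> \<le> \<epsilon> * \<bar>r - t\<bar>"
proof -
  have "\<forall>\<^sub>F r in at t within {0..T}. \<forall>i\<in>idx.
      norm (y r i - y t i - (r - t) *\<^sub>R velocity (y t) (n t) i) \<le> \<epsilon> * \<bar>r - t\<bar> \<and>
      norm (n r i - n t i - (r - t) *\<^sub>R (n t i * rate (y t) (n t) i)) \<le> \<epsilon> * \<bar>r - t\<bar>"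
    using has_vector_derivative_local[OF y_deriv[OF t] \<epsilon>] has_vector_derivative_local[OF n_deriv[OF t] \<epsilon>]
    by (simp add: eventually_ball_finite_distrib eventually_conj_iff)
  then show ?thesis
  proof eventually_elim
    case (elim r)
    show ?case
    proof
      fix s :: "real ^ 'n" assume s: "s \<in> generic N"
      let ?i = "\<sigma> (grid_index N s)"
      have "?i \<in> idx" using step_generic_mem[OF s] .
      with elim show "norm (step_function N \<sigma> (y r) s - step_function N \<sigma> (y t) s
        - (r - t) *\<^sub>R drift (step_function N \<sigma> (y t)) (step_function N \<sigma> (n t)) (step_function N \<sigma> (y t) s)) \<le> \<epsilon> * \<bar>r - t\<bar>
    \<and> \<bar>step_function N \<sigma> (n r) s - step_function N \<sigma> (n t) s
        - (r - t) * Psi \<a> \<s> s (step_function N \<sigma> (y t)) (step_function N \<sigma> (n t))\<bar> \<le> \<epsilon> * \<bar>r - t\<bar>"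
        by (simp add: step_function_generic[OF N s] drift_step Psi_step[OF s])
    qed
  qed
qed

end

section \<open>Convergence of cell averages\<close>

lemma cell_average_diff:
  fixes f g :: "real ^ 'n \<Rightarrow> 'b::euclidean_space" and i :: "nat ^ 'n"
  assumes N: "1 \<le> N" and i: "i \<in> multi_indices N" and f: "integrable \<mu> f" and g: "integrable \<mu> g"
  shows "cell_average N i (\<lambda>s. f s - g s) = cell_average N i f - cell_average N i g"
proof -
  note int = integrable_mult_indicator[OF cell_sets[OF N i]]
  show ?thesis
    using int[OF f] int[OF g] by (simp add: cell_average_eq[OF N i] scaleR_diff_right)
qed

lemma norm_cell_average_le_average:
  fixes f :: "real ^ 'n \<Rightarrow> 'b::euclidean_space" and i :: "nat ^ 'n"
  assumes N: "1 \<le> N" and i: "i \<in> multi_indices N"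
  shows "norm (cell_average N i f) \<le> cell_average N i (\<lambda>s. norm (f s))"
proof -
  have "norm (LINT s|\<mu>. indicat_real (cell N i) s *\<^sub>R f s) \<le> (LINT s|\<mu>. norm (indicat_real (cell N i) s *\<^sub>R f s))"
    by (rule integral_norm_bound)
  also have "\<dots> = (LINT s|\<mu>. indicat_real (cell N i) s *\<^sub>R norm (f s))" by simp
  finally show ?thesis
    by (simp add: cell_average_eq[OF N i] mult_left_mono)
qed

text \<open>Off the cell boundaries this is the conditional expectation of \<open>f\<close> given
  the partition into cells.\<close>

definition grid_average :: "nat \<Rightarrow> (real ^ 'n \<Rightarrow> 'b::euclidean_space) \<Rightarrow> real ^ 'n \<Rightarrow> 'b" where
  "grid_average N f s = (\<Sum>i\<in>multi_indices N. indicat_real (cell N i) s *\<^sub>R cell_average N i f)"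

lemma grid_average_generic:
  "1 \<le> N \<Longrightarrow> s \<in> generic N \<Longrightarrow> grid_average N f s = cell_average N (grid_index N s) f"
  unfolding grid_average_def by (rule sum_cells_generic)

lemma grid_average_measurable: "grid_average N f \<in> borel_measurable \<mu>"
  unfolding grid_average_def[abs_def] by (rule borel_imp_cube_measurable) measurable

text \<open>The triangle inequality in each cell, summed: averaging is a contraction in the
  \<open>L1\<close> norm, so its convergence need only be checked on a dense class.\<close>

lemma grid_average_L1_le:
  fixes f :: "real ^ 'n \<Rightarrow> 'b::euclidean_space"
  assumes N: "1 \<le> N" and f: "integrable \<mu> f"
  shows "(LINT s|\<mu>. norm (grid_average N f s)) \<le> (LINT s|\<mu>. norm (f s))"
proof -
  have Nd: "0 < real N ^ CARD('n)" using N by simp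
  have "(LINT s|\<mu>. norm (grid_average N f s))
    = (1 / real N ^ CARD('n)) *\<^sub>R (\<Sum>i\<in>multi_indices N. norm (cell_average N i f))"
    by (rule integral_grid(2)[OF N]) (simp add: grid_average_generic[OF N])
  also have "\<dots> \<le> (1 / real N ^ CARD('n)) *\<^sub>R (\<Sum>i\<in>multi_indices N. cell_average N i (\<lambda>s. norm (f s)))"
    by (intro scaleR_left_mono sum_mono norm_cell_average_le_average[OF N]) auto
  also have "\<dots> = (LINT s|\<mu>. norm (f s))"
    using sum_cell_average[OF N integrable_norm[OF f]] Nd by simp
  finally show ?thesis .
qed

lemma norm_diff_cell_le:
  fixes s u :: "real ^ 'n"
  assumes N: "1 \<le> N" and "s \<in> cell N i" "u \<in> cell N i"
  shows "norm (s - u) \<le> real CARD('n) / real N"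
proof -
  have "norm (s - u) \<le> (\<Sum>k\<in>UNIV. \<bar>(s - u) $ k\<bar>)" by (rule norm_le_l1_cart)
  also have "\<dots> \<le> (\<Sum>k\<in>(UNIV :: 'n set). 1 / real N)"
  proof (rule sum_mono)
    fix k
    have "(real (i $ k) - 1) / real N \<le> s $ k" "s $ k \<le> real (i $ k) / real N"
      "(real (i $ k) - 1) / real N \<le> u $ k" "u $ k \<le> real (i $ k) / real N"
      using assms by (auto simp: cell_def mem_box_cart)
    then show "\<bar>(s - u) $ k\<bar> \<le> 1 / real N" by (simp add: diff_divide_distrib abs_le_iff)
  qed
  finally show ?thesis by simp
qed

text \<open>The cells have diameter at most \<open>d / N\<close>, so by uniform continuity the
  average over a cell is eventually within \<epsilon> of every value in that cell.\<close>

lemma grid_average_uniform: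
  fixes g :: "real ^ 'n \<Rightarrow> 'b::euclidean_space"
  assumes g: "continuous_on cube g" and \<epsilon>: "0 < \<epsilon>"
  shows "\<forall>\<^sub>F N in sequentially. \<forall>s\<in>generic N. norm (grid_average N g s - g s) \<le> \<epsilon>"
proof -
  have "uniformly_continuous_on cube g"
    using g by (intro compact_uniformly_continuous) (auto simp: cube_def)
  then obtain d where d: "d > 0" "\<And>s u. s \<in> cube \<Longrightarrow> u \<in> cube \<Longrightarrow> dist u s < d \<Longrightarrow> dist (g u) (g s) < \<epsilon>"
    unfolding uniformly_continuous_on_def using \<epsilon> by blast
  have gm: "g \<in> borel_measurable \<mu>"
    using g by (rule continuous_imp_measurable_on_sets_lebesgue) simp
  have "bounded (g ` cube)"
    using g by (intro compact_imp_bounded compact_continuous_image) (auto simp: cube_def)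
  then obtain K where K: "\<And>s. s \<in> cube \<Longrightarrow> norm (g s) \<le> K" unfolding bounded_iff by auto
  have gi: "integrable \<mu> g"
    by (rule cube.integrable_const_bound[OF _ gm, where B = K], rule AE_I2) (use K in auto)
  have "(\<lambda>N. real CARD('n) / real N) \<longlonglongrightarrow> 0" by (rule lim_const_over_n)
  then have "\<forall>\<^sub>F N in sequentially. real CARD('n) / real N < d" using d(1) by (rule order_tendstoD)
  then show ?thesis using eventually_ge_at_top[of 1]
  proof eventually_elim
    case (elim N)
    show ?case
    proof
      fix s :: "real ^ 'n" assume s: "s \<in> generic N"
      let ?i = "grid_index N s"
      have i: "?i \<in> multi_indices N" by (rule grid_index_mem[OF elim(2) s])
      have sc: "s \<in> cell N ?i" "s \<in> cube" using mem_cell_iff[OF elim(2) s i] s by (auto simp: generic_def)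
      have c: "cell_average N ?i (\<lambda>u. g s) = g s"
        by (rule cell_average_AE_const[OF elim(2) i]) simp
      have "grid_average N g s - g s = cell_average N ?i (\<lambda>u. g u - g s)"
        using cell_average_diff[OF elim(2) i gi, of "\<lambda>u. g s"] c
        by (simp add: grid_average_generic[OF elim(2) s])
      \<comment> \<open>The indicator changes nothing inside the average, but makes the integrand
        small on the whole cube, where \<open>norm_cell_average_le\<close> asks for its
        bound.\<close>
      also have "\<dots> = cell_average N ?i (\<lambda>u. indicat_real (cell N ?i) u *\<^sub>R (g u - g s))"
        unfolding cell_average_eq[OF elim(2) i]
        by (rule arg_cong[where f = "\<lambda>h. real N ^ CARD('n) *\<^sub>R integral\<^sup>L \<mu> h"]) (auto simp: indicator_def)
      also have "norm \<dots> \<le> \<epsilon>"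
      proof (rule norm_cell_average_le[OF elim(2) i])
        note [measurable] = gm cell_sets[OF elim(2) i]
        show "(\<lambda>u. indicat_real (cell N ?i) u *\<^sub>R (g u - g s)) \<in> borel_measurable \<mu>" by measurable
        have "norm (indicat_real (cell N ?i) u *\<^sub>R (g u - g s)) \<le> \<epsilon>" if "u \<in> cube" for u
        proof (cases "u \<in> cell N ?i")
          case True
          have "dist u s < d"
            using norm_diff_cell_le[OF elim(2) True sc(1)] elim(1) by (simp add: dist_norm)
          from d(2)[OF sc(2) that this] show ?thesis using True by (simp add: dist_norm)
        qed (use \<epsilon> in simp)
        then show "AE u in \<mu>. norm (indicat_real (cell N ?i) u *\<^sub>R (g u - g s)) \<le> \<epsilon>"
          by (intro AE_I2) auto
      qed
      finally show "norm (grid_average N g s - g s) \<le> \<epsilon>" .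
    qed
  qed
qed

text \<open>A measurable function is the limit of continuous ones off a negligible set. Projecting
  these onto a ball that contains almost all values of \<open>f\<close> keeps continuity and the
  limit, and provides the bound for dominated convergence.\<close>

lemma continuous_L1_dense:
  fixes f :: "real ^ 'n \<Rightarrow> 'b::euclidean_space"
  assumes f: "f \<in> borel_measurable \<mu>" "AE s in \<mu>. norm (f s) \<le> K" and \<epsilon>: "0 < \<epsilon>"
  obtains g where "continuous_on cube g" "integrable \<mu> g" "(LINT s|\<mu>. norm (g s - f s)) < \<epsilon>"
proof -
  have "f measurable_on cube" using f(1) by (simp add: measurable_on_iff_borel_measurable)
  then obtain Z h where Z: "negligible Z" and h: "\<And>k. continuous_on UNIV (h k)"
    and lim: "\<And>s. s \<notin> Z \<Longrightarrow> (\<lambda>k. h k s) \<longlonglongrightarrow> (if s \<in> cube then f s else 0)"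
    unfolding measurable_on_def by blast
  \<comment> \<open>The maximum with 0 keeps the ball nonempty, as the projection requires.\<close>
  define K' where "K' = max K 0"
  let ?C = "cball (0 :: 'b) K'"
  have C: "convex ?C" "closed ?C" "?C \<noteq> {}" by (auto simp: K'_def)
  define g where "g k s = closest_point ?C (h k s)" for k s
  have cp: "continuous_on UNIV (closest_point ?C)" by (rule continuous_on_closest_point[OF C])
  have gc: "continuous_on cube (g k)" for k
    unfolding g_def
    by (rule continuous_on_compose2[OF cp continuous_on_subset[OF h]]) auto
  have gm: "g k \<in> borel_measurable \<mu>" for k
    using gc by (rule continuous_imp_measurable_on_sets_lebesgue) simp
  have gb: "norm (g k s) \<le> K'" for k s
    using closest_point_in_set[OF C(2,3), of "h k s"] by (simp add: g_def)
  have gi: "integrable \<mu> (g k)" for k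
    by (rule cube.integrable_const_bound[OF _ gm]) (use gb in auto)
  have Zae: "AE s in \<mu>. s \<notin> Z"
    unfolding AE_cube_measure using AE_not_in[of Z lebesgue] Z by (auto simp: negligible_iff_null_sets)
  have "(\<lambda>k. LINT s|\<mu>. norm (g k s - f s)) \<longlonglongrightarrow> (LINT s::real^'n|\<mu>. 0 :: real)"
  proof (rule integral_dominated_convergence[where w = "\<lambda>_. 2 * K'"])
    show "(\<lambda>s. norm (g k s - f s)) \<in> borel_measurable \<mu>" for k using gm f(1) by measurable
    show "AE s in \<mu>. (\<lambda>k. norm (g k s - f s)) \<longlonglongrightarrow> 0"
      using Zae f(2) AE_space
    proof eventually_elim
      case (elim s)
      have "isCont (closest_point ?C) (f s)" using cp by (simp add: continuous_on_eq_continuous_at)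
      moreover have "(\<lambda>k. h k s) \<longlonglongrightarrow> f s" using lim[OF elim(1)] elim(3) by simp
      ultimately have "(\<lambda>k. g k s) \<longlonglongrightarrow> closest_point ?C (f s)"
        unfolding g_def by (rule isCont_tendsto_compose)
      moreover have "closest_point ?C (f s) = f s"
        using elim(2) by (intro closest_point_self) (auto simp: K'_def)
      ultimately show ?case by (simp add: LIM_zero tendsto_norm_zero)
    qed
    show "AE s in \<mu>. norm (norm (g k s - f s)) \<le> 2 * K'" for k
      using f(2)
    proof eventually_elim
      case (elim s)
      then show ?case using norm_triangle_ineq4[of "g k s" "f s"] gb[of k s] by (simp add: K'_def)
    qed
  qed auto
  then have "\<forall>\<^sub>F k in sequentially. (LINT s|\<mu>. norm (g k s - f s)) < \<epsilon>"
    using \<epsilon> by (intro order_tendstoD(2)[where y = 0]) auto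
  then obtain k where "(LINT s|\<mu>. norm (g k s - f s)) < \<epsilon>" by (auto simp: eventually_sequentially)
  then show ?thesis using gc gi that by blast
qed

lemma grid_average_tendsto_L1:
  fixes f :: "real ^ 'n \<Rightarrow> 'b::euclidean_space"
  assumes f: "f \<in> borel_measurable \<mu>" "AE s in \<mu>. norm (f s) \<le> K"
  shows "(\<lambda>N. LINT s|\<mu>. norm (grid_average N f s - f s)) \<longlonglongrightarrow> 0"
proof (rule LIMSEQ_I)
  fix r :: real assume r: "0 < r"
  \<comment> \<open>A quarter for each of three errors: averaging \<open>g - f\<close>, averaging
    the continuous \<open>g\<close>, and \<open>g - f\<close> itself.\<close>
  obtain g where g: "continuous_on cube g" "integrable \<mu> g" "(LINT s|\<mu>. norm (g s - f s)) < r / 4"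
    using continuous_L1_dense[OF f, of "r / 4"] r by auto
  have r4: "0 < r / 4" using r by simp
  have fi: "integrable \<mu> f" using f(2,1) by (rule cube.integrable_const_bound)
  have "\<forall>\<^sub>F N in sequentially. norm ((LINT s|\<mu>. norm (grid_average N f s - f s)) - 0) < r"
    using grid_average_uniform[OF g(1) r4] eventually_ge_at_top[of 1]
  proof eventually_elim
    case (elim N)
    have N: "1 \<le> N" by (rule elim)
    have gf: "integrable \<mu> (\<lambda>s. g s - f s)" using g(2) fi by simp
    have avg_int: "integrable \<mu> (grid_average N h)" if "integrable \<mu> h" for h :: "real ^ 'n \<Rightarrow> 'b"
    proof -
      have "integrable \<mu> (\<lambda>s. indicat_real (cell N i) s *\<^sub>R cell_average N i h)" if "i \<in> multi_indices N" for i :: "nat ^ 'n"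
        by (rule integrable_scaleR_left[OF integrable_indicator_cell(1)[OF N that]])
      then show ?thesis unfolding grid_average_def[abs_def] by (intro Bochner_Integration.integrable_sum) auto
    qed
    have "(LINT s|\<mu>. norm (grid_average N f s - f s))
      \<le> (LINT s|\<mu>. norm (grid_average N (\<lambda>s. g s - f s) s) + (r / 4 + norm (g s - f s)))"
    proof (rule integral_mono_AE)
      show "integrable \<mu> (\<lambda>s. norm (grid_average N f s - f s))"
        using avg_int[OF fi] fi by simp
      show "integrable \<mu> (\<lambda>s. norm (grid_average N (\<lambda>s. g s - f s) s) + (r / 4 + norm (g s - f s)))"
        using avg_int[OF gf] gf by simp
      show "AE s in \<mu>. norm (grid_average N f s - f s)
        \<le> norm (grid_average N (\<lambda>s. g s - f s) s) + (r / 4 + norm (g s - f s))"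
        using AE_generic[OF N]
      proof eventually_elim
        case s: (elim s)
        have "grid_average N (\<lambda>s. g s - f s) s = grid_average N g s - grid_average N f s"
          by (simp add: grid_average_generic[OF N s] cell_average_diff[OF N grid_index_mem[OF N s] g(2) fi])
        then have "grid_average N f s - f s
          = - grid_average N (\<lambda>s. g s - f s) s + ((grid_average N g s - g s) + (g s - f s))" by simp
        then have "norm (grid_average N f s - f s)
          \<le> norm (- grid_average N (\<lambda>s. g s - f s) s) + (norm (grid_average N g s - g s) + norm (g s - f s))"
          by (smt (verit) norm_triangle_ineq)
        moreover have "norm (grid_average N g s - g s) \<le> r / 4" using elim(1) s by blast
        ultimately show ?case by simp
      qed
    qed
    also have "\<dots> = (LINT s|\<mu>. norm (grid_average N (\<lambda>s. g s - f s) s)) + (r / 4 + (LINT s|\<mu>. norm (g s - f s)))"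
      using avg_int[OF gf] gf by simp
    also have "\<dots> < r" using grid_average_L1_le[OF N gf] g(3) r by simp
    finally show ?case by simp
  qed
  then show "\<exists>no. \<forall>N\<ge>no. norm ((LINT s|\<mu>. norm (grid_average N f s - f s)) - 0) < r"
    by (simp add: eventually_sequentially)
qed

section \<open>L1 stability of the evolution\<close>

context interaction begin

text \<open>A first-order expansion with error uniform in \<open>s\<close>, whose null set may
  depend on both times and on \<epsilon>. It holds for curves differentiable in the essential
  supremum norm and for step functions, and still suffices to estimate increments of
  \<open>L1\<close> distances.\<close>

definition evolves :: "real \<Rightarrow> (real \<Rightarrow> real ^ 'n \<Rightarrow> real ^ 'n) \<Rightarrow> (real \<Rightarrow> real ^ 'n \<Rightarrow> real) \<Rightarrow> bool" where
  "evolves T f m \<longleftrightarrow> (\<forall>t\<in>{0..T}. \<forall>\<epsilon>>0. \<forall>\<^sub>F r in at t within {0..T}. AE s in \<mu>.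
     norm (f r s - f t s - (r - t) *\<^sub>R drift (f t) (m t) (f t s)) \<le> \<epsilon> * \<bar>r - t\<bar> \<and>
     \<bar>m r s - m t s - (r - t) * Psi \<a> \<s> s (f t) (m t)\<bar> \<le> \<epsilon> * \<bar>r - t\<bar>)"

lemma norm_diff_increment_le:
  fixes gr gt fr ft v w :: "'a::real_normed_vector"
  assumes "norm (gr - gt - h *\<^sub>R v) \<le> \<epsilon> * \<bar>h\<bar>" "norm (fr - ft - h *\<^sub>R w) \<le> \<epsilon> * \<bar>h\<bar>"
  shows "\<bar>norm (gr - fr) - norm (gt - ft)\<bar> \<le> \<bar>h\<bar> * (norm (v - w) + 2 * \<epsilon>)"
proof -
  have "\<bar>norm (gr - fr) - norm (gt - ft)\<bar> \<le> norm ((gr - fr) - (gt - ft))" by (rule norm_triangle_ineq3)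
  also have "(gr - fr) - (gt - ft) = (gr - gt - h *\<^sub>R v) - (fr - ft - h *\<^sub>R w) + h *\<^sub>R (v - w)"
    by (simp add: algebra_simps)
  also have "norm \<dots> \<le> norm (gr - gt - h *\<^sub>R v) + norm (fr - ft - h *\<^sub>R w) + norm (h *\<^sub>R (v - w))"
    using norm_triangle_ineq[of "(gr - gt - h *\<^sub>R v) - (fr - ft - h *\<^sub>R w)" "h *\<^sub>R (v - w)"]
      norm_triangle_ineq4[of "gr - gt - h *\<^sub>R v" "fr - ft - h *\<^sub>R w"] by linarith
  also have "\<dots> \<le> \<epsilon> * \<bar>h\<bar> + \<epsilon> * \<bar>h\<bar> + \<bar>h\<bar> * norm (v - w)" using assms by simp
  finally show ?thesis by (simp add: algebra_simps)
qed

text \<open>The majorant is extended-valued, matching the one from \<open>Psi_stability\<close>;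
  only its integral has to be finite.\<close>

lemma abs_integral_diff_le:
  fixes u v :: "real ^ 'n \<Rightarrow> real"
  assumes "integrable \<mu> u" "integrable \<mu> v"
    and le: "AE s in \<mu>. ennreal \<bar>u s - v s\<bar> \<le> ennreal h * b s" and b: "b \<in> borel_measurable \<mu>"
    and int: "(\<integral>\<^sup>+s. b s \<partial>\<mu>) \<le> ennreal k" and hk: "0 \<le> h" "0 \<le> k"
  shows "\<bar>(LINT s|\<mu>. u s) - (LINT s|\<mu>. v s)\<bar> \<le> h * k"
proof -
  have "ennreal \<bar>(LINT s|\<mu>. u s) - (LINT s|\<mu>. v s)\<bar> = ennreal (norm (LINT s|\<mu>. u s - v s))"
    using assms by simp
  also have "\<dots> \<le> (\<integral>\<^sup>+s. ennreal (norm (u s - v s)) \<partial>\<mu>)"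
    using assms by (intro integral_norm_bound_ennreal) auto
  also have "\<dots> \<le> (\<integral>\<^sup>+s. ennreal h * b s \<partial>\<mu>)"
    using le by (intro nn_integral_mono_AE) auto
  also have "\<dots> = ennreal h * (\<integral>\<^sup>+s. b s \<partial>\<mu>)" using b by (rule nn_integral_cmult)
  also have "\<dots> \<le> ennreal h * ennreal k" using int by (rule mult_left_mono) simp
  also have "\<dots> = ennreal (h * k)" using hk by (simp add: ennreal_mult)
  finally show ?thesis using hk by (simp add: ennreal_le_iff)
qed

text \<open>The sum of both distances satisfies the local growth condition:
  \<open>drift_diff\<close> controls opinions and \<open>Psi_stability\<close> controls weights,
  each by the two distances at the same time. \<open>C\<close> precedes the solutions, hence is
  common to all \<open>N\<close>.\<close>

lemma L1_stability:
  fixes R B c T :: real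
  assumes c: "0 < c" and T: "0 < T"
  shows "\<exists>C\<ge>0. \<forall>f m g n.
      evolves T f m \<longrightarrow> evolves T g n \<longrightarrow>
      (\<forall>t\<in>{0..T}. bounded_profile R B (f t) (m t) \<and> bounded_profile R B (g t) (n t) \<and>
         (\<forall>s\<in>cube. norm (f t s) \<le> R) \<and>
         (\<forall>s\<in>cube. \<forall>s1\<in>cube. c * norm (s - s1) \<le> norm (f t s - f t s1)) \<and>
         (AE s in \<mu>. (\<lambda>s1. \<s> (g t s - g t s1)) \<in> borel_measurable \<mu>)) \<longrightarrow>
      (\<forall>t\<in>{0..T}. (LINT s|\<mu>. norm (g t s - f t s)) + (LINT s|\<mu>. \<bar>n t s - m t s\<bar>)
         \<le> ((LINT s|\<mu>. norm (g 0 s - f 0 s)) + (LINT s|\<mu>. \<bar>n 0 s - m 0 s\<bar>)) * exp (C * T))"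
proof -
  obtain C1 where C1: "C1 \<ge> 0" and stab: "\<And>f m g n. bounded_profile R B f m \<Longrightarrow> bounded_profile R B g n \<Longrightarrow>
      (\<forall>s\<in>cube. norm (f s) \<le> R) \<Longrightarrow>
      (\<forall>s\<in>cube. \<forall>s1\<in>cube. c * norm (s - s1) \<le> norm (f s - f s1)) \<Longrightarrow>
      (AE s in \<mu>. (\<lambda>s1. \<s> (g s - g s1)) \<in> borel_measurable \<mu>) \<Longrightarrow>
      (\<exists>b\<in>borel_measurable \<mu>. (AE s in \<mu>. ennreal \<bar>Psi \<a> \<s> s g n - Psi \<a> \<s> s f m\<bar> \<le> b s) \<and>
         (\<integral>\<^sup>+s. b s \<partial>\<mu>) \<le> ennreal (C1 * ((LINT s|\<mu>. norm (g s - f s)) + (LINT s|\<mu>. \<bar>n s - m s\<bar>))))"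
    using Psi_stability[OF c, of R B] by blast
  \<comment> \<open>The first two terms arise from integrating \<open>drift_diff\<close> over the
    cube, where the distance of the opinions counts twice; \<open>C1\<close> accounts for the
    weights.\<close>
  define C where "C = 2 * L * \<bar>R\<bar> + 2 * \<bar>B\<bar> * L + C1"
  have C0: "0 \<le> C" using C1 L_nonneg by (simp add: C_def)
  show ?thesis
  proof (intro exI[of _ C] conjI allI impI ballI, fact)
    fix f g :: "real \<Rightarrow> real ^ 'n \<Rightarrow> real ^ 'n" and m n :: "real \<Rightarrow> real ^ 'n \<Rightarrow> real" and t
    assume evf: "evolves T f m" and evg: "evolves T g n"
      and H: "\<forall>t\<in>{0..T}. bounded_profile R B (f t) (m t) \<and> bounded_profile R B (g t) (n t) \<and>
         (\<forall>s\<in>cube. norm (f t s) \<le> R) \<and>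
         (\<forall>s\<in>cube. \<forall>s1\<in>cube. c * norm (s - s1) \<le> norm (f t s - f t s1)) \<and>
         (AE s in \<mu>. (\<lambda>s1. \<s> (g t s - g t s1)) \<in> borel_measurable \<mu>)"
      and t: "t \<in> {0..T}"
    define D E where "D t = (LINT s|\<mu>. norm (g t s - f t s))" and "E t = (LINT s|\<mu>. \<bar>n t s - m t s\<bar>)" for t
    have DE0: "0 \<le> D t" "0 \<le> E t" for t by (auto simp: D_def E_def)
    have "D t + E t \<le> (D 0 + E 0) * exp (C * t)"
    proof (rule gronwall_local[OF C0 _ _ t])
      fix t assume t: "t \<in> {0..T}"
      fix \<epsilon> :: real assume \<epsilon>: "0 < \<epsilon>"
      have P: "bounded_profile R B (f t) (m t)" and Q: "bounded_profile R B (g t) (n t)" using H t by auto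
      have [measurable]: "f t \<in> borel_measurable \<mu>" "g t \<in> borel_measurable \<mu>" "m t \<in> borel_measurable \<mu>" "n t \<in> borel_measurable \<mu>"
        using P Q by (auto simp: bounded_profile_def)
      note nn = bounded_profile_nonneg[OF P]
      note int_t = bounded_profile_diff_integrable[OF P Q]
      obtain b where [measurable]: "b \<in> borel_measurable \<mu>"
        and b: "AE s in \<mu>. ennreal \<bar>Psi \<a> \<s> s (g t) (n t) - Psi \<a> \<s> s (f t) (m t)\<bar> \<le> b s"
        and bint: "(\<integral>\<^sup>+s. b s \<partial>\<mu>) \<le> ennreal (C1 * (D t + E t))"
        using stab[OF P Q] H t unfolding D_def E_def by blast
      \<comment> \<open>Each of the two distances collects an expansion error from each of the two
        solutions, four in all.\<close>
      have \<epsilon>4: "0 < \<epsilon> / 4" using \<epsilon> by simp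
      let ?b1 = "\<lambda>s. 2 * L * R * E t + B * L * (D t + norm (g t s - f t s)) + 2 * (\<epsilon> / 4)"
      have b1: "0 \<le> ?b1 s" for s using nn L_nonneg DE0 \<epsilon> by simp
      have b1_int: "(\<integral>\<^sup>+s. ennreal (?b1 s) \<partial>\<mu>) = ennreal (2 * L * R * E t + 2 * B * L * D t + \<epsilon> / 2)"
      proof -
        have "(\<integral>\<^sup>+s. ennreal (?b1 s) \<partial>\<mu>) = ennreal (LINT s|\<mu>. ?b1 s)"
          using int_t b1 by (intro nn_integral_eq_integral) auto
        also have "(LINT s|\<mu>. ?b1 s) = 2 * L * R * E t + 2 * B * L * D t + \<epsilon> / 2"
          using int_t by (simp add: D_def[symmetric] algebra_simps)
        finally show ?thesis .
      qed
      let ?b2 = "\<lambda>s. b s + ennreal (2 * (\<epsilon> / 4))"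
      have b2_int: "(\<integral>\<^sup>+s. ?b2 s \<partial>\<mu>) \<le> ennreal (C1 * (D t + E t) + \<epsilon> / 2)"
      proof -
        have "(\<integral>\<^sup>+s. ?b2 s \<partial>\<mu>) = (\<integral>\<^sup>+s. b s \<partial>\<mu>) + ennreal (\<epsilon> / 2)"
          by (simp add: nn_integral_add emeasure_cube)
        also have "\<dots> \<le> ennreal (C1 * (D t + E t)) + ennreal (\<epsilon> / 2)" using bint by (rule add_right_mono)
        also have "\<dots> = ennreal (C1 * (D t + E t) + \<epsilon> / 2)"
          using C1 DE0 \<epsilon> by (simp add: ennreal_plus)
        finally show ?thesis .
      qed
      have inT: "\<forall>\<^sub>F r in at t within {0..T}. r \<in> {0..T}"
        by (simp add: eventually_at_filter)
      have "\<forall>\<^sub>F r in at t within {0..T}. AE s in \<mu>.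
         norm (f r s - f t s - (r - t) *\<^sub>R drift (f t) (m t) (f t s)) \<le> \<epsilon> / 4 * \<bar>r - t\<bar> \<and>
         \<bar>m r s - m t s - (r - t) * Psi \<a> \<s> s (f t) (m t)\<bar> \<le> \<epsilon> / 4 * \<bar>r - t\<bar>"
        using evf t \<epsilon>4 unfolding evolves_def by blast
      moreover have "\<forall>\<^sub>F r in at t within {0..T}. AE s in \<mu>.
         norm (g r s - g t s - (r - t) *\<^sub>R drift (g t) (n t) (g t s)) \<le> \<epsilon> / 4 * \<bar>r - t\<bar> \<and>
         \<bar>n r s - n t s - (r - t) * Psi \<a> \<s> s (g t) (n t)\<bar> \<le> \<epsilon> / 4 * \<bar>r - t\<bar>"
        using evg t \<epsilon>4 unfolding evolves_def by blast
      ultimately show "\<forall>\<^sub>F r in at t within {0..T}. \<bar>D r + E r - (D t + E t)\<bar> \<le> \<bar>r - t\<bar> * (C * (D t + E t) + \<epsilon>)"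
        using inT
      proof eventually_elim
        case (elim r)
        have int_r: "integrable \<mu> (\<lambda>s. \<bar>n r s - m r s\<bar>)" "integrable \<mu> (\<lambda>s. norm (g r s - f r s))"
          using bounded_profile_diff_integrable[of R B "f r" "m r" "g r" "n r"] H elim(3) by auto
        have "\<bar>(LINT s|\<mu>. norm (g r s - f r s)) - (LINT s|\<mu>. norm (g t s - f t s))\<bar>
          \<le> \<bar>r - t\<bar> * (2 * L * R * E t + 2 * B * L * D t + \<epsilon> / 2)"
        proof (rule abs_integral_diff_le[OF int_r(2) int_t(2) _ _ eq_refl[OF b1_int]])
          have "AE s in \<mu>. norm (f t s) \<le> R" "AE s in \<mu>. norm (g t s) \<le> R"
            using P Q by (auto simp: bounded_profile_def)
          with elim(1,2) show "AE s in \<mu>. ennreal \<bar>norm (g r s - f r s) - norm (g t s - f t s)\<bar>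
            \<le> ennreal \<bar>r - t\<bar> * ennreal (?b1 s)"
          proof eventually_elim
            case s: (elim s)
            have "\<bar>norm (g r s - f r s) - norm (g t s - f t s)\<bar>
              \<le> \<bar>r - t\<bar> * (norm (drift (g t) (n t) (g t s) - drift (f t) (m t) (f t s)) + 2 * (\<epsilon> / 4))"
              using s by (intro norm_diff_increment_le) auto
            also have "\<dots> \<le> \<bar>r - t\<bar> * ?b1 s"
              using drift_diff[OF P Q s(4,3)] by (intro mult_left_mono) (auto simp: D_def E_def)
            finally show ?case using b1 by (simp add: ennreal_leI flip: ennreal_mult)
          qed
        qed (use nn L_nonneg DE0 \<epsilon> in auto)
        then have D: "\<bar>D r - D t\<bar> \<le> \<bar>r - t\<bar> * (2 * L * R * E t + 2 * B * L * D t + \<epsilon> / 2)"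
          by (simp only: D_def)
        have "\<bar>(LINT s|\<mu>. \<bar>n r s - m r s\<bar>) - (LINT s|\<mu>. \<bar>n t s - m t s\<bar>)\<bar>
          \<le> \<bar>r - t\<bar> * (C1 * (D t + E t) + \<epsilon> / 2)"
        proof (rule abs_integral_diff_le[OF int_r(1) int_t(1) _ _ b2_int])
          from elim(1,2) b show "AE s in \<mu>. ennreal \<bar>\<bar>n r s - m r s\<bar> - \<bar>n t s - m t s\<bar>\<bar>
            \<le> ennreal \<bar>r - t\<bar> * ?b2 s"
          proof eventually_elim
            case s: (elim s)
            let ?p = "\<bar>Psi \<a> \<s> s (g t) (n t) - Psi \<a> \<s> s (f t) (m t)\<bar>"
            have "\<bar>norm (n r s - m r s) - norm (n t s - m t s)\<bar> \<le> \<bar>r - t\<bar> *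
              (norm (Psi \<a> \<s> s (g t) (n t) - Psi \<a> \<s> s (f t) (m t)) + 2 * (\<epsilon> / 4))"
              using s by (intro norm_diff_increment_le) auto
            then have "ennreal \<bar>\<bar>n r s - m r s\<bar> - \<bar>n t s - m t s\<bar>\<bar> \<le> ennreal (\<bar>r - t\<bar> * (?p + 2 * (\<epsilon> / 4)))"
              by (simp add: ennreal_leI)
            also have "\<dots> = ennreal \<bar>r - t\<bar> * (ennreal ?p + ennreal (2 * (\<epsilon> / 4)))"
              using \<epsilon> by (simp add: ennreal_mult ennreal_plus)
            also have "\<dots> \<le> ennreal \<bar>r - t\<bar> * ?b2 s"
              using s by (intro mult_left_mono add_right_mono) auto
            finally show ?case .
          qed
        qed (use C1 DE0 \<epsilon> in auto)
        then have E: "\<bar>E r - E t\<bar> \<le> \<bar>r - t\<bar> * (C1 * (D t + E t) + \<epsilon> / 2)"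
          by (simp only: E_def)
        from D E have "\<bar>D r + E r - (D t + E t)\<bar>
          \<le> \<bar>r - t\<bar> * (2 * L * R * E t + 2 * B * L * D t + \<epsilon> / 2) + \<bar>r - t\<bar> * (C1 * (D t + E t) + \<epsilon> / 2)"
          by linarith
        also have "\<dots> = \<bar>r - t\<bar> * (2 * L * R * E t + 2 * B * L * D t + C1 * (D t + E t) + \<epsilon>)"
          by (simp add: algebra_simps)
        also have "\<dots> \<le> \<bar>r - t\<bar> * (C * (D t + E t) + \<epsilon>)"
        proof (rule mult_left_mono)
          have "0 \<le> 2 * L * R * D t" "0 \<le> 2 * B * L * E t" using nn L_nonneg DE0 by auto
          then show "2 * L * R * E t + 2 * B * L * D t + C1 * (D t + E t) + \<epsilon> \<le> C * (D t + E t) + \<epsilon>"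
            using nn by (simp add: C_def algebra_simps)
        qed simp
        finally show ?case .
      qed
    qed (use DE0 in simp)
    also have "\<dots> \<le> (D 0 + E 0) * exp (C * T)"
      using DE0[of 0] C0 t by (intro mult_left_mono) (auto intro: mult_left_mono)
    finally show "(LINT s|\<mu>. norm (g t s - f t s)) + (LINT s|\<mu>. \<bar>n t s - m t s\<bar>)
         \<le> ((LINT s|\<mu>. norm (g 0 s - f 0 s)) + (LINT s|\<mu>. \<bar>n 0 s - m 0 s\<bar>)) * exp (C * T)"
      by (simp add: D_def E_def)
  qed
qed

end

section \<open>The limit solution\<close>

lemma difference_quotient_bound:
  fixes v w :: "'a::real_normed_vector" and h :: real
  assumes "h \<noteq> 0" "norm ((1 / h) *\<^sub>R w - v) \<le> \<epsilon>"
  shows "norm (w - h *\<^sub>R v) \<le> \<epsilon> * \<bar>h\<bar>"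
proof -
  have "w - h *\<^sub>R v = h *\<^sub>R ((1 / h) *\<^sub>R w - v)" using assms(1) by (simp add: algebra_simps)
  also have "norm \<dots> = \<bar>h\<bar> * norm ((1 / h) *\<^sub>R w - v)" by simp
  also have "\<dots> \<le> \<bar>h\<bar> * \<epsilon>" using assms(2) by (rule mult_left_mono) simp
  finally show ?thesis by (simp add: mult.commute)
qed

lemma sup_norm_less:
  assumes "sup_norm f < ennreal c" "s \<in> cube"
  shows "norm (f s) \<le> c"
proof -
  have "ennreal (norm (f s)) \<le> sup_norm f" unfolding sup_norm_def using assms(2) by (rule SUP_upper)
  then have "ennreal (norm (f s)) < ennreal c" using assms(1) by (rule order.strict_trans1)
  then show ?thesis by (simp add: ennreal_less_iff)
qed

lemma Linf_norm_less:
  assumes "Linf_norm f < ennreal c"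
  shows "AE s in \<mu>. norm (f s) \<le> c"
proof -
  have "AE s in \<mu>. ennreal (norm (f s)) \<le> Linf_norm f" unfolding Linf_norm_def by (rule esssup_AE)
  then show ?thesis
  proof eventually_elim
    case (elim s)
    then have "ennreal (norm (f s)) < ennreal c" using assms by (rule order.strict_trans1)
    then show ?case by (simp add: ennreal_less_iff)
  qed
qed

lemma C1_sup_norm_local:
  assumes u: "C1_with_derivative C_space sup_norm T u u'" and t: "t \<in> {0..T}" and \<epsilon>: "0 < \<epsilon>"
  shows "\<forall>\<^sub>F r in at t within {0..T}. \<forall>s\<in>cube. norm (u r s - u t s - (r - t) *\<^sub>R u' t s) \<le> \<epsilon> * \<bar>r - t\<bar>"
proof -
  have "((\<lambda>r. sup_norm (\<lambda>s. (1 / (r - t)) *\<^sub>R (u r s - u t s) - u' t s)) \<longlongrightarrow> 0) (at t within {0..T})"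
    using u t unfolding C1_with_derivative_def by blast
  then have "\<forall>\<^sub>F r in at t within {0..T}. sup_norm (\<lambda>s. (1 / (r - t)) *\<^sub>R (u r s - u t s) - u' t s) < ennreal \<epsilon>"
    by (rule order_tendstoD) (use \<epsilon> in simp)
  moreover have "\<forall>\<^sub>F r in at t within {0..T}. r \<noteq> t" by (simp add: eventually_at_filter)
  ultimately show ?thesis
  proof eventually_elim
    case (elim r)
    show ?case
      using sup_norm_less[OF elim(1)] elim(2) by (intro ballI difference_quotient_bound) auto
  qed
qed

lemma C1_Linf_norm_local:
  assumes u: "C1_with_derivative Linf_space Linf_norm T u u'" and t: "t \<in> {0..T}" and \<epsilon>: "0 < \<epsilon>"
  shows "\<forall>\<^sub>F r in at t within {0..T}. AE s in \<mu>. norm (u r s - u t s - (r - t) *\<^sub>R u' t s) \<le> \<epsilon> * \<bar>r - t\<bar>"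
proof -
  have "((\<lambda>r. Linf_norm (\<lambda>s. (1 / (r - t)) *\<^sub>R (u r s - u t s) - u' t s)) \<longlongrightarrow> 0) (at t within {0..T})"
    using u t unfolding C1_with_derivative_def by blast
  then have "\<forall>\<^sub>F r in at t within {0..T}. Linf_norm (\<lambda>s. (1 / (r - t)) *\<^sub>R (u r s - u t s) - u' t s) < ennreal \<epsilon>"
    by (rule order_tendstoD) (use \<epsilon> in simp)
  moreover have "\<forall>\<^sub>F r in at t within {0..T}. r \<noteq> t" by (simp add: eventually_at_filter)
  ultimately show ?thesis
  proof eventually_elim
    case (elim r)
    from Linf_norm_less[OF elim(1)] show ?case
      by eventually_elim (use elim(2) in \<open>intro difference_quotient_bound; simp\<close>)
  qed
qed

lemma norm_le_from_increment:
  fixes a b v :: "'a::real_normed_vector"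
  assumes "norm (b - a - h *\<^sub>R v) \<le> 1 * \<bar>h\<bar>" "norm a \<le> K" "norm v \<le> K'" "\<bar>h\<bar> \<le> 1"
  shows "norm b \<le> K + K' + 1"
proof -
  have "norm b \<le> norm a + norm (h *\<^sub>R v) + norm (b - a - h *\<^sub>R v)"
    using norm_triangle_ineq[of "a + h *\<^sub>R v" "b - a - h *\<^sub>R v"] norm_triangle_ineq[of a "h *\<^sub>R v"] by simp
  moreover have "\<bar>h\<bar> * norm v \<le> 1 * K'" using assms by (intro mult_mono) auto
  ultimately show ?thesis using assms by simp
qed

lemma eventually_near: "\<forall>\<^sub>F r in at t within A. \<bar>r - t\<bar> \<le> (1::real)"
  unfolding eventually_at by (intro exI[of _ 1]) (auto simp: dist_real_def)

text \<open>Near each time the expansion with error constant 1 and step at most 1 gives the bound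
  \<open>K + K' + 1\<close>; compactness in time makes it uniform.\<close>

lemma C1_sup_norm_bounded:
  fixes u u' :: "real \<Rightarrow> real ^ 'n \<Rightarrow> 'b::real_normed_vector"
  assumes u: "C1_with_derivative C_space sup_norm T u u'"
  shows "\<exists>K\<ge>0. \<forall>t\<in>{0..T}. \<forall>s\<in>cube. norm (u t s) \<le> K"
proof (rule locally_bounded_imp_bounded)
  fix t assume t: "t \<in> {0..T}"
  have "continuous_on cube (u t)" "continuous_on cube (u' t)"
    using u t unfolding C1_with_derivative_def C_space_def by auto
  then have "bounded (u t ` cube)" "bounded (u' t ` cube)"
    by (auto intro!: compact_imp_bounded compact_continuous_image simp: cube_def)
  then obtain K K' where K: "\<And>s. s \<in> cube \<Longrightarrow> norm (u t s) \<le> K" "\<And>s. s \<in> cube \<Longrightarrow> norm (u' t s) \<le> K'"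
    unfolding bounded_iff by auto
  \<comment> \<open>A point of the cube shows that \<open>K'\<close> is nonnegative, so the enlarged
    bound also covers the time \<open>t\<close> itself.\<close>
  have "(0 :: real ^ 'n) \<in> cube" by (simp add: mem_cube)
  then have "0 \<le> K'" by (rule order_trans[OF norm_ge_zero K(2)])
  have "\<forall>\<^sub>F r in at t within {0..T}. \<forall>s\<in>cube. norm (u r s) \<le> K + K' + 1"
    using C1_sup_norm_local[OF u t zero_less_one] eventually_near
  proof eventually_elim
    case (elim r)
    show ?case
    proof
      fix s :: "real ^ 'n" assume s: "s \<in> cube"
      show "norm (u r s) \<le> K + K' + 1"
        by (rule norm_le_from_increment[OF bspec[OF elim(1) s] K(1)[OF s] K(2)[OF s] elim(2)])
    qed
  qed
  then show "\<exists>B. (\<forall>s\<in>cube. norm (u t s) \<le> B) \<and> (\<forall>\<^sub>F r in at t within {0..T}. \<forall>s\<in>cube. norm (u r s) \<le> B)"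
    using K(1) \<open>0 \<le> K'\<close> by (intro exI[of _ "K + K' + 1"]) force
qed (meson order_trans)

lemma Linf_space_bounded:
  assumes "f \<in> Linf_space"
  obtains K where "0 \<le> K" "AE s in \<mu>. norm (f s) \<le> K"
proof -
  have "Linf_norm f < \<infinity>" using assms by (simp add: Linf_space_def)
  then obtain c where "Linf_norm f = ennreal c" "0 \<le> c" by (cases "Linf_norm f") auto
  then have "Linf_norm f < ennreal (c + 1)" by (simp add: ennreal_less_iff)
  from Linf_norm_less[OF this] \<open>0 \<le> c\<close> that[of "c + 1"] show ?thesis by simp
qed

text \<open>The same argument as for the supremum norm, with a null set that may change from one
  time to the next.\<close>

lemma C1_Linf_norm_bounded:
  assumes u: "C1_with_derivative Linf_space Linf_norm T u u'"
  shows "\<exists>K\<ge>0. \<forall>t\<in>{0..T}. AE s in \<mu>. norm (u t s) \<le> K"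
proof (rule locally_bounded_imp_bounded)
  show "AE s in \<mu>. norm (u t s) \<le> B'" if "AE s in \<mu>. norm (u t s) \<le> B" "B \<le> B'" for t B B'
    using that(1) by eventually_elim (use that(2) in simp)
  fix t assume t: "t \<in> {0..T}"
  have "u t \<in> Linf_space" "u' t \<in> Linf_space"
    using u t unfolding C1_with_derivative_def by auto
  then obtain K K' where K: "AE s in \<mu>. norm (u t s) \<le> K" "AE s in \<mu>. norm (u' t s) \<le> K'" "0 \<le> K'"
    by (metis Linf_space_bounded)
  have "\<forall>\<^sub>F r in at t within {0..T}. AE s in \<mu>. norm (u r s) \<le> K + K' + 1"
    using C1_Linf_norm_local[OF u t zero_less_one] eventually_near
  proof eventually_elim
    case (elim r)
    from elim(1) K(1,2) show ?case
      by eventually_elim (rule norm_le_from_increment[OF _ _ _ elim(2)])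
  qed
  moreover have "AE s in \<mu>. norm (u t s) \<le> K + K' + 1"
    using K(1) by eventually_elim (use K(3) in simp)
  ultimately show "\<exists>B. (AE s in \<mu>. norm (u t s) \<le> B) \<and> (\<forall>\<^sub>F r in at t within {0..T}. AE s in \<mu>. norm (u r s) \<le> B)"
    by blast
qed

section \<open>Bounds and separation of trajectories for the limit solution\<close>

context interaction begin

lemma limit_solution_properties:
  assumes sol: "graph_limit_solution \<a> \<s> x0 m0 T x m" and T: "0 < T" and L0: "0 < L0"
    and low: "\<And>s1 s2. s1 \<in> cube \<Longrightarrow> s2 \<in> cube \<Longrightarrow> 1 / L0 * norm (s1 - s2) \<le> norm (x0 s1 - x0 s2)"
  obtains R B c where "0 < c" "evolves T x m"
    "\<And>t. t \<in> {0..T} \<Longrightarrow> bounded_profile R B (x t) (m t)"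
    "\<And>t s. t \<in> {0..T} \<Longrightarrow> s \<in> cube \<Longrightarrow> norm (x t s) \<le> R"
    "\<And>t s1 s2. t \<in> {0..T} \<Longrightarrow> s1 \<in> cube \<Longrightarrow> s2 \<in> cube \<Longrightarrow> c * norm (s1 - s2) \<le> norm (x t s1 - x t s2)"
proof -
  obtain x' m' where x: "C1_with_derivative C_space sup_norm T x x'"
    and m: "C1_with_derivative Linf_space Linf_norm T m m'"
    and x': "\<And>t s. t \<in> {0..T} \<Longrightarrow> s \<in> cube \<Longrightarrow>
       x' t s = (LINT s1:cube|lebesgue. m t s1 *\<^sub>R \<a> (x t s1 - x t s))"
    and m': "\<And>t. t \<in> {0..T} \<Longrightarrow> AE s in \<mu>. m' t s = Psi \<a> \<s> s (x t) (m t)"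
    and init: "\<And>s. s \<in> cube \<Longrightarrow> x 0 s = x0 s"
    using sol unfolding graph_limit_solution_def by blast
  have x'_drift: "x' t s = drift (x t) (m t) (x t s)" if "t \<in> {0..T}" "s \<in> cube" for t s
    unfolding x'[OF that] drift_def set_lebesgue_integral_def by (rule integral_restrict_space[symmetric]) simp
  obtain R where R: "0 \<le> R" "\<And>t s. t \<in> {0..T} \<Longrightarrow> s \<in> cube \<Longrightarrow> norm (x t s) \<le> R"
    using C1_sup_norm_bounded[OF x] by blast
  obtain B where B: "0 \<le> B" "\<And>t. t \<in> {0..T} \<Longrightarrow> AE s in \<mu>. norm (m t s) \<le> B"
    using C1_Linf_norm_bounded[OF m] by blast
  have P: "bounded_profile R B (x t) (m t)" if t: "t \<in> {0..T}" for t
    unfolding bounded_profile_def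
  proof (intro conjI)
    have "continuous_on cube (x t)" using x t unfolding C1_with_derivative_def C_space_def by auto
    then show "x t \<in> borel_measurable \<mu>" by (rule continuous_imp_measurable_on_sets_lebesgue) simp
    show "m t \<in> borel_measurable \<mu>" using m t unfolding C1_with_derivative_def Linf_space_def by auto
    show "AE s in \<mu>. norm (x t s) \<le> R" using R(2)[OF t] by (intro AE_I2) auto
    show "AE s in \<mu>. \<bar>m t s\<bar> \<le> B" using B(2)[OF t] by simp
  qed
  have ev: "evolves T x m"
    unfolding evolves_def
  proof (intro ballI allI impI)
    fix t \<epsilon> :: real assume t: "t \<in> {0..T}" and \<epsilon>: "0 < \<epsilon>"
    show "\<forall>\<^sub>F r in at t within {0..T}. AE s in \<mu>.
       norm (x r s - x t s - (r - t) *\<^sub>R drift (x t) (m t) (x t s)) \<le> \<epsilon> * \<bar>r - t\<bar> \<and>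
       \<bar>m r s - m t s - (r - t) * Psi \<a> \<s> s (x t) (m t)\<bar> \<le> \<epsilon> * \<bar>r - t\<bar>"
      using C1_sup_norm_local[OF x t \<epsilon>] C1_Linf_norm_local[OF m t \<epsilon>]
    proof eventually_elim
      case (elim r)
      from elim(2) m'[OF t] AE_space show ?case
        by eventually_elim (use elim(1) x'_drift[OF t] in auto)
    qed
  qed
  \<comment> \<open>Lipschitz constant of the velocity field common to two trajectories, from
    \<open>drift_diff\<close> with equal profiles. Backward Gronwall then costs a factor
    \<open>exp (- K * T)\<close> in their initial separation.\<close>
  define K where "K = B * L"
  have K0: "0 \<le> K" using B(1) L_nonneg by (simp add: K_def)
  have lower: "exp (- K * T) / L0 * norm (s1 - s2) \<le> norm (x t s1 - x t s2)"
    if t: "t \<in> {0..T}" and s: "s1 \<in> cube" "s2 \<in> cube" for t s1 s2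
  proof -
    have "norm (x 0 s1 - x 0 s2) \<le> norm (x t s1 - x t s2) * exp (K * t)"
    proof (rule gronwall_local_backward[OF K0 _ _ t])
      fix t \<epsilon> :: real assume t: "t \<in> {0..T}" and \<epsilon>: "0 < \<epsilon>"
      have "\<forall>\<^sub>F r in at t within {0..T}.
        norm ((x r s1 - x r s2) - (x t s1 - x t s2) - (r - t) *\<^sub>R (x' t s1 - x' t s2)) \<le> \<epsilon> * \<bar>r - t\<bar>"
        using C1_sup_norm_local[OF x t half_gt_zero[OF \<epsilon>]]
      proof eventually_elim
        case (elim r)
        have "(x r s1 - x r s2) - (x t s1 - x t s2) - (r - t) *\<^sub>R (x' t s1 - x' t s2)
          = (x r s1 - x t s1 - (r - t) *\<^sub>R x' t s1) - (x r s2 - x t s2 - (r - t) *\<^sub>R x' t s2)"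
          by (simp add: algebra_simps)
        also have "norm \<dots> \<le> \<epsilon> / 2 * \<bar>r - t\<bar> + \<epsilon> / 2 * \<bar>r - t\<bar>"
          by (rule order_trans[OF norm_triangle_ineq4 add_mono]) (use elim s in blast)+
        finally show ?case by simp
      qed
      moreover have "norm (x' t s1 - x' t s2) \<le> K * norm (x t s1 - x t s2)"
        using drift_diff[OF P[OF t] P[OF t] R(2)[OF t s(1)] R(2)[OF t s(2)]] x'_drift[OF t] s
        by (simp add: K_def)
      ultimately show "\<forall>\<^sub>F r in at t within {0..T}. \<bar>norm (x r s1 - x r s2) - norm (x t s1 - x t s2)\<bar>
        \<le> \<bar>r - t\<bar> * (K * norm (x t s1 - x t s2) + \<epsilon>)"
        by (rule local_growth_norm)
    qed simp
    also have "\<dots> \<le> norm (x t s1 - x t s2) * exp (K * T)"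
      using K0 t by (intro mult_left_mono) (auto intro: mult_left_mono)
    finally have "1 / L0 * norm (s1 - s2) \<le> norm (x t s1 - x t s2) * exp (K * T)"
      using low[OF s] init s by simp
    from mult_right_mono[OF this, of "exp (- K * T)"]
    have "1 / L0 * norm (s1 - s2) * exp (- K * T) \<le> norm (x t s1 - x t s2) * (exp (K * T) * exp (- K * T))"
      by (simp add: mult.assoc)
    then show ?thesis by (simp add: mult_ac flip: exp_add)
  qed
  show ?thesis
    by (rule that[of "exp (- K * T) / L0"]) (use L0 ev P R lower in auto)
qed

end

section \<open>Step functions as solutions, and the convergence\<close>

context particle_flow begin

lemma evolves_step:
  "evolves T (\<lambda>t. step_function N \<sigma> (y t)) (\<lambda>t. step_function N \<sigma> (n t))"
  unfolding evolves_def
proof (intro ballI allI impI)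
  fix t \<epsilon> :: real assume t: "t \<in> {0..T}" and \<epsilon>: "0 < \<epsilon>"
  from step_local[OF t \<epsilon>]
  show "\<forall>\<^sub>F r in at t within {0..T}. AE s in \<mu>.
    norm (step_function N \<sigma> (y r) s - step_function N \<sigma> (y t) s
        - (r - t) *\<^sub>R drift (step_function N \<sigma> (y t)) (step_function N \<sigma> (n t)) (step_function N \<sigma> (y t) s)) \<le> \<epsilon> * \<bar>r - t\<bar>
    \<and> \<bar>step_function N \<sigma> (n r) s - step_function N \<sigma> (n t) s
        - (r - t) * Psi \<a> \<s> s (step_function N \<sigma> (y t)) (step_function N \<sigma> (n t))\<bar> \<le> \<epsilon> * \<bar>r - t\<bar>"
  proof eventually_elim
    case (elim r)
    from AE_generic[OF N] show ?case by eventually_elim (use elim in blast)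
  qed
qed

lemma step_initial:
  assumes s: "s \<in> generic N"
  shows "step_function N \<sigma> (y 0) s = grid_average N x0 s"
    and "step_function N \<sigma> (n 0) s = grid_average N m0 s"
proof -
  have "inv_into (multi_indices N) \<sigma> (\<sigma> (grid_index N s)) = grid_index N s"
    using sigma grid_index_mem[OF N s] by (auto simp: bij_betw_def)
  then show "step_function N \<sigma> (y 0) s = grid_average N x0 s"
    and "step_function N \<sigma> (n 0) s = grid_average N m0 s"
    using step_generic_mem[OF s]
    by (simp_all add: step_function_generic[OF N s] grid_average_generic[OF N s] y_init n_init)
qed

end

text \<open>Integrability is part of the premises because the Bochner integral of a function that is
  not integrable is 0 and would say nothing about the extended norm.\<close>

lemma C_L1_norm_le:
  assumes "\<And>t. t \<in> {0..T} \<Longrightarrow> integrable \<mu> (\<lambda>s. norm (u t s))"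
    and "\<And>t. t \<in> {0..T} \<Longrightarrow> (LINT s|\<mu>. norm (u t s)) \<le> K"
  shows "C_L1_norm T u \<le> ennreal K"
  unfolding C_L1_norm_def
proof (rule SUP_least)
  fix t assume t: "t \<in> {0..T}"
  have "L1_norm (u t) = ennreal (LINT s|\<mu>. norm (u t s))"
    unfolding L1_norm_def using assms(1)[OF t] by (intro nn_integral_eq_integral) auto
  then show "L1_norm (u t) \<le> ennreal K" using assms(2)[OF t] by (simp add: ennreal_leI)
qed

theorem theorem5p1:
  fixes \<a> \<s> x0 :: "real ^ 'n \<Rightarrow> real ^ 'n"
    and m0 :: "real ^ 'n \<Rightarrow> real"
    and S :: "real ^ 'n \<Rightarrow> ennreal"
    and L L0 M X T :: real
    and x :: "real \<Rightarrow> real ^ 'n \<Rightarrow> real ^ 'n"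
    and m :: "real \<Rightarrow> real ^ 'n \<Rightarrow> real"
    and \<sigma> :: "nat \<Rightarrow> nat ^ 'n \<Rightarrow> nat"
    and xN :: "nat \<Rightarrow> real \<Rightarrow> nat \<Rightarrow> real ^ 'n"
    and mN :: "nat \<Rightarrow> real \<Rightarrow> nat \<Rightarrow> real"
  assumes d: "CARD('n) > 1"
    and T: "T > 0"
    and A1: "has_Lip \<a> L" "\<a> 0 = 0"
    and A2_m0: "m0 \<in> Linf_space"
      "(LINT s:cube|lebesgue. m0 s) = 1"
      "M > 1"
      "AE s in lebesgue_on cube. 1 / M \<le> m0 s \<and> m0 s \<le> M"
    and A2_x0: "X > 0" "\<forall>s\<in>cube. norm (x0 s) \<le> X"
      "L0 > 0"
      "\<forall>s1\<in>cube. \<forall>s2\<in>cube.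
         1 / L0 * norm (s1 - s2) \<le> norm (x0 s1 - x0 s2) \<and>
         norm (x0 s1 - x0 s2) \<le> L0 * norm (s1 - s2)"
    and A3: "\<s> \<in> borel_measurable lebesgue"
      "\<forall>z. \<s> (- z) = - \<s> z"
      "locally_integrable S"
      "\<forall>z1 z2. ennreal (norm (\<s> z1 - \<s> z2)) \<le> S z2 * ennreal (norm (z1 - z2))"
    and limit: "graph_limit_solution \<a> \<s> x0 m0 T x m"
    and sigma: "\<forall>N\<ge>1. bij_betw (\<sigma> N) (multi_indices N) {1..N ^ CARD('n)}"
    and flow: "\<forall>N\<ge>1. unique_particle_solution \<a> \<s> x0 m0 T N (\<sigma> N) (xN N) (mN N)"
  shows "(\<lambda>N. C_L1_norm T (\<lambda>t s. step_function N (\<sigma> N) (xN N t) s - x t s)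
            + C_L1_norm T (\<lambda>t s. step_function N (\<sigma> N) (mN N t) s - m t s))
         \<longlonglongrightarrow> 0"
proof -
  \<comment> \<open>Replacing \<open>S\<close> by a Borel majorant keeps the inequality for
    \<open>\<s>\<close> at every point and leaves the integrals over balls unchanged.\<close>
  obtain S' where S': "S' \<in> borel_measurable borel" "\<And>z. S z \<le> S' z" "AE z in lebesgue. S' z = S z"
    using A3(3) borel_majorant[of S] unfolding locally_integrable_def by blast
  interpret interaction \<a> \<s> S' L
  proof
    show "L-lipschitz_on UNIV \<a>" using A1(1) by (simp add: has_Lip_def)
    show "(\<integral>\<^sup>+z\<in>cball 0 r. S' z \<partial>lborel) < \<infinity>" for r
    proof -
      have "(\<integral>\<^sup>+z\<in>cball 0 r. S' z \<partial>lborel) = (\<integral>\<^sup>+z\<in>cball 0 r. S' z \<partial>lebesgue)"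
        by (rule nn_integral_completion[symmetric])
      also have "\<dots> = (\<integral>\<^sup>+z\<in>cball 0 r. S z \<partial>lebesgue)"
        using S'(3) by (intro nn_integral_cong_AE) auto
      also have "\<dots> < \<infinity>" using A3(3) by (simp add: locally_integrable_def)
      finally show ?thesis .
    qed
    show "ennreal (norm (\<s> z1 - \<s> z2)) \<le> S' z2 * ennreal (norm (z1 - z2))" for z1 z2
      using A3(4) S'(2)[of z2] by (meson mult_right_mono order_trans zero_le)
  qed (use A1(2) A3(2) S'(1) in auto)
  obtain R1 B1 c where c: "0 < c" and ev: "evolves T x m"
    and P1: "\<And>t. t \<in> {0..T} \<Longrightarrow> bounded_profile R1 B1 (x t) (m t)"
    and R1: "\<And>t s. t \<in> {0..T} \<Longrightarrow> s \<in> cube \<Longrightarrow> norm (x t s) \<le> R1"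
    and low: "\<And>t s1 s2. t \<in> {0..T} \<Longrightarrow> s1 \<in> cube \<Longrightarrow> s2 \<in> cube \<Longrightarrow> c * norm (s1 - s2) \<le> norm (x t s1 - x t s2)"
    using limit_solution_properties[OF limit T A2_x0(3)] A2_x0(4) by metis
  define R2 where "R2 = X * exp (2 * L * T)"
  obtain k where k: "\<And>z. norm z \<le> 2 * R2 \<Longrightarrow> norm (\<s> z) \<le> k" using s_bounded[of "2 * R2"] by blast
  define B2 where "B2 = M * exp (4 * L * R2 * k * T)"
  \<comment> \<open>Common bounds for the limit solution and for the particles of every
    \<open>N\<close>, so that one stability constant serves the whole sequence.\<close>
  define R B where "R = max R1 R2" and "B = max B1 B2"
  have x0_cont: "continuous_on cube x0"
  proof (rule lipschitz_on_continuous_on)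
    show "L0-lipschitz_on cube x0"
      using A2_x0(3,4) by (intro lipschitz_onI) (auto simp: dist_norm)
  qed
  have x0: "x0 \<in> borel_measurable \<mu>" "AE s in \<mu>. norm (x0 s) \<le> X"
    using continuous_imp_measurable_on_sets_lebesgue[OF x0_cont] A2_x0(2) by auto
  have m0_bound: "AE s in \<mu>. norm (m0 s) \<le> M"
    using A2_m0(4)
  proof eventually_elim
    case (elim s)
    have "0 < 1 / M" using A2_m0(3) by simp
    with elim show ?case unfolding real_norm_def by linarith
  qed
  have m0: "m0 \<in> borel_measurable \<mu>" using A2_m0(1) by (simp add: Linf_space_def)
  have m0_integrable: "integrable \<mu> m0" using m0_bound m0 by (rule cube.integrable_const_bound)
  have m0_int: "(LINT s|\<mu>. m0 s) = 1"
    using A2_m0(2) unfolding set_lebesgue_integral_def by (subst integral_restrict_space) auto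
  have x_init: "\<And>s. s \<in> cube \<Longrightarrow> x 0 s = x0 s" and m_init: "AE s in \<mu>. m 0 s = m0 s"
    using limit by (auto simp: graph_limit_solution_def)
  obtain C where "0 \<le> C" and stab: "\<And>f m g n. evolves T f m \<Longrightarrow> evolves T g n \<Longrightarrow>
      (\<forall>t\<in>{0..T}. bounded_profile R B (f t) (m t) \<and> bounded_profile R B (g t) (n t) \<and>
         (\<forall>s\<in>cube. norm (f t s) \<le> R) \<and>
         (\<forall>s\<in>cube. \<forall>s1\<in>cube. c * norm (s - s1) \<le> norm (f t s - f t s1)) \<and>
         (AE s in \<mu>. (\<lambda>s1. \<s> (g t s - g t s1)) \<in> borel_measurable \<mu>)) \<Longrightarrow>
      (\<forall>t\<in>{0..T}. (LINT s|\<mu>. norm (g t s - f t s)) + (LINT s|\<mu>. \<bar>n t s - m t s\<bar>)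
         \<le> ((LINT s|\<mu>. norm (g 0 s - f 0 s)) + (LINT s|\<mu>. \<bar>n 0 s - m 0 s\<bar>)) * exp (C * T))"
    using L1_stability[OF c T, of R B] by blast
  have P: "bounded_profile R B (x t) (m t)" if "t \<in> {0..T}" for t
    using P1[OF that] by (rule bounded_profile_mono) (auto simp: R_def B_def)
  have xR: "norm (x t s) \<le> R" if "t \<in> {0..T}" "s \<in> cube" for t s
    using R1[OF that] by (simp add: R_def)
  \<comment> \<open>The \<open>L1\<close> error of the initial data, which is the only source of
    error because the step functions solve the same evolution.\<close>
  define e where "e N = (LINT s|\<mu>. norm (grid_average N x0 s - x0 s)) + (LINT s|\<mu>. norm (grid_average N m0 s - m0 s))" for N
  \<comment> \<open>The factor 2 arises because stability bounds the sum of the distances at each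
    time, while the norms take the two suprema over time separately.\<close>
  have bound: "C_L1_norm T (\<lambda>t s. step_function N (\<sigma> N) (xN N t) s - x t s)
      + C_L1_norm T (\<lambda>t s. step_function N (\<sigma> N) (mN N t) s - m t s) \<le> ennreal (2 * (e N * exp (C * T)))"
    if N: "1 \<le> N" for N
  proof -
    interpret particle_flow \<a> \<s> S' L N "\<sigma> N" x0 m0 M X T "xN N" "mN N"
      by unfold_locales
        (use N sigma flow T x0 m0_integrable m0_int A2_m0 in \<open>auto simp: unique_particle_solution_def\<close>)
    let ?g = "\<lambda>t. step_function N (\<sigma> N) (xN N t)" and ?n = "\<lambda>t. step_function N (\<sigma> N) (mN N t)"
    have Q: "bounded_profile R B (?g t) (?n t)" if t: "t \<in> {0..T}" for t
    proof (rule step_bounded_profile)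
      show "norm (xN N t j) \<le> R" if "j \<in> idx" for j
        using y_bound[OF t that] by (simp add: R_def R2_def)
      show "\<bar>mN N t j\<bar> \<le> B" if "j \<in> idx" for j
        using n_bound[OF k[unfolded R2_def] t that] by (simp add: B_def B2_def R2_def)
    qed
    note int = bounded_profile_diff_integrable[OF P Q]
    have main: "(LINT s|\<mu>. norm (?g t s - x t s)) + (LINT s|\<mu>. \<bar>?n t s - m t s\<bar>) \<le> e N * exp (C * T)"
      if t: "t \<in> {0..T}" for t
    proof -
      have "(LINT s|\<mu>. norm (?g t s - x t s)) + (LINT s|\<mu>. \<bar>?n t s - m t s\<bar>)
        \<le> ((LINT s|\<mu>. norm (?g 0 s - x 0 s)) + (LINT s|\<mu>. \<bar>?n 0 s - m 0 s\<bar>)) * exp (C * T)"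
        by (rule bspec[OF stab[OF ev evolves_step] t])
          (use P Q xR low in \<open>simp add: s_step_measurable\<close>)
      also have "(LINT s|\<mu>. norm (?g 0 s - x 0 s)) = (LINT s|\<mu>. norm (grid_average N x0 s - x0 s))"
      proof (rule integral_cong_AE)
        show "(\<lambda>s. norm (?g 0 s - x 0 s)) \<in> borel_measurable \<mu>" using int(2)[of 0] T by auto
        show "(\<lambda>s. norm (grid_average N x0 s - x0 s)) \<in> borel_measurable \<mu>"
          using x0(1) grid_average_measurable[of N x0] by measurable
        show "AE s in \<mu>. norm (?g 0 s - x 0 s) = norm (grid_average N x0 s - x0 s)"
          using AE_generic[OF N]
          by eventually_elim (use x_init in \<open>auto simp: step_initial generic_def\<close>)
      qed
      also have "(LINT s|\<mu>. \<bar>?n 0 s - m 0 s\<bar>) = (LINT s|\<mu>. norm (grid_average N m0 s - m0 s))"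
      proof (rule integral_cong_AE)
        show "(\<lambda>s. \<bar>?n 0 s - m 0 s\<bar>) \<in> borel_measurable \<mu>" using int(1)[of 0] T by auto
        show "(\<lambda>s. norm (grid_average N m0 s - m0 s)) \<in> borel_measurable \<mu>"
          using m0 grid_average_measurable[of N m0] by measurable
        show "AE s in \<mu>. \<bar>?n 0 s - m 0 s\<bar> = norm (grid_average N m0 s - m0 s)"
          using AE_generic[OF N] m_init by eventually_elim (auto simp: step_initial)
      qed
      finally show ?thesis by (simp add: e_def)
    qed
    have gx: "C_L1_norm T (\<lambda>t s. ?g t s - x t s) \<le> ennreal (e N * exp (C * T))"
    proof (rule C_L1_norm_le)
      fix t assume t: "t \<in> {0..T}"
      show "integrable \<mu> (\<lambda>s. norm (?g t s - x t s))" using int(2)[OF t t] .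
      have "0 \<le> (LINT s|\<mu>. \<bar>?n t s - m t s\<bar>)" by simp
      then show "(LINT s|\<mu>. norm (?g t s - x t s)) \<le> e N * exp (C * T)" using main[OF t] by linarith
    qed
    have nm: "C_L1_norm T (\<lambda>t s. ?n t s - m t s) \<le> ennreal (e N * exp (C * T))"
    proof (rule C_L1_norm_le)
      fix t assume t: "t \<in> {0..T}"
      show "integrable \<mu> (\<lambda>s. norm (?n t s - m t s))" using int(1)[OF t t] by simp
      have "0 \<le> (LINT s|\<mu>. norm (?g t s - x t s))" by simp
      then show "(LINT s|\<mu>. norm (?n t s - m t s)) \<le> e N * exp (C * T)"
        unfolding real_norm_def using main[OF t] by linarith
    qed
    have "0 \<le> e N" by (simp add: e_def)
    then have "ennreal (2 * (e N * exp (C * T))) = ennreal (e N * exp (C * T)) + ennreal (e N * exp (C * T))"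
      by (subst ennreal_plus[symmetric]) auto
    with gx nm show ?thesis by (simp only: add_mono)
  qed
  have "e \<longlonglongrightarrow> 0 + 0"
    unfolding e_def[abs_def]
    by (intro tendsto_add grid_average_tendsto_L1[OF x0] grid_average_tendsto_L1[OF m0 m0_bound])
  then have "(\<lambda>N. 2 * (e N * exp (C * T))) \<longlonglongrightarrow> 2 * (0 * exp (C * T))"
    by (intro tendsto_intros) simp
  then have "(\<lambda>N. ennreal (2 * (e N * exp (C * T)))) \<longlonglongrightarrow> ennreal 0"
    by (intro tendsto_ennrealI) simp
  then have lim: "(\<lambda>N. ennreal (2 * (e N * exp (C * T)))) \<longlonglongrightarrow> 0" by simp
  show ?thesis
  proof (rule tendsto_sandwich[OF _ _ tendsto_const lim])
    show "\<forall>\<^sub>F N in sequentially. C_L1_norm T (\<lambda>t s. step_function N (\<sigma> N) (xN N t) s - x t s)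
      + C_L1_norm T (\<lambda>t s. step_function N (\<sigma> N) (mN N t) s - m t s) \<le> ennreal (2 * (e N * exp (C * T)))"
      using eventually_ge_at_top[of 1] by eventually_elim (rule bound)
  qed simp
qed

end
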